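(* Let $k$ be a field of characteristic $2$ and let $V_4$ be the Klein four group. A finite dimensional projective-free representation $M$ of $V_4$ over $k$ is even dimensional if and only if $\Omega(M) \cong M$ as $kV_4$-modules.
   Context: The Klein four group $V_4$ is the product of two cyclic groups of order two. A finite dimensional representation of $V_4$ over $k$ is a $kV_4$-module that is finite dimensional over $k$. It is projective-free if it has no non-zero projective direct summand. The Heller shift $\Omega(M)$ is the kernel of a minimal projective cover $P \to M$; it is well defined up to isomorphism.
   Formalization: "Even dimensional" is read as: every indecomposable direct summand of M has even dimension (the same as dim M even when M is indecomposable). Read literally the claim is false: M = k ⊕ k with trivial action has dimension 2, but Ω(M) has dimension 6. *)

theory Defs
  imports
    "HOL-Algebra.Elementary_Groups"
    "HOL-Algebra.Multiplicative_Group"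
    "Jordan_Normal_Form.Missing_VectorSpace"
begin

section \<open>The field and the group\<close>

text \<open>The additive order of the unit; \<^const>\<open>group.ord\<close> is 0 on elements of infinite order, so this
  is the usual characteristic.\<close>

definition characteristic :: "('k, 'e) ring_scheme \<Rightarrow> nat" where
  "characteristic K = group.ord (add_monoid K) \<one>\<^bsub>K\<^esub>"

definition klein_four :: "(int \<times> int) monoid" where
  "klein_four = integer_mod_group 2 \<times>\<times> integer_mod_group 2"

lemma comm_group_klein_four: "comm_group klein_four"
proof -
  have "group klein_four"
    unfolding klein_four_def by (intro DirProd_group group_integer_mod_group)
  then show ?thesis
    by (rule group.group_comm_groupI)
      (auto simp: klein_four_def DirProd_def carrier_integer_mod_group add.commute)
qed

lemma finite_klein_four: "finite (carrier klein_four)"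
  by (simp add: klein_four_def carrier_integer_mod_group)

section \<open>Group algebras\<close>

text \<open>For a finite group \<open>G\<close>, the element \<open>f\<close> stands for the formal sum of the \<open>f x \<cdot> x\<close> over
  \<open>x\<close> in \<open>G\<close>. The product is convolution.\<close>

definition group_algebra ::
    "('k, 'e) ring_scheme \<Rightarrow> ('g, 'd) monoid_scheme \<Rightarrow> ('g \<Rightarrow> 'k) ring" where
  "group_algebra K G =
    \<lparr>carrier = carrier G \<rightarrow>\<^sub>E carrier K,
     mult = (\<lambda>f h. \<lambda>x\<in>carrier G. \<Oplus>\<^bsub>K\<^esub>y\<in>carrier G. f y \<otimes>\<^bsub>K\<^esub> h (inv\<^bsub>G\<^esub> y \<otimes>\<^bsub>G\<^esub> x)),
     one = (\<lambda>x\<in>carrier G. if x = \<one>\<^bsub>G\<^esub> then \<one>\<^bsub>K\<^esub> else \<zero>\<^bsub>K\<^esub>),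
     zero = (\<lambda>x\<in>carrier G. \<zero>\<^bsub>K\<^esub>),
     add = (\<lambda>f h. \<lambda>x\<in>carrier G. f x \<oplus>\<^bsub>K\<^esub> h x)\<rparr>"

definition scalar :: "('k, 'e) ring_scheme \<Rightarrow> ('g, 'd) monoid_scheme \<Rightarrow> 'k \<Rightarrow> 'g \<Rightarrow> 'k" where
  "scalar K G c = (\<lambda>x\<in>carrier G. if x = \<one>\<^bsub>G\<^esub> then c else \<zero>\<^bsub>K\<^esub>)"

text \<open>Not needed to state anything below, but \<^locale>\<open>module\<close> asks for a commutative ring, so without
  this fact the notion of a module over the group algebra could be empty.\<close>

lemma group_algebra_cring:
  assumes "cring K" "comm_group G" "finite (carrier G)"
  shows "cring (group_algebra K G)"
proof -
  interpret K: cring K by fact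
  interpret G: comm_group G by fact
  let ?A = "group_algebra K G"
  let ?S = "carrier G"
  note fin = assms(3)
  have car: "f \<in> carrier ?A \<longleftrightarrow> f \<in> ?S \<rightarrow>\<^sub>E carrier K" for f
    by (simp add: group_algebra_def)
  have cl [simp]: "f x \<in> carrier K" if "f \<in> carrier ?A" "x \<in> ?S" for f x
    using that by (auto simp: car)
  have eqI: "f = h" if "f \<in> carrier ?A" "h \<in> carrier ?A" "\<And>x. x \<in> ?S \<Longrightarrow> f x = h x" for f h
    using that unfolding car by (meson PiE_ext)
  have add_app [simp]: "(f \<oplus>\<^bsub>?A\<^esub> h) x = f x \<oplus>\<^bsub>K\<^esub> h x" if "x \<in> ?S" for f h x
    using that by (simp add: group_algebra_def)
  have mult_app: "(f \<otimes>\<^bsub>?A\<^esub> h) x = (\<Oplus>\<^bsub>K\<^esub>y\<in>?S. f y \<otimes>\<^bsub>K\<^esub> h (inv\<^bsub>G\<^esub> y \<otimes>\<^bsub>G\<^esub> x))"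
    if "x \<in> ?S" for f h x
    using that by (simp add: group_algebra_def)
  have zero_app [simp]: "\<zero>\<^bsub>?A\<^esub> x = \<zero>\<^bsub>K\<^esub>" if "x \<in> ?S" for x
    using that by (simp add: group_algebra_def)
  have one_app [simp]: "\<one>\<^bsub>?A\<^esub> x = (if x = \<one>\<^bsub>G\<^esub> then \<one>\<^bsub>K\<^esub> else \<zero>\<^bsub>K\<^esub>)" if "x \<in> ?S" for x
    using that by (simp add: group_algebra_def)
  have add_cl [simp]: "f \<oplus>\<^bsub>?A\<^esub> h \<in> carrier ?A" if "f \<in> carrier ?A" "h \<in> carrier ?A" for f h
    using that by (auto simp: group_algebra_def PiE_iff)
  have mult_cl [simp]: "f \<otimes>\<^bsub>?A\<^esub> h \<in> carrier ?A" if "f \<in> carrier ?A" "h \<in> carrier ?A" for f h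
    unfolding car
  proof (intro PiE_I)
    fix x assume "x \<in> ?S"
    then show "(f \<otimes>\<^bsub>?A\<^esub> h) x \<in> carrier K"
      using that by (auto simp: mult_app intro!: K.finsum_closed)
  qed (simp add: group_algebra_def)
  have zero_cl [simp]: "\<zero>\<^bsub>?A\<^esub> \<in> carrier ?A" and one_cl [simp]: "\<one>\<^bsub>?A\<^esub> \<in> carrier ?A"
    by (auto simp: group_algebra_def)
  have comm: "f \<otimes>\<^bsub>?A\<^esub> h = h \<otimes>\<^bsub>?A\<^esub> f" if f: "f \<in> carrier ?A" and h: "h \<in> carrier ?A" for f h
  proof (rule eqI)
    fix x assume x: "x \<in> ?S"
    have flip: "inv\<^bsub>G\<^esub> (inv\<^bsub>G\<^esub> y \<otimes>\<^bsub>G\<^esub> x) \<otimes>\<^bsub>G\<^esub> x = y" if "y \<in> ?S" for y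
    proof -
      have "inv\<^bsub>G\<^esub> (inv\<^bsub>G\<^esub> y \<otimes>\<^bsub>G\<^esub> x) = y \<otimes>\<^bsub>G\<^esub> inv\<^bsub>G\<^esub> x"
        using that x by (simp add: G.inv_mult_group G.m_comm[of "inv\<^bsub>G\<^esub> x" y])
      then show ?thesis
        using that x by (simp add: G.m_assoc)
    qed
    have "(\<Oplus>\<^bsub>K\<^esub>y\<in>?S. f y \<otimes>\<^bsub>K\<^esub> h (inv\<^bsub>G\<^esub> y \<otimes>\<^bsub>G\<^esub> x))
        = (\<Oplus>\<^bsub>K\<^esub>y\<in>?S. h y \<otimes>\<^bsub>K\<^esub> f (inv\<^bsub>G\<^esub> y \<otimes>\<^bsub>G\<^esub> x))"
      by (rule K.finsum_reindex_bij_witness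
            [where i = "\<lambda>y. inv\<^bsub>G\<^esub> y \<otimes>\<^bsub>G\<^esub> x" and j = "\<lambda>y. inv\<^bsub>G\<^esub> y \<otimes>\<^bsub>G\<^esub> x"])
        (use f h x in \<open>auto simp: flip K.m_comm\<close>)
    then show "(f \<otimes>\<^bsub>?A\<^esub> h) x = (h \<otimes>\<^bsub>?A\<^esub> f) x"
      using x by (simp add: mult_app)
  qed (use that in simp_all)
  have assoc: "(f \<otimes>\<^bsub>?A\<^esub> g) \<otimes>\<^bsub>?A\<^esub> h = f \<otimes>\<^bsub>?A\<^esub> (g \<otimes>\<^bsub>?A\<^esub> h)"
    if f: "f \<in> carrier ?A" and g: "g \<in> carrier ?A" and h: "h \<in> carrier ?A" for f g h
  proof (rule eqI)
    fix x assume x: "x \<in> ?S"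
    let ?t = "\<lambda>z y. f y \<otimes>\<^bsub>K\<^esub> g (inv\<^bsub>G\<^esub> y \<otimes>\<^bsub>G\<^esub> z) \<otimes>\<^bsub>K\<^esub> h (inv\<^bsub>G\<^esub> z \<otimes>\<^bsub>G\<^esub> x)"
    have "((f \<otimes>\<^bsub>?A\<^esub> g) \<otimes>\<^bsub>?A\<^esub> h) x = (\<Oplus>\<^bsub>K\<^esub>z\<in>?S. \<Oplus>\<^bsub>K\<^esub>y\<in>?S. ?t z y)"
      using f g h x fin
      by (auto simp: mult_app intro!: K.finsum_cong' K.finsum_ldistr K.finsum_closed)
    also have "\<dots> = (\<Oplus>\<^bsub>K\<^esub>y\<in>?S. \<Oplus>\<^bsub>K\<^esub>z\<in>?S. ?t z y)"
      by (rule K.add.finprod_finprod_swap) (use f g h x fin in auto)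
    also have "\<dots> = (\<Oplus>\<^bsub>K\<^esub>y\<in>?S. f y \<otimes>\<^bsub>K\<^esub> (g \<otimes>\<^bsub>?A\<^esub> h) (inv\<^bsub>G\<^esub> y \<otimes>\<^bsub>G\<^esub> x))"
    proof (intro K.finsum_cong' refl)
      fix y assume y: "y \<in> ?S"
      let ?u = "\<lambda>w. g w \<otimes>\<^bsub>K\<^esub> h (inv\<^bsub>G\<^esub> w \<otimes>\<^bsub>G\<^esub> (inv\<^bsub>G\<^esub> y \<otimes>\<^bsub>G\<^esub> x))"
      have shift: "inv\<^bsub>G\<^esub> (y \<otimes>\<^bsub>G\<^esub> w) \<otimes>\<^bsub>G\<^esub> x = inv\<^bsub>G\<^esub> w \<otimes>\<^bsub>G\<^esub> (inv\<^bsub>G\<^esub> y \<otimes>\<^bsub>G\<^esub> x)"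
        "inv\<^bsub>G\<^esub> y \<otimes>\<^bsub>G\<^esub> (y \<otimes>\<^bsub>G\<^esub> w) = w" "y \<otimes>\<^bsub>G\<^esub> (inv\<^bsub>G\<^esub> y \<otimes>\<^bsub>G\<^esub> w) = w" if "w \<in> ?S" for w
        using that x y by (simp add: G.inv_mult_group G.m_assoc)
          (use that y in \<open>simp_all add: G.m_assoc [symmetric]\<close>)
      have "(\<Oplus>\<^bsub>K\<^esub>z\<in>?S. ?t z y) = (\<Oplus>\<^bsub>K\<^esub>w\<in>?S. f y \<otimes>\<^bsub>K\<^esub> ?u w)"
      proof (rule K.finsum_reindex_bij_witness
            [where i = "\<lambda>w. y \<otimes>\<^bsub>G\<^esub> w" and j = "\<lambda>z. inv\<^bsub>G\<^esub> y \<otimes>\<^bsub>G\<^esub> z"])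
        fix z assume z: "z \<in> ?S"
        then have "inv\<^bsub>G\<^esub> (inv\<^bsub>G\<^esub> y \<otimes>\<^bsub>G\<^esub> z) \<otimes>\<^bsub>G\<^esub> (inv\<^bsub>G\<^esub> y \<otimes>\<^bsub>G\<^esub> x) = inv\<^bsub>G\<^esub> z \<otimes>\<^bsub>G\<^esub> x"
          using shift(1)[of "inv\<^bsub>G\<^esub> y \<otimes>\<^bsub>G\<^esub> z"] shift(3)[of z] y by simp
        then show "f y \<otimes>\<^bsub>K\<^esub> ?u (inv\<^bsub>G\<^esub> y \<otimes>\<^bsub>G\<^esub> z) = ?t z y"
          using f g h x y z by (simp add: K.m_assoc)
      qed (use f g h x y shift in auto)
      also have "\<dots> = f y \<otimes>\<^bsub>K\<^esub> (\<Oplus>\<^bsub>K\<^esub>w\<in>?S. ?u w)"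
        by (rule K.finsum_rdistr [symmetric]) (use f g h x y fin in auto)
      finally show "(\<Oplus>\<^bsub>K\<^esub>z\<in>?S. ?t z y) = f y \<otimes>\<^bsub>K\<^esub> (g \<otimes>\<^bsub>?A\<^esub> h) (inv\<^bsub>G\<^esub> y \<otimes>\<^bsub>G\<^esub> x)"
        using x y by (simp add: mult_app)
    qed (use f g h x in auto)
    also have "\<dots> = (f \<otimes>\<^bsub>?A\<^esub> (g \<otimes>\<^bsub>?A\<^esub> h)) x"
      using x by (simp add: mult_app)
    finally show "((f \<otimes>\<^bsub>?A\<^esub> g) \<otimes>\<^bsub>?A\<^esub> h) x = (f \<otimes>\<^bsub>?A\<^esub> (g \<otimes>\<^bsub>?A\<^esub> h)) x" .
  qed (use that in simp_all)
  have one_l: "\<one>\<^bsub>?A\<^esub> \<otimes>\<^bsub>?A\<^esub> f = f" if f: "f \<in> carrier ?A" for f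
  proof (rule eqI)
    fix x assume x: "x \<in> ?S"
    have "(\<one>\<^bsub>?A\<^esub> \<otimes>\<^bsub>?A\<^esub> f) x = (\<Oplus>\<^bsub>K\<^esub>y\<in>?S. if \<one>\<^bsub>G\<^esub> = y then f (inv\<^bsub>G\<^esub> y \<otimes>\<^bsub>G\<^esub> x) else \<zero>\<^bsub>K\<^esub>)"
      unfolding mult_app[OF x] using f x by (intro K.finsum_cong') auto
    also have "\<dots> = f x"
      using K.finsum_singleton[of "\<one>\<^bsub>G\<^esub>" ?S "\<lambda>y. f (inv\<^bsub>G\<^esub> y \<otimes>\<^bsub>G\<^esub> x)"] f x fin by auto
    finally show "(\<one>\<^bsub>?A\<^esub> \<otimes>\<^bsub>?A\<^esub> f) x = f x" .
  qed (use that in simp_all)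
  have distr: "(f \<oplus>\<^bsub>?A\<^esub> g) \<otimes>\<^bsub>?A\<^esub> h = f \<otimes>\<^bsub>?A\<^esub> h \<oplus>\<^bsub>?A\<^esub> g \<otimes>\<^bsub>?A\<^esub> h"
    if f: "f \<in> carrier ?A" and g: "g \<in> carrier ?A" and h: "h \<in> carrier ?A" for f g h
  proof (rule eqI)
    fix x assume x: "x \<in> ?S"
    have "(\<Oplus>\<^bsub>K\<^esub>y\<in>?S. (f \<oplus>\<^bsub>?A\<^esub> g) y \<otimes>\<^bsub>K\<^esub> h (inv\<^bsub>G\<^esub> y \<otimes>\<^bsub>G\<^esub> x))
        = (\<Oplus>\<^bsub>K\<^esub>y\<in>?S. f y \<otimes>\<^bsub>K\<^esub> h (inv\<^bsub>G\<^esub> y \<otimes>\<^bsub>G\<^esub> x) \<oplus>\<^bsub>K\<^esub> g y \<otimes>\<^bsub>K\<^esub> h (inv\<^bsub>G\<^esub> y \<otimes>\<^bsub>G\<^esub> x))"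
      using f g h x by (intro K.finsum_cong') (auto simp: K.l_distr)
    also have "\<dots> = (\<Oplus>\<^bsub>K\<^esub>y\<in>?S. f y \<otimes>\<^bsub>K\<^esub> h (inv\<^bsub>G\<^esub> y \<otimes>\<^bsub>G\<^esub> x))
        \<oplus>\<^bsub>K\<^esub> (\<Oplus>\<^bsub>K\<^esub>y\<in>?S. g y \<otimes>\<^bsub>K\<^esub> h (inv\<^bsub>G\<^esub> y \<otimes>\<^bsub>G\<^esub> x))"
      by (rule K.finsum_addf) (use f g h x in auto)
    finally show "((f \<oplus>\<^bsub>?A\<^esub> g) \<otimes>\<^bsub>?A\<^esub> h) x = (f \<otimes>\<^bsub>?A\<^esub> h \<oplus>\<^bsub>?A\<^esub> g \<otimes>\<^bsub>?A\<^esub> h) x"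
      using x by (simp add: mult_app)
  qed (use that in simp_all)
  have "abelian_group ?A"
  proof (rule abelian_groupI)
    fix f assume f: "f \<in> carrier ?A"
    let ?n = "\<lambda>x\<in>?S. \<ominus>\<^bsub>K\<^esub> f x"
    have n: "?n \<in> carrier ?A" using f by (auto simp: car)
    have "?n \<oplus>\<^bsub>?A\<^esub> f = \<zero>\<^bsub>?A\<^esub>"
      by (rule eqI) (use f n in \<open>auto simp: K.l_neg\<close>)
    with n show "\<exists>y\<in>carrier ?A. y \<oplus>\<^bsub>?A\<^esub> f = \<zero>\<^bsub>?A\<^esub>" by blast
  qed (auto intro!: eqI simp: K.a_ac)
  moreover have "comm_monoid ?A"
    by (rule comm_monoidI) (fact mult_cl one_cl assoc one_l comm)+
  ultimately show ?thesis
    by (rule cringI) (fact distr)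
qed

section \<open>Modules\<close>

text \<open>Restriction of scalars from the group algebra to the field.\<close>

definition vector_space_of ::
    "('k, 'e) ring_scheme \<Rightarrow> ('g, 'd) monoid_scheme \<Rightarrow> ('g \<Rightarrow> 'k, 'm) module \<Rightarrow> ('k, 'm) module" where
  "vector_space_of K G M =
    \<lparr>carrier = carrier M, mult = mult M, one = one M, zero = zero M, add = add M,
     smult = (\<lambda>c v. scalar K G c \<odot>\<^bsub>M\<^esub> v)\<rparr>"

definition isomorphic_modules ::
    "('r, 'e) ring_scheme \<Rightarrow> ('r, 'm) module \<Rightarrow> ('r, 'n) module \<Rightarrow> bool" where
  "isomorphic_modules R M N \<longleftrightarrow> (\<exists>f\<in>module_hom R M N. bij_betw f (carrier M) (carrier N))"

text \<open>The lifting property. A definition cannot quantify over types, so the test modules live on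
  \<^typ>\<open>'p \<Rightarrow> 'r\<close> and \<^typ>\<open>'p\<close>. Nothing is lost: the free module on the set \<^term>\<open>carrier P\<close> lives on
  \<^typ>\<open>'p \<Rightarrow> 'r\<close>, lifting the identity along its projection onto \<open>P\<close> makes \<open>P\<close> a direct summand of it,
  and hence \<open>P\<close> has the lifting property with respect to modules on all types.\<close>

definition projective :: "('r, 'e) ring_scheme \<Rightarrow> ('r, 'p) module \<Rightarrow> bool" where
  "projective R P \<longleftrightarrow> module R P \<and>
    (\<forall>(N :: ('r, 'p \<Rightarrow> 'r) module) (L :: ('r, 'p) module) g f.
      mod_hom R N L g \<and> g ` carrier N = carrier L \<and> mod_hom R P L f \<longrightarrow>
      (\<exists>h\<in>module_hom R P N. \<forall>x\<in>carrier P. g (h x) = f x))"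

definition direct_summand :: "('r, 'e) ring_scheme \<Rightarrow> 'm set \<Rightarrow> ('r, 'm) module \<Rightarrow> bool" where
  "direct_summand R U M \<longleftrightarrow> submodule R U M \<and>
    (\<exists>W. submodule R W M \<and> U \<inter> W = {\<zero>\<^bsub>M\<^esub>} \<and> module.submodule_sum M U W = carrier M)"

definition indecomposable :: "('r, 'e) ring_scheme \<Rightarrow> ('r, 'm) module \<Rightarrow> bool" where
  "indecomposable R M \<longleftrightarrow> carrier M \<noteq> {\<zero>\<^bsub>M\<^esub>} \<and>
    (\<forall>U. direct_summand R U M \<longrightarrow> U = {\<zero>\<^bsub>M\<^esub>} \<or> U = carrier M)"

definition projective_free :: "('r, 'e) ring_scheme \<Rightarrow> ('r, 'm) module \<Rightarrow> bool" where
  "projective_free R M \<longleftrightarrow>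
    (\<forall>U. direct_summand R U M \<and> projective R (M\<lparr>carrier := U\<rparr>) \<longrightarrow> U = {\<zero>\<^bsub>M\<^esub>})"

text \<open>Minimality: no proper submodule of \<open>P\<close> is mapped onto \<open>M\<close>.\<close>

definition minimal_projective_cover ::
    "('r, 'e) ring_scheme \<Rightarrow> ('r, 'p) module \<Rightarrow> ('r, 'm) module \<Rightarrow> ('p \<Rightarrow> 'm) \<Rightarrow> bool" where
  "minimal_projective_cover R P M \<pi> \<longleftrightarrow>
    projective R P \<and> mod_hom R P M \<pi> \<and> \<pi> ` carrier P = carrier M \<and>
    (\<forall>U. submodule R U P \<and> \<pi> ` U = carrier M \<longrightarrow> U = carrier P)"

definition heller_shift :: "('r, 'p) module \<Rightarrow> ('r, 'm) module \<Rightarrow> ('p \<Rightarrow> 'm) \<Rightarrow> ('r, 'p) module" where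
  "heller_shift P M \<pi> = P\<lparr>carrier := mod_hom.ker P M \<pi>\<rparr>"

section \<open>Representations of the Klein four group\<close>

abbreviation kV4 :: "('k, 'e) ring_scheme \<Rightarrow> (int \<times> int \<Rightarrow> 'k) ring" where
  "kV4 K \<equiv> group_algebra K klein_four"

abbreviation kV4_fin_dim :: "('k, 'e) ring_scheme \<Rightarrow> (int \<times> int \<Rightarrow> 'k, 'm) module \<Rightarrow> bool" where
  "kV4_fin_dim K M \<equiv> vectorspace.fin_dim K (vector_space_of K klein_four M)"

abbreviation kV4_dim :: "('k, 'e) ring_scheme \<Rightarrow> (int \<times> int \<Rightarrow> 'k, 'm) module \<Rightarrow> nat" where
  "kV4_dim K M \<equiv> vectorspace.dim K (vector_space_of K klein_four M)"

text \<open>For a decomposable module, \<^emph>\<open>even dimensional\<close> is read summand by summand. Asking only for the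
  total dimension to be even would not characterise \<open>\<Omega>(M) \<cong> M\<close>: the trivial module \<open>M = k \<oplus> k\<close> is
  projective-free of dimension 2, while \<open>\<Omega>(M)\<close> is the sum of two copies of the augmentation ideal
  and has dimension 6. For indecomposable modules the two readings coincide.\<close>

definition even_dimensional :: "('k, 'e) ring_scheme \<Rightarrow> (int \<times> int \<Rightarrow> 'k, 'm) module \<Rightarrow> bool" where
  "even_dimensional K M \<longleftrightarrow>
    (\<forall>U. direct_summand (kV4 K) U M \<and> indecomposable (kV4 K) (M\<lparr>carrier := U\<rparr>) \<longrightarrow>
      even (kV4_dim K (M\<lparr>carrier := U\<rparr>)))"

lemma even_dimensional_indecomposable:
  assumes "module (kV4 K) M" "indecomposable (kV4 K) M"
  shows "even_dimensional K M \<longleftrightarrow> even (kV4_dim K M)"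
proof -
  interpret module "kV4 K" M by fact
  have self: "M\<lparr>carrier := carrier M\<rparr> = M" by simp
  have "submodule (kV4 K) (carrier M) M" "submodule (kV4 K) {\<zero>\<^bsub>M\<^esub>} M"
    using assms(1) by (auto simp: submodule_def)
  moreover have "submodule_sum (carrier M) {\<zero>\<^bsub>M\<^esub>} = carrier M"
    by (force simp: submodule_sum_def)
  ultimately have summand: "direct_summand (kV4 K) (carrier M) M"
    unfolding direct_summand_def by (intro conjI exI[of _ "{\<zero>\<^bsub>M\<^esub>}"]) auto
  have unique: "U = carrier M"
    if "direct_summand (kV4 K) U M" "indecomposable (kV4 K) (M\<lparr>carrier := U\<rparr>)" for U
    using that assms(2) by (auto simp: indecomposable_def)
  show ?thesis
  proof
    assume "even_dimensional K M"
    then have "even (kV4_dim K (M\<lparr>carrier := carrier M\<rparr>))"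
      using summand assms(2) unfolding even_dimensional_def self by (metis self)
    then show "even (kV4_dim K M)" unfolding self .
  next
    assume ev: "even (kV4_dim K M)"
    show "even_dimensional K M"
      unfolding even_dimensional_def
    proof (intro allI impI)
      fix U
      assume "direct_summand (kV4 K) U M \<and> indecomposable (kV4 K) (M\<lparr>carrier := U\<rparr>)"
      then have "U = carrier M" using unique by blast
      then show "even (kV4_dim K (M\<lparr>carrier := U\<rparr>))" using ev self by (simp only:)
    qed
  qed
qed

end

theory Submission
  imports Defs
begin

text \<open>
  Put \<open>X = g + 1\<close> and \<open>Y = h + 1\<close> for generators \<open>g\<close>, \<open>h\<close> of the Klein four group, so that the group
  algebra is \<open>k[X,Y]/(X\<^sup>2,Y\<^sup>2)\<close>. It is self-injective, hence \<open>XY\<close> kills a projective-free module \<open>M\<close>,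
  and \<open>M\<close> amounts to a pair of linear maps \<open>X, Y : A \<rightarrow> B\<close>, where \<open>B\<close> is the radical and \<open>A\<close> a
  complement of it. The minimal projective cover is free on \<open>A\<close>, and the Heller shift has
  \<open>{(a,a') | Xa + Ya' = 0}\<close> in place of \<open>A\<close> and \<open>A\<close> in place of \<open>B\<close>.

  If all summands of \<open>M\<close> have even dimension, then \<open>dim A' \<le> dim B'\<close> for all subpairs
  \<open>A' \<rightarrow> B'\<close>, with equality for \<open>A \<rightarrow> B\<close>: otherwise, shifting repeatedly (which preserves the parity
  of dimensions of summands) leads to a pair with a one-dimensional summand. A Fitting decomposition for
  the relation \<open>X\<^sup>-\<^sup>1Y\<close> then splits the pair into a part where \<open>Y\<close> is invertible and one where \<open>X\<close>
  is invertible, and each of these is isomorphic to its shift.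

  Conversely, the difference \<open>dim A - dim B\<close> does not decrease under the shift, while the
  dimension grows by twice this difference. If \<open>\<Omega>(M) \<cong> M\<close>, then no summand of \<open>M\<close> has a positive
  difference; the differences of complementary summands add up to 0, so all summands have
  \<open>dim A = dim B\<close>.
\<close>

section \<open>Linear algebra on subspaces\<close>

text \<open>Exactness of 0 -> A -> B + B -> C -> 0 gives dim A - dim B = dim B - dim C: passing to a
  neighbouring pair keeps the difference, and in one of the two directions a nonzero difference
  makes the dimensions drop at every step. Since they are natural numbers, the passage must become
  impossible at some point. Going on fails only if a vector is killed by both maps, going back fails
  only if the two images do not generate the target; the first yields a summand k -> 0, the second a
  summand 0 -> k. The same equation makes dim A + dim C even, which is why parities of summands
  survive a shift.

  The resulting bounds on subpairs drive the decomposition: if xS lies in yS, then S -> yS is a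
  subpair, so dim S <= dim yS and y is injective on S. Fitting's argument thus works for a relation
  instead of an endomorphism.

  In the converse direction the constants come from the cover of a summand U, which has dimension 4
  (dim U - dim rad U); its kernel has dimension 3 dim U - 4 dim rad U, that is, dim U + 2 (dim U - 2
  dim rad U).\<close>

definition vdim :: "'k ring \<Rightarrow> ('k, 'v) module \<Rightarrow> 'v set \<Rightarrow> nat" where
  "vdim K V W = vectorspace.dim K (V\<lparr>carrier := W\<rparr>)"

text \<open>Spaces are subsets of an ambient module, and finite dimension is asked of the subset:
  the ambient space may be infinite dimensional, as the space of sequences below is, while
  \<open>vectorspace.dim\<close> has its usual meaning in finite dimension.\<close>

definition fin_sub :: "'k ring \<Rightarrow> ('k, 'v) module \<Rightarrow> 'v set \<Rightarrow> bool" where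
  "fin_sub K V W \<longleftrightarrow> subspace K W V \<and> vectorspace.fin_dim K (V\<lparr>carrier := W\<rparr>)"

text \<open>Relative to a set, so that restriction leaves the function unchanged and one pair of
  maps serves a space, its subspaces and its summands.\<close>

definition linear_on :: "'k ring \<Rightarrow> ('k, 'v) module \<Rightarrow> ('k, 'w) module \<Rightarrow> 'v set \<Rightarrow> ('v \<Rightarrow> 'w) \<Rightarrow> bool" where
  "linear_on K V W A f \<longleftrightarrow> (\<forall>a\<in>A. f a \<in> carrier W) \<and>
    (\<forall>a\<in>A. \<forall>b\<in>A. f (a \<oplus>\<^bsub>V\<^esub> b) = f a \<oplus>\<^bsub>W\<^esub> f b) \<and>
    (\<forall>c\<in>carrier K. \<forall>a\<in>A. f (c \<odot>\<^bsub>V\<^esub> a) = c \<odot>\<^bsub>W\<^esub> f a)"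

definition plus_set :: "('k, 'v) module \<Rightarrow> 'v set \<Rightarrow> 'v set \<Rightarrow> 'v set" where
  "plus_set V A B = {a \<oplus>\<^bsub>V\<^esub> b | a b. a \<in> A \<and> b \<in> B}"

definition dir_sum :: "'k ring \<Rightarrow> ('k, 'v) module \<Rightarrow> 'v set \<Rightarrow> 'v set \<Rightarrow> 'v set \<Rightarrow> bool" where
  "dir_sum K V A A1 A2 \<longleftrightarrow> subspace K A1 V \<and> subspace K A2 V \<and> A1 \<inter> A2 = {\<zero>\<^bsub>V\<^esub>} \<and> A = plus_set V A1 A2"

lemma plus_setI: "a \<in> A \<Longrightarrow> b \<in> B \<Longrightarrow> a \<oplus>\<^bsub>V\<^esub> b \<in> plus_set V A B"
  by (auto simp: plus_set_def)

lemma plus_setE: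
  assumes "v \<in> plus_set V A B" 
  obtains a b where "a \<in> A" "b \<in> B" "v = a \<oplus>\<^bsub>V\<^esub> b"
  using assms by (auto simp: plus_set_def)

lemma subspaceI:
  assumes "vectorspace K V" "W \<subseteq> carrier V" "\<zero>\<^bsub>V\<^esub> \<in> W"
    "\<And>a b. a \<in> W \<Longrightarrow> b \<in> W \<Longrightarrow> a \<oplus>\<^bsub>V\<^esub> b \<in> W"
    "\<And>c a. c \<in> carrier K \<Longrightarrow> a \<in> W \<Longrightarrow> c \<odot>\<^bsub>V\<^esub> a \<in> W"
  shows "subspace K W V"
  using assms unfolding subspace_def submodule_def vectorspace_def by auto

lemma subspaceD:
  assumes "subspace K W V"
  shows "vectorspace K V" "\<And>a. a \<in> W \<Longrightarrow> a \<in> carrier V" "\<zero>\<^bsub>V\<^esub> \<in> W"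
    "\<And>a b. a \<in> W \<Longrightarrow> b \<in> W \<Longrightarrow> a \<oplus>\<^bsub>V\<^esub> b \<in> W"
    "\<And>c a. c \<in> carrier K \<Longrightarrow> a \<in> W \<Longrightarrow> c \<odot>\<^bsub>V\<^esub> a \<in> W"
    "\<And>a. a \<in> W \<Longrightarrow> \<ominus>\<^bsub>V\<^esub> a \<in> W"
    "\<And>a b. a \<in> W \<Longrightarrow> b \<in> W \<Longrightarrow> a \<ominus>\<^bsub>V\<^esub> b \<in> W"
proof -
  have vs: "vectorspace K V" and sm: "submodule K W V"
    using assms by (auto simp: subspace_def)
  show "vectorspace K V" by fact
  interpret V: vectorspace K V by fact
  interpret W: submodule K W V by fact
  show c: "a \<in> carrier V" if "a \<in> W" for a using that W.subset by auto
  show z: "\<zero>\<^bsub>V\<^esub> \<in> W" by simp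
  show a: "a \<oplus>\<^bsub>V\<^esub> b \<in> W" if "a \<in> W" "b \<in> W" for a b using that by simp
  show s: "c \<odot>\<^bsub>V\<^esub> a \<in> W" if "c \<in> carrier K" "a \<in> W" for a c using that by simp
  show n: "\<ominus>\<^bsub>V\<^esub> a \<in> W" if "a \<in> W" for a
    using s[OF V.R.a_inv_closed[OF V.R.one_closed] that] c[OF that] V.smult_minus_1 by simp
  show "a \<ominus>\<^bsub>V\<^esub> b \<in> W" if "a \<in> W" "b \<in> W" for a b
    using that a n by (simp add: a_minus_def)
qed

lemma subspace_carrier: "vectorspace K V \<Longrightarrow> subspace K (carrier V) V"
  by (rule subspaceI) (auto simp: vectorspace_def module_def module_axioms_def abelian_group_def abelian_monoid.a_closed abelian_monoid.zero_closed)

lemma subspace_zero: "vectorspace K V \<Longrightarrow> subspace K {\<zero>\<^bsub>V\<^esub>} V"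
proof -
  assume "vectorspace K V"
  then interpret V: vectorspace K V .
  show ?thesis by (rule subspaceI) (auto intro: V.vectorspace_axioms)
qed

lemma subspace_Int: "subspace K A V \<Longrightarrow> subspace K B V \<Longrightarrow> subspace K (A \<inter> B) V"
  by (rule subspaceI) (auto dest: subspaceD)

lemma subspace_plus:
  assumes A: "subspace K A V" and B: "subspace K B V"
  shows "subspace K (plus_set V A B) V"
proof -
  interpret V: vectorspace K V using A by (rule subspaceD)
  note [simp] = subspaceD[OF A] subspaceD[OF B]
  show ?thesis
  proof (rule subspaceI)
    show "vectorspace K V" by (rule V.vectorspace_axioms)
    show "plus_set V A B \<subseteq> carrier V" by (auto simp: plus_set_def)
    show "\<zero>\<^bsub>V\<^esub> \<in> plus_set V A B"
      using plus_setI[OF subspaceD(3)[OF A] subspaceD(3)[OF B], of V] by simp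
  next
    fix a b assume "a \<in> plus_set V A B" "b \<in> plus_set V A B"
    then obtain a1 a2 b1 b2 where *: "a1 \<in> A" "a2 \<in> B" "b1 \<in> A" "b2 \<in> B"
      and "a = a1 \<oplus>\<^bsub>V\<^esub> a2" "b = b1 \<oplus>\<^bsub>V\<^esub> b2" by (auto simp: plus_set_def)
    then have "a \<oplus>\<^bsub>V\<^esub> b = (a1 \<oplus>\<^bsub>V\<^esub> b1) \<oplus>\<^bsub>V\<^esub> (a2 \<oplus>\<^bsub>V\<^esub> b2)"
      by (simp add: V.M.a_ac)
    with * show "a \<oplus>\<^bsub>V\<^esub> b \<in> plus_set V A B" by (simp add: plus_setI)
  next
    fix c a assume c: "c \<in> carrier K" and "a \<in> plus_set V A B"
    then obtain a1 a2 where *: "a1 \<in> A" "a2 \<in> B" and "a = a1 \<oplus>\<^bsub>V\<^esub> a2"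
      by (auto simp: plus_set_def)
    then have "c \<odot>\<^bsub>V\<^esub> a = (c \<odot>\<^bsub>V\<^esub> a1) \<oplus>\<^bsub>V\<^esub> (c \<odot>\<^bsub>V\<^esub> a2)"
      using c by (simp add: V.smult_r_distr)
    with * c show "c \<odot>\<^bsub>V\<^esub> a \<in> plus_set V A B" by (simp add: plus_setI)
  qed
qed

lemma plus_set_upper:
  assumes A: "subspace K A V" and B: "subspace K B V"
  shows "A \<subseteq> plus_set V A B" "B \<subseteq> plus_set V A B"
proof -
  interpret V: vectorspace K V using A by (rule subspaceD)
  show "A \<subseteq> plus_set V A B" unfolding plus_set_def
    using subspaceD[OF A] subspaceD(3)[OF B] by (auto intro: V.M.r_zero[symmetric])
  show "B \<subseteq> plus_set V A B" unfolding plus_set_def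
    using subspaceD[OF B] subspaceD(3)[OF A] by (auto intro: V.M.l_zero[symmetric])
qed

lemma plus_set_least: "subspace K C V \<Longrightarrow> A \<subseteq> C \<Longrightarrow> B \<subseteq> C \<Longrightarrow> plus_set V A B \<subseteq> C"
  by (auto simp: plus_set_def intro: subspaceD(4))

lemma plus_set_commute:
  assumes A: "subspace K A V" and B: "subspace K B V"
  shows "plus_set V A B = plus_set V B A"
  by (intro equalityI plus_set_least[of K] subspace_plus plus_set_upper[of K] A B)

lemma fin_subD:
  assumes "fin_sub K V W"
  shows "subspace K W V" "vectorspace K V" "vectorspace K (V\<lparr>carrier := W\<rparr>)"
    "vectorspace.fin_dim K (V\<lparr>carrier := W\<rparr>)"
  using assms subspaceD(1)[of K W V] vectorspace.subspace_is_vs[of K V W] unfolding fin_sub_def by auto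

lemma fin_sub_iff_span:
  assumes "vectorspace K V"
  shows "fin_sub K V W \<longleftrightarrow> (\<exists>S. finite S \<and> S \<subseteq> carrier V \<and> W = module.span K V S)"
proof -
  interpret V: vectorspace K V by fact
  show ?thesis
  proof
    assume W: "fin_sub K V W"
    interpret W: vectorspace K "V\<lparr>carrier := W\<rparr>" using W by (rule fin_subD)
    obtain S where S: "finite S" "S \<subseteq> W" "W.span S = W"
      using fin_subD(4)[OF W] unfolding W.fin_dim_def by auto
    have "W.span S = V.span S"
      using V.span_li_not_depend(1)[OF S(2)] fin_subD(1)[OF W] by simp
    with S show "\<exists>S. finite S \<and> S \<subseteq> carrier V \<and> W = V.span S"
      using subspaceD(2)[OF fin_subD(1)[OF W]] by blast
  next
    assume "\<exists>S. finite S \<and> S \<subseteq> carrier V \<and> W = V.span S"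
    then obtain S where S: "finite S" "S \<subseteq> carrier V" "W = V.span S" by auto
    have sub: "subspace K W V" using S V.span_is_subspace by auto
    interpret W: vectorspace K "V\<lparr>carrier := W\<rparr>" using V.subspace_is_vs[OF sub] .
    have SW: "S \<subseteq> W" using S V.in_own_span by auto
    have "W.span S = W" 
      using V.span_li_not_depend(1)[OF SW] sub S by simp
    then have "W.fin_dim" unfolding W.fin_dim_def using S SW by auto
    then show "fin_sub K V W" using sub by (simp add: fin_sub_def)
  qed
qed

text \<open>Independent subsets of \<open>A\<close> are independent in \<open>B\<close>, so they
  have at most dim B elements and a maximal one exists; it is a basis of \<open>A\<close>. If it has
  dim B elements, it is a basis of \<open>B\<close> as well, whence the last clause.\<close>

lemma fin_sub_basis:
  assumes A: "subspace K A V" and B: "fin_sub K V B" and AB: "A \<subseteq> B"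
  obtains S where "finite S" "S \<subseteq> A" "\<not> module.lin_dep K V S" "module.span K V S = A"
    "card S = vdim K V A" "card S \<le> vdim K V B" "fin_sub K V A"
    "card S = vdim K V B \<Longrightarrow> A = B"
proof -
  interpret V: vectorspace K V using A by (rule subspaceD)
  interpret VB: vectorspace K "V\<lparr>carrier := B\<rparr>" using B by (rule fin_subD)
  interpret VA: vectorspace K "V\<lparr>carrier := A\<rparr>" using A V.subspace_is_vs by blast
  have subA: "submodule K A V" and subB: "submodule K B V" using A fin_subD(1)[OF B] by auto
  have li: "VB.lin_dep S = V.lin_dep S" "VA.lin_dep S = V.lin_dep S" "VB.span S = V.span S" "VA.span S = V.span S"
    if "S \<subseteq> A" for S
    using V.span_li_not_depend[OF _ subA, of S] V.span_li_not_depend[OF _ subB, of S] that AB by auto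
  have fin: "finite S \<and> card S \<le> VB.dim" if "S \<subseteq> A \<and> \<not> V.lin_dep S" for S
    using VB.li_le_dim[of S] fin_subD(4)[OF B] that AB li[of S] by auto
  have "V.lin_indpt {}" by (simp add: V.lin_dep_def)
  then obtain S where S: "finite S" "maximal S (\<lambda>S. S \<subseteq> A \<and> \<not> V.lin_dep S)"
    using maximal_exists[of "\<lambda>S. S \<subseteq> A \<and> \<not> V.lin_dep S" VB.dim "{}", OF fin] by auto
  have SA: "S \<subseteq> A" "\<not> V.lin_dep S" using S by (auto simp: maximal_def)
  have "maximal S (\<lambda>S. S \<subseteq> carrier (V\<lparr>carrier := A\<rparr>) \<and> \<not> VA.lin_dep S)"
    using S(2) by (simp add: li(2) cong: conj_cong)
  then have bas: "VA.basis S" by (rule VA.max_li_is_basis)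
  have span: "V.span S = A" using bas SA li by (auto simp: VA.basis_def)
  have card: "card S = VA.dim" using VA.dim_basis[OF S(1) bas] by simp
  have "VA.fin_dim" using VA.fin_dim_def bas S(1) by (auto simp: VA.basis_def)
  moreover have "A = B" if "card S = vdim K V B"
  proof -
    have "VB.basis S"
      by (rule VB.dim_li_is_basis) (use fin_subD(4)[OF B] S(1) SA AB that li(1)[OF SA(1)] in \<open>auto simp: vdim_def\<close>)
    then show ?thesis using span SA li by (auto simp: VB.basis_def)
  qed
  ultimately show thesis
    using that S(1) SA span card fin[of S] A by (auto simp: vdim_def fin_sub_def)
qed

lemma fin_sub_mono:
  assumes "fin_sub K V B" "subspace K A V" "A \<subseteq> B"
  shows "fin_sub K V A" "vdim K V A \<le> vdim K V B"
  using fin_sub_basis[OF assms(2,1,3)] by metis+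

lemma subspace_eqI:
  assumes "fin_sub K V B" "subspace K A V" "A \<subseteq> B" "vdim K V B \<le> vdim K V A"
  shows "A = B"
  using fin_sub_basis[OF assms(2,1,3)] assms(4) by (metis order.antisym)

lemma fin_sub_plus:
  assumes A: "fin_sub K V A" and B: "fin_sub K V B"
  shows "fin_sub K V (plus_set V A B)"
proof -
  interpret V: vectorspace K V using A by (rule fin_subD)
  note iff = fin_sub_iff_span[OF V.vectorspace_axioms]
  obtain S T where "finite S" "S \<subseteq> carrier V" "A = V.span S" "finite T" "T \<subseteq> carrier V" "B = V.span T"
    using A B by (auto simp: iff)
  then show ?thesis
    unfolding iff using V.span_union_is_sum[of S T]
    by (intro exI[of _ "S \<union> T"]) (auto simp: plus_set_def V.submodule_sum_def)
qed

lemma vdim_zero: "vectorspace K V \<Longrightarrow> vdim K V {\<zero>\<^bsub>V\<^esub>} = 0"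
  and fin_sub_zero: "vectorspace K V \<Longrightarrow> fin_sub K V {\<zero>\<^bsub>V\<^esub>}"
proof -
  assume "vectorspace K V"
  then interpret V: vectorspace K V .
  have fs: "fin_sub K V {\<zero>\<^bsub>V\<^esub>}"
    unfolding fin_sub_iff_span[OF V.vectorspace_axioms] using V.span_empty by (intro exI[of _ "{}"]) auto
  interpret Z: vectorspace K "V\<lparr>carrier := {\<zero>\<^bsub>V\<^esub>}\<rparr>" using fs by (rule fin_subD)
  have "Z.dim = 0" by (rule Z.dim0I) (use Z.span_closed Z.span_zero in \<open>auto\<close>)
  then show "vdim K V {\<zero>\<^bsub>V\<^esub>} = 0" by (simp add: vdim_def)
  show "fin_sub K V {\<zero>\<^bsub>V\<^esub>}" by fact
qed

lemma vdim_eq_0_iff: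
  assumes "fin_sub K V A"
  shows "vdim K V A = 0 \<longleftrightarrow> A = {\<zero>\<^bsub>V\<^esub>}"
proof -
  note D = fin_subD[OF assms]
  show ?thesis
    using subspace_eqI[OF assms subspace_zero[OF D(2)]] subspaceD(3)[OF D(1)] vdim_zero[OF D(2)] by auto
qed

lemma vdim_line:
  assumes V: "vectorspace K V" and v: "v \<in> carrier V" "v \<noteq> \<zero>\<^bsub>V\<^esub>"
  defines "L \<equiv> {c \<odot>\<^bsub>V\<^esub> v | c. c \<in> carrier K}"
  shows "fin_sub K V L" "vdim K V L = 1" "v \<in> L"
proof -
  interpret V: vectorspace K V by fact
  have sp: "V.span {v} = L"
  proof -
    have eq: "V.lincomb a {v} = a v \<odot>\<^bsub>V\<^esub> v" if "a v \<in> carrier K" for a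
      using that v by (simp add: V.lincomb_def)
    have "V.span {v} = {V.lincomb a {v} | a. a \<in> {v} \<rightarrow> carrier K}"
      using v by (intro V.finite_span) auto
    also have "\<dots> = L"
      unfolding L_def
    proof (intro equalityI subsetI; clarify)
      fix a assume "a \<in> {v} \<rightarrow> carrier K"
      then show "\<exists>c. V.lincomb a {v} = c \<odot>\<^bsub>V\<^esub> v \<and> c \<in> carrier K" using eq[of a] by blast
    next
      fix c assume "c \<in> carrier K"
      then show "\<exists>a. c \<odot>\<^bsub>V\<^esub> v = V.lincomb a {v} \<and> a \<in> {v} \<rightarrow> carrier K"
        using eq[of "\<lambda>_. c"] by (intro exI[of _ "\<lambda>_. c"]) auto
    qed
    finally show ?thesis .
  qed
  show fs: "fin_sub K V L"
    unfolding fin_sub_iff_span[OF V] using sp v by (intro exI[of _ "{v}"]) auto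
  show vL: "v \<in> L" unfolding L_def using v V.smult_one[of v] V.R.one_closed by force
  interpret L: vectorspace K "V\<lparr>carrier := L\<rparr>" using fs by (rule fin_subD)
  have "L.span {v} = L" using V.span_li_not_depend(1)[of "{v}" L] vL fin_subD(1)[OF fs] sp by simp
  then show "vdim K V L = 1" unfolding vdim_def using vL v by (intro L.dim1I) auto
qed

section \<open>Linear maps on subspaces; rank and nullity\<close>

lemma linear_onD:
  assumes "linear_on K V W A f"
  shows "\<And>a. a \<in> A \<Longrightarrow> f a \<in> carrier W"
    "\<And>a b. a \<in> A \<Longrightarrow> b \<in> A \<Longrightarrow> f (a \<oplus>\<^bsub>V\<^esub> b) = f a \<oplus>\<^bsub>W\<^esub> f b"
    "\<And>c a. c \<in> carrier K \<Longrightarrow> a \<in> A \<Longrightarrow> f (c \<odot>\<^bsub>V\<^esub> a) = c \<odot>\<^bsub>W\<^esub> f a"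
  using assms by (auto simp: linear_on_def)

lemma linear_on_subset: "linear_on K V W A f \<Longrightarrow> B \<subseteq> A \<Longrightarrow> linear_on K V W B f"
  unfolding linear_on_def by blast

lemma linear_on_map:
  assumes A: "subspace K A V" and W: "vectorspace K W" and f: "linear_on K V W A f"
  shows "linear_map K (V\<lparr>carrier := A\<rparr>) W f"
proof -
  interpret W: vectorspace K W by fact
  interpret V: vectorspace K V using A by (rule subspaceD)
  interpret A: vectorspace K "V\<lparr>carrier := A\<rparr>" using V.subspace_is_vs[OF A] .
  show ?thesis by unfold_locales (use f in \<open>auto simp: module_hom_def linear_on_def\<close>)
qed

lemma linear_on_zero:
  assumes A: "subspace K A V" and W: "vectorspace K W" and f: "linear_on K V W A f"
  shows "f \<zero>\<^bsub>V\<^esub> = \<zero>\<^bsub>W\<^esub>"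
  and "\<And>a. a \<in> A \<Longrightarrow> f (\<ominus>\<^bsub>V\<^esub> a) = \<ominus>\<^bsub>W\<^esub> f a"
  and "\<And>a b. a \<in> A \<Longrightarrow> b \<in> A \<Longrightarrow> f (a \<ominus>\<^bsub>V\<^esub> b) = f a \<ominus>\<^bsub>W\<^esub> f b"
proof -
  interpret W: vectorspace K W by fact
  interpret V: vectorspace K V using A by (rule subspaceD)
  note S = subspaceD[OF A] and L = linear_onD[OF f]
  show z: "f \<zero>\<^bsub>V\<^esub> = \<zero>\<^bsub>W\<^esub>" 
    using L(2)[OF S(3) S(3)] L(1)[OF S(3)] by (simp add: W.add.l_cancel_one)
  show n: "f (\<ominus>\<^bsub>V\<^esub> a) = \<ominus>\<^bsub>W\<^esub> f a" if "a \<in> A" for a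
    using L(2)[OF S(6)[OF that] that] z S(2) that L(1) S(6)
    by (intro W.M.minus_equality[symmetric]) (auto simp: V.M.l_neg)
  show "f (a \<ominus>\<^bsub>V\<^esub> b) = f a \<ominus>\<^bsub>W\<^esub> f b" if "a \<in> A" "b \<in> A" for a b
    using L(2)[OF that(1) S(6)[OF that(2)]] n[OF that(2)] by (simp add: a_minus_def)
qed

lemma subspace_image:
  assumes A: "subspace K A V" and W: "vectorspace K W" and f: "linear_on K V W A f"
  shows "subspace K (f ` A) W" 
proof (rule subspaceI)
  note L = linear_onD[OF f] and S = subspaceD[OF A]
  show "\<zero>\<^bsub>W\<^esub> \<in> f ` A" using linear_on_zero(1)[OF assms] S(3) by force
  show "a \<oplus>\<^bsub>W\<^esub> b \<in> f ` A" if "a \<in> f ` A" "b \<in> f ` A" for a b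
    using that S(4) L(2) by (metis (no_types, lifting) imageE imageI)
  show "c \<odot>\<^bsub>W\<^esub> a \<in> f ` A" if "c \<in> carrier K" "a \<in> f ` A" for a c
    using that S(5) L(3) by (metis (no_types, lifting) imageE imageI)
qed (use assms in \<open>auto simp: linear_on_def\<close>)

lemma subspace_vimage:
  assumes A: "subspace K A V" and B: "subspace K B W" and f: "linear_on K V W A f"
  shows "subspace K {a \<in> A. f a \<in> B} V"
proof (rule subspaceI)
  note L = linear_onD[OF f] and S = subspaceD[OF A] and T = subspaceD[OF B]
  show "\<zero>\<^bsub>V\<^esub> \<in> {a \<in> A. f a \<in> B}" using linear_on_zero(1)[OF A T(1) f] S(3) T(3) by simp
qed (use subspaceD[OF A] subspaceD[OF B] linear_onD[OF f] in auto)

lemma rank_nullity: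
  assumes A: "fin_sub K V A" and W: "vectorspace K W" and f: "linear_on K V W A f"
  shows "fin_sub K W (f ` A)" "vdim K W (f ` A) + vdim K V {a \<in> A. f a = \<zero>\<^bsub>W\<^esub>} = vdim K V A"
proof -
  note sA = fin_subD[OF A]
  interpret W: vectorspace K W by fact
  have I: "subspace K (f ` A) W" by (rule subspace_image[OF sA(1) W f])
  interpret I: vectorspace K "W\<lparr>carrier := f ` A\<rparr>" using W.subspace_is_vs[OF I] .
  have "linear_on K V (W\<lparr>carrier := f ` A\<rparr>) A f" using f by (auto simp: linear_on_def)
  from linear_on_map[OF sA(1) I.vectorspace_axioms this]
  interpret T: linear_map K "V\<lparr>carrier := A\<rparr>" "W\<lparr>carrier := f ` A\<rparr>" f .
  note rn = T.rank_nullity_main[OF sA(4)]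
  show "fin_sub K W (f ` A)" using rn(2) I by (simp add: fin_sub_def)
  show "vdim K W (f ` A) + vdim K V {a \<in> A. f a = \<zero>\<^bsub>W\<^esub>} = vdim K V A"
    using rn(1) by (simp add: T.im_def T.ker_def vdim_def)
qed

lemma linear_on_inj_iff:
  assumes A: "subspace K A V" and W: "vectorspace K W" and f: "linear_on K V W A f"
  shows "inj_on f A \<longleftrightarrow> (\<forall>a\<in>A. f a = \<zero>\<^bsub>W\<^esub> \<longrightarrow> a = \<zero>\<^bsub>V\<^esub>)"
proof -
  interpret W: vectorspace K W by fact
  interpret V: vectorspace K V using A by (rule subspaceD)
  note S = subspaceD[OF A] and L = linear_onD[OF f] and z = linear_on_zero[OF A W f]
  have "a = b" if "a \<in> A" "b \<in> A" "f a = f b" "\<forall>a\<in>A. f a = \<zero>\<^bsub>W\<^esub> \<longrightarrow> a = \<zero>\<^bsub>V\<^esub>" for a b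
  proof -
    have "f (a \<ominus>\<^bsub>V\<^esub> b) = \<zero>\<^bsub>W\<^esub>" using that z(3)[of a b] L(1) by simp
    then have "a \<ominus>\<^bsub>V\<^esub> b = \<zero>\<^bsub>V\<^esub>" using that S(7) by blast
    then show ?thesis using that S(2) by simp
  qed
  moreover have "a = \<zero>\<^bsub>V\<^esub>" if "inj_on f A" "a \<in> A" "f a = \<zero>\<^bsub>W\<^esub>" for a
    using that z(1) S(3) by (metis inj_onD)
  ultimately show ?thesis by (meson inj_onI)
qed

lemma vdim_image_inj:
  assumes A: "fin_sub K V A" and W: "vectorspace K W" and f: "linear_on K V W A f" and "inj_on f A"
  shows "vdim K W (f ` A) = vdim K V A"
proof -
  note sA = fin_subD[OF A]
  have "{a \<in> A. f a = \<zero>\<^bsub>W\<^esub>} = {\<zero>\<^bsub>V\<^esub>}"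
    using linear_on_inj_iff[OF sA(1) W f] \<open>inj_on f A\<close> linear_on_zero(1)[OF sA(1) W f] subspaceD(3)[OF sA(1)] by blast
  then show ?thesis using rank_nullity(2)[OF A W f] vdim_zero[OF sA(2)] by simp
qed

text \<open>Rank and nullity leave dimension 0 for the kernel. This is how bounds on the dimensions
  of subpairs become injectivity.\<close>

lemma inj_on_if_vdim_le:
  assumes A: "fin_sub K V A" and W: "vectorspace K W" and f: "linear_on K V W A f"
    and le: "vdim K V A \<le> vdim K W (f ` A)"
  shows "inj_on f A"
proof -
  note sA = fin_subD[OF A]
  have k: "subspace K {a \<in> A. f a = \<zero>\<^bsub>W\<^esub>} V"
    using subspace_vimage[OF sA(1) subspace_zero[OF W] f] by simp
  have "vdim K V {a \<in> A. f a = \<zero>\<^bsub>W\<^esub>} = 0" using rank_nullity(2)[OF A W f] le by simp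
  moreover have "fin_sub K V {a \<in> A. f a = \<zero>\<^bsub>W\<^esub>}" by (rule fin_sub_mono(1)[OF A k]) auto
  ultimately have "{a \<in> A. f a = \<zero>\<^bsub>W\<^esub>} = {\<zero>\<^bsub>V\<^esub>}" by (simp add: vdim_eq_0_iff)
  then show ?thesis unfolding linear_on_inj_iff[OF sA(1) W f] by blast
qed

lemma vectorspace_add_diff:
  assumes "vectorspace K V" "a \<in> carrier V" "b \<in> carrier V"
  shows "(a \<oplus>\<^bsub>V\<^esub> b) \<ominus>\<^bsub>V\<^esub> a = b" "(a \<oplus>\<^bsub>V\<^esub> b) \<ominus>\<^bsub>V\<^esub> b = a" "(a \<ominus>\<^bsub>V\<^esub> b) \<oplus>\<^bsub>V\<^esub> b = a"
proof -
  interpret V: vectorspace K V by fact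
  have "a \<oplus>\<^bsub>V\<^esub> (b \<oplus>\<^bsub>V\<^esub> \<ominus>\<^bsub>V\<^esub> b) = a" "b \<oplus>\<^bsub>V\<^esub> (a \<oplus>\<^bsub>V\<^esub> \<ominus>\<^bsub>V\<^esub> a) = b" "a \<oplus>\<^bsub>V\<^esub> (\<ominus>\<^bsub>V\<^esub> b \<oplus>\<^bsub>V\<^esub> b) = a"
    using assms by (auto simp: V.M.r_neg V.M.l_neg)
  then show "(a \<oplus>\<^bsub>V\<^esub> b) \<ominus>\<^bsub>V\<^esub> a = b" "(a \<oplus>\<^bsub>V\<^esub> b) \<ominus>\<^bsub>V\<^esub> b = a" "(a \<ominus>\<^bsub>V\<^esub> b) \<oplus>\<^bsub>V\<^esub> b = a"
    using assms V.M.a_comm[of a b] by (metis a_minus_def V.M.a_assoc V.M.a_inv_closed)+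
qed

lemma vectorspace_minus_cancel:
  assumes "vectorspace K V" "a \<in> carrier V" "b \<in> carrier V" "c \<in> carrier V" "d \<in> carrier V"
  shows "a \<oplus>\<^bsub>V\<^esub> b = c \<oplus>\<^bsub>V\<^esub> d \<longleftrightarrow> a \<ominus>\<^bsub>V\<^esub> c = d \<ominus>\<^bsub>V\<^esub> b"
proof -
  interpret V: vectorspace K V by fact
  have "(a \<ominus>\<^bsub>V\<^esub> c) \<oplus>\<^bsub>V\<^esub> (c \<oplus>\<^bsub>V\<^esub> b) = a \<oplus>\<^bsub>V\<^esub> b"
    using assms by (simp add: a_minus_def V.M.a_assoc V.M.r_neg1)
  moreover have "(d \<ominus>\<^bsub>V\<^esub> b) \<oplus>\<^bsub>V\<^esub> (c \<oplus>\<^bsub>V\<^esub> b) = c \<oplus>\<^bsub>V\<^esub> d"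
    using assms V.M.a_comm[of c b] V.M.a_comm[of c d] by (simp add: a_minus_def V.M.a_assoc V.M.r_neg1)
  ultimately show ?thesis using assms V.add.right_cancel[of "c \<oplus>\<^bsub>V\<^esub> b" "a \<ominus>\<^bsub>V\<^esub> c" "d \<ominus>\<^bsub>V\<^esub> b"]
    by simp
qed

section \<open>Direct sums, projections and complements\<close>

lemma dir_sumI:
  assumes "subspace K A1 V" "subspace K A2 V" "\<And>a. a \<in> A1 \<Longrightarrow> a \<in> A2 \<Longrightarrow> a = \<zero>\<^bsub>V\<^esub>"
    "subspace K A V" "A1 \<subseteq> A" "A2 \<subseteq> A" "\<And>a. a \<in> A \<Longrightarrow> \<exists>a1\<in>A1. \<exists>a2\<in>A2. a = a1 \<oplus>\<^bsub>V\<^esub> a2"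
  shows "dir_sum K V A A1 A2"
proof -
  have "A = plus_set V A1 A2"
    using plus_set_least[OF assms(4-6)] assms(7) by (fastforce simp: plus_set_def)
  moreover have "A1 \<inter> A2 = {\<zero>\<^bsub>V\<^esub>}"
    using assms(3) subspaceD(3)[OF assms(1)] subspaceD(3)[OF assms(2)] by blast
  ultimately show ?thesis
    using assms(1,2) by (simp add: dir_sum_def)
qed

lemma dir_sumD:
  assumes "dir_sum K V A A1 A2"
  shows "subspace K A1 V" "subspace K A2 V" "subspace K A V" "A1 \<subseteq> A" "A2 \<subseteq> A"
    "\<And>a. a \<in> A1 \<Longrightarrow> a \<in> A2 \<Longrightarrow> a = \<zero>\<^bsub>V\<^esub>"
    "A = plus_set V A1 A2"
    "\<And>a. a \<in> A \<Longrightarrow> \<exists>a1\<in>A1. \<exists>a2\<in>A2. a = a1 \<oplus>\<^bsub>V\<^esub> a2"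
  using assms subspace_plus plus_set_upper[of K A1 V A2] unfolding dir_sum_def plus_set_def by auto

lemma dir_sum_unique:
  assumes "dir_sum K V A A1 A2" "a1 \<in> A1" "b1 \<in> A1" "a2 \<in> A2" "b2 \<in> A2" "a1 \<oplus>\<^bsub>V\<^esub> a2 = b1 \<oplus>\<^bsub>V\<^esub> b2"
  shows "a1 = b1" "a2 = b2"
proof -
  note D = dir_sumD[OF assms(1)]
  note S1 = subspaceD[OF D(1)] and S2 = subspaceD[OF D(2)]
  interpret V: vectorspace K V by (rule S1(1))
  have eq: "a1 \<ominus>\<^bsub>V\<^esub> b1 = b2 \<ominus>\<^bsub>V\<^esub> a2"
    using vectorspace_minus_cancel[OF S1(1) S1(2)[OF assms(2)] S2(2)[OF assms(4)] S1(2)[OF assms(3)] S2(2)[OF assms(5)]]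
      assms(6) by simp
  have "a1 \<ominus>\<^bsub>V\<^esub> b1 = \<zero>\<^bsub>V\<^esub>"
    using D(6)[OF S1(7)[OF assms(2,3)]] S2(7)[OF assms(5,4)] eq by simp
  then show "a1 = b1" "a2 = b2" using eq assms S1(2) S2(2) by auto
qed

lemma dir_sum_eq_zero:
  assumes "dir_sum K V A A1 A2" "a1 \<in> A1" "a2 \<in> A2" "a1 \<oplus>\<^bsub>V\<^esub> a2 = \<zero>\<^bsub>V\<^esub>"
  shows "a1 = \<zero>\<^bsub>V\<^esub>" "a2 = \<zero>\<^bsub>V\<^esub>"
proof -
  note D = dir_sumD[OF assms(1)]
  interpret V: vectorspace K V by (rule subspaceD(1)[OF D(1)])
  have "a1 \<oplus>\<^bsub>V\<^esub> a2 = \<zero>\<^bsub>V\<^esub> \<oplus>\<^bsub>V\<^esub> \<zero>\<^bsub>V\<^esub>" using assms by simp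
  from dir_sum_unique[OF assms(1) assms(2) subspaceD(3)[OF D(1)] assms(3) subspaceD(3)[OF D(2)] this]
  show "a1 = \<zero>\<^bsub>V\<^esub>" "a2 = \<zero>\<^bsub>V\<^esub>" .
qed

lemma dir_sum_commute: "dir_sum K V A A1 A2 \<Longrightarrow> dir_sum K V A A2 A1"
  unfolding dir_sum_def using plus_set_commute by blast

definition proj :: "('k, 'v) module \<Rightarrow> 'v set \<Rightarrow> 'v set \<Rightarrow> 'v \<Rightarrow> 'v" where
  "proj V A1 A2 a = (SOME a1. a1 \<in> A1 \<and> (\<exists>a2\<in>A2. a = a1 \<oplus>\<^bsub>V\<^esub> a2))"

lemma dir_sum_proj:
  assumes ds: "dir_sum K V A A1 A2"
  shows proj_add: "\<And>a1 a2. a1 \<in> A1 \<Longrightarrow> a2 \<in> A2 \<Longrightarrow> proj V A1 A2 (a1 \<oplus>\<^bsub>V\<^esub> a2) = a1"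
    and proj_closed: "\<And>a. a \<in> A \<Longrightarrow> proj V A1 A2 a \<in> A1"
    and proj_id: "\<And>a. a \<in> A1 \<Longrightarrow> proj V A1 A2 a = a"
    and proj_zero: "\<And>a. a \<in> A2 \<Longrightarrow> proj V A1 A2 a = \<zero>\<^bsub>V\<^esub>"
    and linear_on_proj: "linear_on K V V A (proj V A1 A2)"
proof -
  note D = dir_sumD[OF ds]
  note S1 = subspaceD[OF D(1)] and S2 = subspaceD[OF D(2)]
  interpret V: vectorspace K V by (rule S1(1))
  let ?p = "proj V A1 A2"
  have add: "?p (a1 \<oplus>\<^bsub>V\<^esub> a2) = a1" if "a1 \<in> A1" "a2 \<in> A2" for a1 a2
    unfolding proj_def by (rule some_equality) (use that dir_sum_unique[OF ds] in blast)+
  show "?p (a1 \<oplus>\<^bsub>V\<^esub> a2) = a1" if "a1 \<in> A1" "a2 \<in> A2" for a1 a2 by (rule add[OF that])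
  show cl: "?p a \<in> A1" if "a \<in> A" for a using D(8)[OF that] add by auto
  show "?p a = a" if "a \<in> A1" for a using add[OF that S2(3)] S1(2)[OF that] by simp
  show "?p a = \<zero>\<^bsub>V\<^esub>" if "a \<in> A2" for a using add[OF S1(3) that] S2(2)[OF that] by simp
  have "?p (a \<oplus>\<^bsub>V\<^esub> b) = ?p a \<oplus>\<^bsub>V\<^esub> ?p b" if "a \<in> A" "b \<in> A" for a b
  proof -
    obtain a1 a2 b1 b2 where ab: "a1 \<in> A1" "a2 \<in> A2" "a = a1 \<oplus>\<^bsub>V\<^esub> a2" "b1 \<in> A1" "b2 \<in> A2" "b = b1 \<oplus>\<^bsub>V\<^esub> b2"
      using D(8) \<open>a \<in> A\<close> \<open>b \<in> A\<close> by meson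
    then have "a \<oplus>\<^bsub>V\<^esub> b = (a1 \<oplus>\<^bsub>V\<^esub> b1) \<oplus>\<^bsub>V\<^esub> (a2 \<oplus>\<^bsub>V\<^esub> b2)"
      using S1(2) S2(2) by (simp add: V.M.a_ac)
    then have "?p (a \<oplus>\<^bsub>V\<^esub> b) = a1 \<oplus>\<^bsub>V\<^esub> b1" using add[OF S1(4) S2(4)] ab by simp
    then show ?thesis using ab add by simp
  qed
  moreover have "?p (c \<odot>\<^bsub>V\<^esub> a) = c \<odot>\<^bsub>V\<^esub> ?p a" if "a \<in> A" "c \<in> carrier K" for a c
  proof -
    obtain a1 a2 where ab: "a1 \<in> A1" "a2 \<in> A2" "a = a1 \<oplus>\<^bsub>V\<^esub> a2"
      using D(8) \<open>a \<in> A\<close> by meson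
    then have "c \<odot>\<^bsub>V\<^esub> a = (c \<odot>\<^bsub>V\<^esub> a1) \<oplus>\<^bsub>V\<^esub> (c \<odot>\<^bsub>V\<^esub> a2)"
      using that S1(2) S2(2) by (simp add: V.smult_r_distr)
    then have "?p (c \<odot>\<^bsub>V\<^esub> a) = c \<odot>\<^bsub>V\<^esub> a1" using add[OF S1(5) S2(5)] ab that by simp
    then show ?thesis using ab add by simp
  qed
  ultimately show "linear_on K V V A ?p"
    unfolding linear_on_def using cl S1(2) by simp
qed

lemma proj_sum:
  assumes ds: "dir_sum K V A A1 A2" and a: "a \<in> A"
  shows "proj V A1 A2 a \<oplus>\<^bsub>V\<^esub> proj V A2 A1 a = a"
proof -
  note D = dir_sumD[OF ds]
  interpret V: vectorspace K V by (rule subspaceD(1)[OF D(1)])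
  obtain a1 a2 where ab: "a1 \<in> A1" "a2 \<in> A2" "a = a1 \<oplus>\<^bsub>V\<^esub> a2" using D(8)[OF a] by blast
  then have "a = a2 \<oplus>\<^bsub>V\<^esub> a1"
    using subspaceD(2)[OF D(1)] subspaceD(2)[OF D(2)] by (simp add: V.M.a_comm)
  then show ?thesis
    using proj_add[OF ds ab(1,2)] proj_add[OF dir_sum_commute[OF ds] ab(2,1)] ab(3) by simp
qed

lemma dir_sum_vdim:
  assumes ds: "dir_sum K V A A1 A2" and fA: "fin_sub K V A"
  shows "vdim K V A = vdim K V A1 + vdim K V A2" "fin_sub K V A1" "fin_sub K V A2"
proof -
  note D = dir_sumD[OF ds] and P = dir_sum_proj[OF ds]
  show "fin_sub K V A1" "fin_sub K V A2" using fin_sub_mono(1)[OF fA] D by auto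
  have "proj V A1 A2 ` A = A1"
    using P(2,3) D(4) by (force simp: image_iff)
  moreover have "{a \<in> A. proj V A1 A2 a = \<zero>\<^bsub>V\<^esub>} = A2"
  proof (intro equalityI subsetI)
    fix a assume "a \<in> {a \<in> A. proj V A1 A2 a = \<zero>\<^bsub>V\<^esub>}"
    then have a: "a \<in> A" "proj V A1 A2 a = \<zero>\<^bsub>V\<^esub>" by auto
    interpret V: vectorspace K V by (rule fin_subD(2)[OF fA])
    have "proj V A2 A1 a \<in> A2" by (rule proj_closed[OF dir_sum_commute[OF ds] a(1)])
    then show "a \<in> A2" using proj_sum[OF ds a(1)] a(2) subspaceD(2)[OF D(2)] by fastforce
  qed (use P(4) D(5) in blast)
  ultimately show "vdim K V A = vdim K V A1 + vdim K V A2"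
    using rank_nullity(2)[OF fA fin_subD(2)[OF fA] P(5)] by simp
qed

lemma dir_sum_fin_sub:
  "dir_sum K V A A1 A2 \<Longrightarrow> fin_sub K V A1 \<Longrightarrow> fin_sub K V A2 \<Longrightarrow> fin_sub K V A"
  using fin_sub_plus dir_sumD(7) by metis

text \<open>If a nonzero multiple of \<open>v\<close> lay in \<open>C\<close>, dividing by the
  scalar would put \<open>v\<close> itself into \<open>C\<close>.\<close>

lemma dir_sum_line:
  assumes C: "subspace K C V" and v: "v \<in> carrier V" "v \<notin> C"
  defines "L \<equiv> {c \<odot>\<^bsub>V\<^esub> v | c. c \<in> carrier K}"
  shows "dir_sum K V (plus_set V C L) C L"
proof -
  interpret V: vectorspace K V using C by (rule subspaceD)
  have v0: "v \<noteq> \<zero>\<^bsub>V\<^esub>" using v(2) subspaceD(3)[OF C] by auto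
  have L: "subspace K L V" using vdim_line(1)[OF V.vectorspace_axioms v(1) v0] fin_subD(1) unfolding L_def by blast
  have "a = \<zero>\<^bsub>V\<^esub>" if a: "a \<in> C" "a \<in> L" for a
  proof (rule ccontr)
    obtain c where c: "c \<in> carrier K" "a = c \<odot>\<^bsub>V\<^esub> v" using a(2) unfolding L_def by blast
    assume "a \<noteq> \<zero>\<^bsub>V\<^esub>"
    then have c0: "c \<noteq> \<zero>\<^bsub>K\<^esub>" using c(2) V.smult_l_null[OF v(1)] by blast
    have "v = (inv\<^bsub>K\<^esub> c) \<odot>\<^bsub>V\<^esub> a" using V.mult_inverse[OF c(1) v(1) c(2)[symmetric] c0] .
    then show False using subspaceD(5)[OF C _ a(1), of "inv\<^bsub>K\<^esub> c"] v(2) c(1) c0 V.inverse_exists by auto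
  qed
  then show ?thesis
    by (intro dir_sumI C L subspace_plus plus_set_upper[of K]) (auto simp: plus_set_def)
qed

text \<open>Take \<open>C\<close> of largest dimension among the subspaces of \<open>B\<close> that
  meet \<open>A\<close> trivially. If \<open>v\<close> lay outside A + C, adjoining it to
  \<open>C\<close> would keep the intersection trivial: in a = c + l with l a multiple of
  \<open>v\<close>, the vector l lies in A + C and hence is 0.\<close>

lemma complement_exists:
  assumes B: "fin_sub K V B" and A: "subspace K A V" "A \<subseteq> B"
  obtains C where "dir_sum K V B A C"
proof -
  note sB = fin_subD[OF B]
  interpret V: vectorspace K V by (rule sB(2))
  define P where "P n \<longleftrightarrow> (\<exists>C. subspace K C V \<and> C \<subseteq> B \<and> A \<inter> C = {\<zero>\<^bsub>V\<^esub>} \<and> vdim K V C = n)" for n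
  have "P 0" unfolding P_def
    using subspace_zero[OF sB(2)] vdim_zero[OF sB(2)] subspaceD(3)[OF sB(1)] subspaceD(3)[OF A(1)] by blast
  moreover have bd: "n \<le> vdim K V B" if "P n" for n using that fin_sub_mono(2)[OF B] by (auto simp: P_def)
  ultimately have "P (GREATEST n. P n)" "\<And>n. P n \<Longrightarrow> n \<le> (GREATEST n. P n)"
    using GreatestI_nat[of P] Greatest_le_nat[of P] by blast+
  then obtain C where C: "subspace K C V" "C \<subseteq> B" "A \<inter> C = {\<zero>\<^bsub>V\<^esub>}" and max: "\<And>n. P n \<Longrightarrow> n \<le> vdim K V C"
    unfolding P_def by metis
  note AC = subspace_plus[OF A(1) C(1)]
  have "v \<in> plus_set V A C" if "v \<in> B" for v
  proof (rule ccontr)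
    assume nv: "v \<notin> plus_set V A C"
    have v: "v \<in> carrier V" using subspaceD(2)[OF sB(1) that] .
    have vC: "v \<notin> C" using nv plus_set_upper[OF A(1) C(1)] by auto
    then have v0: "v \<noteq> \<zero>\<^bsub>V\<^esub>" using subspaceD(3)[OF C(1)] by auto
    let ?L = "{c \<odot>\<^bsub>V\<^esub> v | c. c \<in> carrier K}"
    note L = vdim_line[OF sB(2) v v0] and dsL = dir_sum_line[OF C(1) v vC]
    have LB: "?L \<subseteq> B" using subspaceD(5)[OF sB(1) _ that] by auto
    have sub: "plus_set V C ?L \<subseteq> B" by (rule plus_set_least[OF sB(1) C(2) LB])
    have "vdim K V (plus_set V C ?L) = vdim K V C + 1"
      using dir_sum_vdim(1)[OF dsL fin_sub_mono(1)[OF B dir_sumD(3)[OF dsL] sub]] L(2) by simp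
    moreover have "A \<inter> plus_set V C ?L = {\<zero>\<^bsub>V\<^esub>}"
    proof -
      have "a = \<zero>\<^bsub>V\<^esub>" if a: "a \<in> A" "a \<in> plus_set V C ?L" for a
      proof -
        obtain c l where cl: "c \<in> C" "l \<in> ?L" "a = c \<oplus>\<^bsub>V\<^esub> l" using a(2) by (rule plus_setE)
        have car: "a \<in> carrier V" "c \<in> carrier V" "l \<in> carrier V"
          using a cl subspaceD(2)[OF A(1)] subspaceD(2)[OF C(1)] subspaceD(2)[OF fin_subD(1)[OF L(1)]] by auto
        have "l = a \<ominus>\<^bsub>V\<^esub> c" using cl(3) vectorspace_add_diff(1)[OF sB(2)] car by simp
        then have "l \<in> plus_set V A C"
          using subspaceD(7)[OF AC] plus_set_upper[OF A(1) C(1)] a(1) cl(1) by blast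
        then have "l = \<zero>\<^bsub>V\<^esub>" using dir_sumD(6)[OF dir_sum_line[OF AC v nv]] cl(2) by blast
        then have "a = c" using cl(3) car by simp
        then show ?thesis using C(3) a(1) cl(1) by blast
      qed
      then show ?thesis using subspaceD(3)[OF A(1)] subspaceD(3)[OF dir_sumD(3)[OF dsL]] by blast
    qed
    ultimately have "P (vdim K V C + 1)"
      unfolding P_def using sub dir_sumD(3)[OF dsL] by (intro exI[of _ "plus_set V C ?L"] conjI)
    then show False using max by fastforce
  qed
  then have "B = plus_set V A C" using plus_set_least[OF sB(1) A(2) C(2)] by auto
  then show thesis using that A C by (auto simp: dir_sum_def)
qed

text \<open>If \<open>E\<close> complements S + T, then S + E complements \<open>T\<close>. This is
  for splitting off a line from a target space with a complement that still contains the images of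
  both maps.\<close>

lemma complement_containing:
  assumes B: "fin_sub K V B" and S: "subspace K S V" "S \<subseteq> B" and T: "subspace K T V" "T \<subseteq> B"
    and ST: "S \<inter> T = {\<zero>\<^bsub>V\<^esub>}"
  obtains C where "S \<subseteq> C" "dir_sum K V B C T"
proof -
  note sB = fin_subD[OF B]
  interpret V: vectorspace K V by (rule sB(2))
  note ST' = subspace_plus[OF S(1) T(1)]
  obtain E where E: "dir_sum K V B (plus_set V S T) E"
    using complement_exists[OF B ST' plus_set_least[OF sB(1) S(2) T(2)]] .
  note D = dir_sumD[OF E]
  note SE = subspace_plus[OF S(1) D(2)]
  have ds: "dir_sum K V (plus_set V S T) S T" using S T ST by (auto simp: dir_sum_def)
  have "dir_sum K V B (plus_set V S E) T"
  proof (rule dir_sumI)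
    fix a assume a: "a \<in> plus_set V S E" "a \<in> T"
    then obtain s e where se: "s \<in> S" "e \<in> E" "a = s \<oplus>\<^bsub>V\<^esub> e" by (elim plus_setE)
    have car: "a \<in> carrier V" "s \<in> carrier V" "e \<in> carrier V"
      using a se subspaceD(2)[OF S(1)] subspaceD(2)[OF T(1)] subspaceD(2)[OF D(2)] by auto
    have "e = a \<ominus>\<^bsub>V\<^esub> s" using se(3) vectorspace_add_diff(1)[OF sB(2)] car by simp
    then have "e \<in> plus_set V S T"
      using subspaceD(7)[OF ST'] plus_set_upper[OF S(1) T(1)] a se by blast
    then have "e = \<zero>\<^bsub>V\<^esub>" using D(6) se by blast
    then have "a = s" using se car by simp
    then show "a = \<zero>\<^bsub>V\<^esub>" using se ST a by blast
  next
    fix a assume "a \<in> B"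
    then obtain u e where ue: "u \<in> plus_set V S T" "e \<in> E" "a = u \<oplus>\<^bsub>V\<^esub> e" using D(8) by meson
    then obtain s t where st: "s \<in> S" "t \<in> T" "u = s \<oplus>\<^bsub>V\<^esub> t" by (elim plus_setE)
    have "a = (s \<oplus>\<^bsub>V\<^esub> e) \<oplus>\<^bsub>V\<^esub> t"
      using ue st subspaceD(2)[OF S(1)] subspaceD(2)[OF T(1)] subspaceD(2)[OF D(2)] by (simp add: V.M.a_ac)
    then show "\<exists>a1\<in>plus_set V S E. \<exists>a2\<in>T. a = a1 \<oplus>\<^bsub>V\<^esub> a2"
      using plus_setI[OF st(1) ue(2), of V] st(2) by blast
  qed (intro SE T sB(1) plus_set_least[OF sB(1) S(2) D(5)])+
  with plus_set_upper(1)[OF S(1) D(2)] show thesis by (rule that)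
qed

text \<open>A complement of the intersection in \<open>B\<close> is also a complement of
  \<open>A\<close> in A + B.\<close>

lemma vdim_plus_Int:
  assumes A: "fin_sub K V A" and B: "fin_sub K V B"
  shows "vdim K V (plus_set V A B) + vdim K V (A \<inter> B) = vdim K V A + vdim K V B"
proof -
  note sA = fin_subD[OF A] and sB = fin_subD[OF B]
  interpret V: vectorspace K V by (rule sB(2))
  note I = subspace_Int[OF sA(1) sB(1)]
  obtain C where C: "dir_sum K V B (A \<inter> B) C" using complement_exists[OF B I] by auto
  note D = dir_sumD[OF C]
  have "dir_sum K V (plus_set V A B) A C"
  proof (rule dir_sumI)
    fix a assume "a \<in> plus_set V A B"
    then obtain x y where xy: "x \<in> A" "y \<in> B" "a = x \<oplus>\<^bsub>V\<^esub> y" by (elim plus_setE)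
    then obtain i c where ic: "i \<in> A \<inter> B" "c \<in> C" "y = i \<oplus>\<^bsub>V\<^esub> c" using D(8) by blast
    have "a = (x \<oplus>\<^bsub>V\<^esub> i) \<oplus>\<^bsub>V\<^esub> c"
      using xy ic subspaceD(2)[OF sA(1)] subspaceD(2)[OF D(2)] by (simp add: V.M.a_ac)
    then show "\<exists>a1\<in>A. \<exists>a2\<in>C. a = a1 \<oplus>\<^bsub>V\<^esub> a2" using ic xy subspaceD(4)[OF sA(1)] by blast
  qed (use D sA sB subspace_plus plus_set_upper[OF sA(1) sB(1)] in auto)
  from dir_sum_vdim(1)[OF this fin_sub_plus[OF A B]] dir_sum_vdim(1)[OF C B]
  show ?thesis by simp
qed

section \<open>Pairs of linear maps\<close>

text \<open>A finite dimensional representation of the Kronecker quiver. It will be used with a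
  complement of the radical of a module, the radical itself, and the actions of \<open>X\<close> and
  \<open>Y\<close>.\<close>

definition kron :: "'k ring \<Rightarrow> ('k, 'v) module \<Rightarrow> ('k, 'w) module \<Rightarrow> 'v set \<Rightarrow> 'w set \<Rightarrow>
    ('v \<Rightarrow> 'w) \<Rightarrow> ('v \<Rightarrow> 'w) \<Rightarrow> bool" where
  "kron K V W A B x y \<longleftrightarrow> fin_sub K V A \<and> fin_sub K W B \<and> linear_on K V W A x \<and> linear_on K V W A y \<and>
    (\<forall>a\<in>A. x a \<in> B \<and> y a \<in> B)"

definition kron_split :: "'k ring \<Rightarrow> ('k, 'v) module \<Rightarrow> ('k, 'w) module \<Rightarrow> 'v set \<Rightarrow> 'w set \<Rightarrow>
    ('v \<Rightarrow> 'w) \<Rightarrow> ('v \<Rightarrow> 'w) \<Rightarrow> 'v set \<Rightarrow> 'v set \<Rightarrow> 'w set \<Rightarrow> 'w set \<Rightarrow> bool" where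
  "kron_split K V W A B x y A1 A2 B1 B2 \<longleftrightarrow> dir_sum K V A A1 A2 \<and> dir_sum K W B B1 B2 \<and>
    (\<forall>a\<in>A1. x a \<in> B1 \<and> y a \<in> B1) \<and> (\<forall>a\<in>A2. x a \<in> B2 \<and> y a \<in> B2)"

text \<open>Arbitrary summands rather than indecomposable ones: arbitrary decompositions can be
  carried along a shift, and an odd-dimensional summand always contains an indecomposable one of odd
  dimension.\<close>

definition odd_split :: "'k ring \<Rightarrow> ('k, 'v) module \<Rightarrow> ('k, 'w) module \<Rightarrow> 'v set \<Rightarrow> 'w set \<Rightarrow>
    ('v \<Rightarrow> 'w) \<Rightarrow> ('v \<Rightarrow> 'w) \<Rightarrow> bool" where
  "odd_split K V W A B x y \<longleftrightarrow>
    (\<exists>A1 A2 B1 B2. kron_split K V W A B x y A1 A2 B1 B2 \<and> odd (vdim K V A1 + vdim K W B1))"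

text \<open>The sequence \<open>0 \<rightarrow> A \<rightarrow> B \<oplus> B \<rightarrow> C \<rightarrow> 0\<close> is exact, so the pair \<open>A \<rightarrow> B\<close> is the Heller shift of
  \<open>B \<rightarrow> C\<close>.\<close>
definition linked :: "'k ring \<Rightarrow> ('k, 'u) module \<Rightarrow> ('k, 'v) module \<Rightarrow> ('k, 'w) module \<Rightarrow>
    'u set \<Rightarrow> 'v set \<Rightarrow> 'w set \<Rightarrow> ('u \<Rightarrow> 'v) \<Rightarrow> ('u \<Rightarrow> 'v) \<Rightarrow> ('v \<Rightarrow> 'w) \<Rightarrow> ('v \<Rightarrow> 'w) \<Rightarrow> bool" where
  "linked K U V W A B C x y x' y' \<longleftrightarrow> kron K U V A B x y \<and> kron K V W B C x' y' \<and>
    (\<forall>a\<in>A. x a = \<zero>\<^bsub>V\<^esub> \<longrightarrow> y a = \<zero>\<^bsub>V\<^esub> \<longrightarrow> a = \<zero>\<^bsub>U\<^esub>) \<and>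
    (\<forall>b\<in>B. \<forall>b'\<in>B. x' b \<oplus>\<^bsub>W\<^esub> y' b' = \<zero>\<^bsub>W\<^esub> \<longleftrightarrow> (\<exists>a\<in>A. b = y a \<and> b' = x a)) \<and>
    C = plus_set W (x' ` B) (y' ` B)"

lemma kronD:
  assumes "kron K V W A B x y"
  shows "fin_sub K V A" "fin_sub K W B" "linear_on K V W A x" "linear_on K V W A y"
    "\<And>a. a \<in> A \<Longrightarrow> x a \<in> B" "\<And>a. a \<in> A \<Longrightarrow> y a \<in> B"
    "subspace K A V" "subspace K B W" "vectorspace K V" "vectorspace K W"
  using assms fin_subD[of K V A] fin_subD[of K W B] by (auto simp: kron_def)

lemma linkedD:
  assumes "linked K U V W A B C x y x' y'"
  shows "kron K U V A B x y" "kron K V W B C x' y'"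
    "\<And>a. a \<in> A \<Longrightarrow> x a = \<zero>\<^bsub>V\<^esub> \<Longrightarrow> y a = \<zero>\<^bsub>V\<^esub> \<Longrightarrow> a = \<zero>\<^bsub>U\<^esub>"
    "\<And>b b'. b \<in> B \<Longrightarrow> b' \<in> B \<Longrightarrow> x' b \<oplus>\<^bsub>W\<^esub> y' b' = \<zero>\<^bsub>W\<^esub> \<Longrightarrow> \<exists>a\<in>A. b = y a \<and> b' = x a"
    "\<And>a. a \<in> A \<Longrightarrow> x' (y a) \<oplus>\<^bsub>W\<^esub> y' (x a) = \<zero>\<^bsub>W\<^esub>"
    "C = plus_set W (x' ` B) (y' ` B)"
  using assms kronD(5,6)[of K U V A B x y] unfolding linked_def by blast+

text \<open>The exact sequence, counted without forming B + B. The intersection of x'B and y'B is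
  x'(yA), the kernel of \<open>x'\<close> lies in yA, and \<open>x\<close> maps the kernel of
  \<open>y\<close> bijectively to that of \<open>y'\<close>. Rank and nullity for \<open>x'\<close>,
  \<open>y'\<close>, \<open>y\<close> and for \<open>x'\<close> on yA do the rest.\<close>

lemma linked_vdim:
  assumes L: "linked K U V W A B C x y x' y'"
  shows "vdim K U A + vdim K W C = 2 * vdim K V B"
proof -
  note l = linkedD[OF L]
  note k = kronD[OF l(1)] and k' = kronD[OF l(2)]
  interpret V: vectorspace K V by (rule k(10))
  interpret W: vectorspace K W by (rule k'(10))
  note Bc = subspaceD[OF k(8)]
  note x'0 = linear_on_zero[OF k'(7) k'(10) k'(3)] and y'0 = linear_on_zero[OF k'(7) k'(10) k'(4)]
  have D: "fin_sub K V (y ` A)" by (rule rank_nullity(1)[OF k(1,10,4)])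
  have DB: "y ` A \<subseteq> B" using k(6) by auto
  have "x' ` (y ` A) = x' ` B \<inter> y' ` B"
  proof (intro equalityI subsetI)
    fix v assume "v \<in> x' ` (y ` A)"
    then obtain a where a: "a \<in> A" "v = x' (y a)" by auto
    have "x' (y a) = \<ominus>\<^bsub>W\<^esub> y' (x a)"
      using l(5)[OF a(1)] a(1) k(5,6) linear_onD(1)[OF k'(3)] linear_onD(1)[OF k'(4)] W.M.minus_equality by metis
    also have "\<dots> = y' (\<ominus>\<^bsub>V\<^esub> x a)" using y'0(2) k(5) a by simp
    finally have "v = y' (\<ominus>\<^bsub>V\<^esub> x a)" using a(2) by simp
    then show "v \<in> x' ` B \<inter> y' ` B" using a k(5,6) Bc(6) by blast
  next
    fix v assume "v \<in> x' ` B \<inter> y' ` B"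
    then obtain b b' where b: "b \<in> B" "v = x' b" "b' \<in> B" "v = y' b'" by blast
    have "x' b \<oplus>\<^bsub>W\<^esub> y' (\<ominus>\<^bsub>V\<^esub> b') = v \<oplus>\<^bsub>W\<^esub> \<ominus>\<^bsub>W\<^esub> v" using b y'0(2) by metis
    also have "\<dots> = \<zero>\<^bsub>W\<^esub>" using b linear_onD(1)[OF k'(3)] by (simp add: W.M.r_neg)
    finally show "v \<in> x' ` (y ` A)" using l(4)[OF b(1) Bc(6)[OF b(3)]] b(2) by blast
  qed
  moreover have "{b \<in> y ` A. x' b = \<zero>\<^bsub>W\<^esub>} = {b \<in> B. x' b = \<zero>\<^bsub>W\<^esub>}"
  proof (intro equalityI subsetI)
    fix b assume b: "b \<in> {b \<in> B. x' b = \<zero>\<^bsub>W\<^esub>}"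
    then have "x' b \<oplus>\<^bsub>W\<^esub> y' \<zero>\<^bsub>V\<^esub> = \<zero>\<^bsub>W\<^esub>" using y'0(1) by simp
    then show "b \<in> {b \<in> y ` A. x' b = \<zero>\<^bsub>W\<^esub>}" using l(4)[OF _ Bc(3)] b by blast
  qed (use DB in auto)
  moreover have "vdim K V {b \<in> B. y' b = \<zero>\<^bsub>W\<^esub>} = vdim K U {a \<in> A. y a = \<zero>\<^bsub>V\<^esub>}"
  proof -
    have sub: "subspace K {a \<in> A. y a = \<zero>\<^bsub>V\<^esub>} U"
      using subspace_vimage[OF k(7) subspace_zero[OF k(10)] k(4)] by simp
    have fs: "fin_sub K U {a \<in> A. y a = \<zero>\<^bsub>V\<^esub>}" by (rule fin_sub_mono(1)[OF k(1) sub]) auto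
    have lin: "linear_on K U V {a \<in> A. y a = \<zero>\<^bsub>V\<^esub>} x" by (rule linear_on_subset[OF k(3)]) auto
    have "inj_on x {a \<in> A. y a = \<zero>\<^bsub>V\<^esub>}"
      unfolding linear_on_inj_iff[OF sub k(10) lin] using l(3) by auto
    moreover have "x ` {a \<in> A. y a = \<zero>\<^bsub>V\<^esub>} = {b \<in> B. y' b = \<zero>\<^bsub>W\<^esub>}"
    proof (intro equalityI subsetI)
      fix b assume "b \<in> x ` {a \<in> A. y a = \<zero>\<^bsub>V\<^esub>}"
      then obtain a where a: "a \<in> A" "y a = \<zero>\<^bsub>V\<^esub>" "b = x a" by auto
      then show "b \<in> {b \<in> B. y' b = \<zero>\<^bsub>W\<^esub>}"
        using l(5)[OF a(1)] x'0(1) k(5) linear_onD(1)[OF k'(4)] by auto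
    next
      fix b assume b: "b \<in> {b \<in> B. y' b = \<zero>\<^bsub>W\<^esub>}"
      then have "x' \<zero>\<^bsub>V\<^esub> \<oplus>\<^bsub>W\<^esub> y' b = \<zero>\<^bsub>W\<^esub>" using x'0(1) by simp
      then obtain a where "a \<in> A" "\<zero>\<^bsub>V\<^esub> = y a" "b = x a" using l(4)[OF Bc(3)] b by blast
      then show "b \<in> x ` {a \<in> A. y a = \<zero>\<^bsub>V\<^esub>}" by auto
    qed
    ultimately show ?thesis using vdim_image_inj[OF fs k(10) lin] by simp
  qed
  moreover note rank_nullity(2)[OF D k'(10) linear_on_subset[OF k'(3) DB]]
    rank_nullity(2)[OF k'(1,10,3)] rank_nullity(2)[OF k'(1,10,4)] rank_nullity(2)[OF k(1,10,4)]
    vdim_plus_Int[OF rank_nullity(1)[OF k'(1,10,3)] rank_nullity(1)[OF k'(1,10,4)]]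
  ultimately show ?thesis using l(6) by simp
qed

section \<open>Decompositions of linked pairs\<close>

lemma kron_splitD:
  assumes "kron_split K V W A B x y A1 A2 B1 B2"
  shows "dir_sum K V A A1 A2" "dir_sum K W B B1 B2"
    "\<And>a. a \<in> A1 \<Longrightarrow> x a \<in> B1" "\<And>a. a \<in> A1 \<Longrightarrow> y a \<in> B1"
    "\<And>a. a \<in> A2 \<Longrightarrow> x a \<in> B2" "\<And>a. a \<in> A2 \<Longrightarrow> y a \<in> B2"
  using assms unfolding kron_split_def by auto

lemma kron_split_kron:
  assumes "kron K V W A B x y" "kron_split K V W A B x y A1 A2 B1 B2"
  shows "kron K V W A1 B1 x y"
  unfolding kron_def using kron_splitD[OF assms(2)] kronD[OF assms(1)] dir_sum_vdim(2) linear_on_subset dir_sumD(4) by metis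

text \<open>An element a of \<open>A\<close> is determined by (y a, x a), and these pairs are
  exactly the relations x' b + y' b' = 0. As \<open>C1\<close> and \<open>C2\<close> meet trivially,
  both components of a relation are relations, so each comes from an element of
  \<open>A\<close>.\<close>

lemma linked_split_up:
  assumes L: "linked K U V W A B C x y x' y'" and S: "kron_split K V W B C x' y' B1 B2 C1 C2"
  defines "A1 \<equiv> {a \<in> A. x a \<in> B1 \<and> y a \<in> B1}" and "A2 \<equiv> {a \<in> A. x a \<in> B2 \<and> y a \<in> B2}"
  shows "kron_split K U V A B x y A1 A2 B1 B2" "linked K U V W A1 B1 C1 x y x' y'"
proof -
  note l = linkedD[OF L]
  note k = kronD[OF l(1)] and k' = kronD[OF l(2)] and s = kron_splitD[OF S]
  note dB = dir_sumD[OF s(1)] and dC = dir_sumD[OF s(2)]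
  interpret U: vectorspace K U by (rule k(9))
  interpret V: vectorspace K V by (rule k(10))
  interpret W: vectorspace K W by (rule k'(10))
  note Ac = subspaceD[OF k(7)] and B1c = subspaceD[OF dB(1)] and B2c = subspaceD[OF dB(2)]
    and C1c = subspaceD[OF dC(1)] and C2c = subspaceD[OF dC(2)]
  have split0: "x' b1 \<oplus>\<^bsub>W\<^esub> y' b1' = \<zero>\<^bsub>W\<^esub> \<and> x' b2 \<oplus>\<^bsub>W\<^esub> y' b2' = \<zero>\<^bsub>W\<^esub>"
    if "b1 \<in> B1" "b1' \<in> B1" "b2 \<in> B2" "b2' \<in> B2"
      "x' (b1 \<oplus>\<^bsub>V\<^esub> b2) \<oplus>\<^bsub>W\<^esub> y' (b1' \<oplus>\<^bsub>V\<^esub> b2') = \<zero>\<^bsub>W\<^esub>" for b1 b1' b2 b2'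
  proof -
    have inB: "b1 \<in> B" "b2 \<in> B" "b1' \<in> B" "b2' \<in> B" using that dB(4,5) by auto
    have "(x' b1 \<oplus>\<^bsub>W\<^esub> y' b1') \<oplus>\<^bsub>W\<^esub> (x' b2 \<oplus>\<^bsub>W\<^esub> y' b2') = \<zero>\<^bsub>W\<^esub>"
      using that(5) linear_onD[OF k'(3)] linear_onD[OF k'(4)] inB by (simp add: W.M.a_ac)
    then show ?thesis
      using dir_sum_eq_zero[OF s(2)] that s(3-6) C1c(4) C2c(4) by metis
  qed
  have sA1: "subspace K A1 U" and sA2: "subspace K A2 U"
  proof -
    have "A1 = {a \<in> A. x a \<in> B1} \<inter> {a \<in> A. y a \<in> B1}" by (auto simp: A1_def)
    then show "subspace K A1 U"
      using subspace_Int[OF subspace_vimage[OF k(7) dB(1) k(3)] subspace_vimage[OF k(7) dB(1) k(4)]] by simp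
    have "A2 = {a \<in> A. x a \<in> B2} \<inter> {a \<in> A. y a \<in> B2}" by (auto simp: A2_def)
    then show "subspace K A2 U"
      using subspace_Int[OF subspace_vimage[OF k(7) dB(2) k(3)] subspace_vimage[OF k(7) dB(2) k(4)]] by simp
  qed
  have dsA: "dir_sum K U A A1 A2"
  proof (rule dir_sumI)
    fix a assume "a \<in> A1" "a \<in> A2"
    then show "a = \<zero>\<^bsub>U\<^esub>" using l(3)[of a] dB(6) by (auto simp: A1_def A2_def)
  next
    fix a assume a: "a \<in> A"
    obtain b1 b2 where b: "b1 \<in> B1" "b2 \<in> B2" "y a = b1 \<oplus>\<^bsub>V\<^esub> b2" using dB(8)[OF k(6)[OF a]] by blast
    obtain c1 c2 where c: "c1 \<in> B1" "c2 \<in> B2" "x a = c1 \<oplus>\<^bsub>V\<^esub> c2" using dB(8)[OF k(5)[OF a]] by blast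
    have z: "x' b1 \<oplus>\<^bsub>W\<^esub> y' c1 = \<zero>\<^bsub>W\<^esub>" "x' b2 \<oplus>\<^bsub>W\<^esub> y' c2 = \<zero>\<^bsub>W\<^esub>"
      using split0[OF b(1) c(1) b(2) c(2)] l(5)[OF a] b(3) c(3) by auto
    obtain a1 where a1: "a1 \<in> A" "b1 = y a1" "c1 = x a1" using l(4)[OF _ _ z(1)] b c dB(4) by blast
    obtain a2 where a2: "a2 \<in> A" "b2 = y a2" "c2 = x a2" using l(4)[OF _ _ z(2)] b c dB(5) by blast
    have "a \<ominus>\<^bsub>U\<^esub> (a1 \<oplus>\<^bsub>U\<^esub> a2) = \<zero>\<^bsub>U\<^esub>"
    proof (rule l(3))
      show "a \<ominus>\<^bsub>U\<^esub> (a1 \<oplus>\<^bsub>U\<^esub> a2) \<in> A" using a a1 a2 Ac(4,7) by auto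
      have "x (a1 \<oplus>\<^bsub>U\<^esub> a2) = x a" "y (a1 \<oplus>\<^bsub>U\<^esub> a2) = y a"
        using linear_onD[OF k(3)] linear_onD[OF k(4)] a1 a2 b c by auto
      then show "x (a \<ominus>\<^bsub>U\<^esub> (a1 \<oplus>\<^bsub>U\<^esub> a2)) = \<zero>\<^bsub>V\<^esub>" "y (a \<ominus>\<^bsub>U\<^esub> (a1 \<oplus>\<^bsub>U\<^esub> a2)) = \<zero>\<^bsub>V\<^esub>"
        using linear_on_zero(3)[OF k(7,10,3)] linear_on_zero(3)[OF k(7,10,4)] a Ac(4)[OF a1(1) a2(1)]
          linear_onD(1)[OF k(3)] linear_onD(1)[OF k(4)] by auto
    qed
    then have "a = a1 \<oplus>\<^bsub>U\<^esub> a2" using a a1 a2 Ac(2,4) by simp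
    moreover have "a1 \<in> A1" "a2 \<in> A2" using a1 a2 b c by (auto simp: A1_def A2_def)
    ultimately show "\<exists>a1\<in>A1. \<exists>a2\<in>A2. a = a1 \<oplus>\<^bsub>U\<^esub> a2" by blast
  qed (use sA1 sA2 k(7) in \<open>auto simp: A1_def A2_def\<close>)
  show ks: "kron_split K U V A B x y A1 A2 B1 B2"
    unfolding kron_split_def using dsA s(1) by (auto simp: A1_def A2_def)
  show "linked K U V W A1 B1 C1 x y x' y'"
    unfolding linked_def
  proof (intro conjI ballI impI)
    show "kron K U V A1 B1 x y" by (rule kron_split_kron[OF l(1) ks])
    show "kron K V W B1 C1 x' y'" by (rule kron_split_kron[OF l(2) S])
    show "a = \<zero>\<^bsub>U\<^esub>" if "a \<in> A1" "x a = \<zero>\<^bsub>V\<^esub>" "y a = \<zero>\<^bsub>V\<^esub>" for a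
      using that l(3) by (auto simp: A1_def)
    show "x' b \<oplus>\<^bsub>W\<^esub> y' b' = \<zero>\<^bsub>W\<^esub> \<longleftrightarrow> (\<exists>a\<in>A1. b = y a \<and> b' = x a)" if "b \<in> B1" "b' \<in> B1" for b b'
      using that l(4)[of b b'] l(5) dB(4) by (auto simp: A1_def)
    show "C1 = plus_set W (x' ` B1) (y' ` B1)"
    proof (intro equalityI subsetI)
      fix c assume c: "c \<in> C1"
      then obtain b b' where b: "b \<in> B" "b' \<in> B" "c = x' b \<oplus>\<^bsub>W\<^esub> y' b'"
        using dC(4) l(6) by (auto simp: plus_set_def)
      obtain b1 b2 where b1: "b1 \<in> B1" "b2 \<in> B2" "b = b1 \<oplus>\<^bsub>V\<^esub> b2" using dB(8)[OF b(1)] by blast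
      obtain c1 c2 where c1: "c1 \<in> B1" "c2 \<in> B2" "b' = c1 \<oplus>\<^bsub>V\<^esub> c2" using dB(8)[OF b(2)] by blast
      have inB: "b1 \<in> B" "b2 \<in> B" "c1 \<in> B" "c2 \<in> B" using b1 c1 dB(4,5) by auto
      have "c \<oplus>\<^bsub>W\<^esub> \<zero>\<^bsub>W\<^esub> = (x' b1 \<oplus>\<^bsub>W\<^esub> y' c1) \<oplus>\<^bsub>W\<^esub> (x' b2 \<oplus>\<^bsub>W\<^esub> y' c2)"
        using b b1 c1 linear_onD[OF k'(3)] linear_onD[OF k'(4)] inB by (simp add: W.M.a_ac)
      then have "c = x' b1 \<oplus>\<^bsub>W\<^esub> y' c1"
        using dir_sum_unique(1)[OF s(2) c C1c(4)[OF s(3)[OF b1(1)] s(4)[OF c1(1)]] C2c(3) C2c(4)[OF s(5)[OF b1(2)] s(6)[OF c1(2)]]] by simp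
      then show "c \<in> plus_set W (x' ` B1) (y' ` B1)" using b1 c1 by (auto simp: plus_set_def)
    qed (use s C1c(4) in \<open>auto simp: plus_set_def\<close>)
  qed
qed

text \<open>\<open>C\<close> is the cokernel of \<open>A\<close> in B + B, so a decomposition
  descends. If c comes from (b, b') over \<open>B1\<close> and from (d, d') over \<open>B2\<close>,
  then (b - d, b' - d') is a relation and comes from some a1 + a2; comparing components in
  \<open>B1\<close> gives b = y a1 and b' = x a1, hence c = 0.\<close>

lemma linked_split_down:
  assumes L: "linked K U V W A B C x y x' y'" and S: "kron_split K U V A B x y A1 A2 B1 B2"
  defines "C1 \<equiv> plus_set W (x' ` B1) (y' ` B1)" and "C2 \<equiv> plus_set W (x' ` B2) (y' ` B2)"
  shows "kron_split K V W B C x' y' B1 B2 C1 C2"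
proof -
  note l = linkedD[OF L]
  note k = kronD[OF l(1)] and k' = kronD[OF l(2)] and s = kron_splitD[OF S]
  note dA = dir_sumD[OF s(1)] and dB = dir_sumD[OF s(2)]
  interpret U: vectorspace K U by (rule k(9))
  interpret V: vectorspace K V by (rule k(10))
  interpret W: vectorspace K W by (rule k'(10))
  note B1c = subspaceD[OF dB(1)] and B2c = subspaceD[OF dB(2)]
  note lin = linear_onD[OF k'(3)] linear_onD[OF k'(4)]
  have im: "subspace K (x' ` B1) W" "subspace K (x' ` B2) W" "subspace K (y' ` B1) W" "subspace K (y' ` B2) W"
    using subspace_image[OF dB(1) k'(10) linear_on_subset[OF k'(3) dB(4)]] subspace_image[OF dB(2) k'(10) linear_on_subset[OF k'(3) dB(5)]]
      subspace_image[OF dB(1) k'(10) linear_on_subset[OF k'(4) dB(4)]] subspace_image[OF dB(2) k'(10) linear_on_subset[OF k'(4) dB(5)]] .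
  have sub: "subspace K C1 W" "subspace K C2 W"
    unfolding C1_def C2_def by (intro subspace_plus im)+
  have inC: "C1 \<subseteq> C" "C2 \<subseteq> C"
    using l(6) dB(4,5) unfolding C1_def C2_def plus_set_def by blast+
  have "dir_sum K W C C1 C2"
  proof (rule dir_sumI)
    fix c assume c: "c \<in> C1" "c \<in> C2"
    obtain b b' where b: "b \<in> B1" "b' \<in> B1" "c = x' b \<oplus>\<^bsub>W\<^esub> y' b'" using c(1) by (auto simp: C1_def plus_set_def)
    obtain d d' where d: "d \<in> B2" "d' \<in> B2" "c = x' d \<oplus>\<^bsub>W\<^esub> y' d'" using c(2) by (auto simp: C2_def plus_set_def)
    have inB: "b \<in> B" "b' \<in> B" "d \<in> B" "d' \<in> B" using b d dB by auto
    have nB: "\<ominus>\<^bsub>V\<^esub> d \<in> B2" "\<ominus>\<^bsub>V\<^esub> d' \<in> B2" using B2c(6) d by auto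
    have inB': "\<ominus>\<^bsub>V\<^esub> d \<in> B" "\<ominus>\<^bsub>V\<^esub> d' \<in> B" using nB dB(5) by auto
    note n = linear_on_zero(2)[OF k'(7,10,3)] linear_on_zero(2)[OF k'(7,10,4)]
    have "x' (b \<oplus>\<^bsub>V\<^esub> \<ominus>\<^bsub>V\<^esub> d) \<oplus>\<^bsub>W\<^esub> y' (b' \<oplus>\<^bsub>V\<^esub> \<ominus>\<^bsub>V\<^esub> d') = (x' b \<oplus>\<^bsub>W\<^esub> y' b') \<oplus>\<^bsub>W\<^esub> \<ominus>\<^bsub>W\<^esub> (x' d \<oplus>\<^bsub>W\<^esub> y' d')"
      using lin inB inB' n by (simp add: W.M.a_ac W.M.minus_add)
    also have "\<dots> = \<zero>\<^bsub>W\<^esub>" using b(3) d(3) lin(1,4) inB by (metis W.M.r_neg W.M.a_closed)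
    finally obtain a where a: "a \<in> A" "b \<oplus>\<^bsub>V\<^esub> \<ominus>\<^bsub>V\<^esub> d = y a" "b' \<oplus>\<^bsub>V\<^esub> \<ominus>\<^bsub>V\<^esub> d' = x a"
      using l(4) inB inB' subspaceD(4)[OF k(8)] by metis
    obtain a1 a2 where a12: "a1 \<in> A1" "a2 \<in> A2" "a = a1 \<oplus>\<^bsub>U\<^esub> a2" using dA(8)[OF a(1)] by blast
    have inA: "a1 \<in> A" "a2 \<in> A" using a12 dA by auto
    have "b \<oplus>\<^bsub>V\<^esub> \<ominus>\<^bsub>V\<^esub> d = y a1 \<oplus>\<^bsub>V\<^esub> y a2" "b' \<oplus>\<^bsub>V\<^esub> \<ominus>\<^bsub>V\<^esub> d' = x a1 \<oplus>\<^bsub>V\<^esub> x a2"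
      using a a12 inA linear_onD(2)[OF k(3)] linear_onD(2)[OF k(4)] by auto
    then have "b = y a1" "b' = x a1"
      using dir_sum_unique(1)[OF s(2)] b nB s(3-6) a12 by metis+
    then show "c = \<zero>\<^bsub>W\<^esub>" using l(5)[OF inA(1)] b(3) by simp
  next
    fix c assume "c \<in> C"
    then obtain b b' where b: "b \<in> B" "b' \<in> B" "c = x' b \<oplus>\<^bsub>W\<^esub> y' b'"
      using l(6) by (auto simp: plus_set_def)
    obtain b1 b2 where b1: "b1 \<in> B1" "b2 \<in> B2" "b = b1 \<oplus>\<^bsub>V\<^esub> b2" using dB(8)[OF b(1)] by blast
    obtain c1 c2 where c1: "c1 \<in> B1" "c2 \<in> B2" "b' = c1 \<oplus>\<^bsub>V\<^esub> c2" using dB(8)[OF b(2)] by blast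
    have inB: "b1 \<in> B" "b2 \<in> B" "c1 \<in> B" "c2 \<in> B" using b1 c1 dB(4,5) by auto
    have "c = (x' b1 \<oplus>\<^bsub>W\<^esub> y' c1) \<oplus>\<^bsub>W\<^esub> (x' b2 \<oplus>\<^bsub>W\<^esub> y' c2)"
      using b b1 c1 lin inB by (simp add: W.M.a_ac)
    moreover have "x' b1 \<oplus>\<^bsub>W\<^esub> y' c1 \<in> C1" "x' b2 \<oplus>\<^bsub>W\<^esub> y' c2 \<in> C2"
      using b1 c1 by (auto simp: C1_def C2_def plus_set_def)
    ultimately show "\<exists>a1\<in>C1. \<exists>a2\<in>C2. c = a1 \<oplus>\<^bsub>W\<^esub> a2" by blast
  qed (fact sub inC k'(8))+
  moreover have "x' b \<in> C1" "y' b \<in> C1" if "b \<in> B1" for b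
    using plus_set_upper[OF im(1,3)] that by (auto simp: C1_def)
  moreover have "x' b \<in> C2" "y' b \<in> C2" if "b \<in> B2" for b
    using plus_set_upper[OF im(2,4)] that by (auto simp: C2_def)
  ultimately show ?thesis unfolding kron_split_def using s(2) by simp
qed

text \<open>Linked summands satisfy dim A1 + dim C1 = 2 dim B1, so dim A1 + dim B1 and dim B1 + dim
  C1 have the same parity.\<close>

lemma linked_odd_split:
  assumes L: "linked K U V W A B C x y x' y'"
  shows "odd_split K U V A B x y \<longleftrightarrow> odd_split K V W B C x' y'"
proof
  assume "odd_split K V W B C x' y'"
  then obtain B1 B2 C1 C2 where S: "kron_split K V W B C x' y' B1 B2 C1 C2" and o: "odd (vdim K V B1 + vdim K W C1)"
    by (auto simp: odd_split_def)
  note u = linked_split_up[OF L S]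
  show "odd_split K U V A B x y"
    unfolding odd_split_def
  proof (intro exI conjI)
    show "odd (vdim K U {a \<in> A. x a \<in> B1 \<and> y a \<in> B1} + vdim K V B1)"
      using linked_vdim[OF u(2)] o by presburger
  qed (rule u(1))
next
  assume "odd_split K U V A B x y"
  then obtain A1 A2 B1 B2 where S: "kron_split K U V A B x y A1 A2 B1 B2" and o: "odd (vdim K U A1 + vdim K V B1)"
    by (auto simp: odd_split_def)
  let ?C1 = "plus_set W (x' ` B1) (y' ` B1)" and ?C2 = "plus_set W (x' ` B2) (y' ` B2)"
  note d = linked_split_down[OF L S]
  note u = linked_split_up[OF L d]
  note sS = kron_splitD[OF S] and k = kronD[OF linkedD(1)[OF L]] and su = kron_splitD[OF u(1)]
  note fA = kronD(1)[OF linkedD(1)[OF L]]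
  let ?A1 = "{a \<in> A. x a \<in> B1 \<and> y a \<in> B1}" and ?A2 = "{a \<in> A. x a \<in> B2 \<and> y a \<in> B2}"
  \<comment> \<open>Lifting the decomposition of B -> C back up gives \<open>?A1\<close> and
    \<open>?A2\<close>, which could be larger than \<open>A1\<close> and \<open>A2\<close>. Both
    pairs decompose \<open>A\<close>, so dimensions agree, and the count for linked summands applies
    to \<open>A1\<close>.\<close>
  have sub: "A1 \<subseteq> ?A1" "A2 \<subseteq> ?A2" using sS dir_sumD(4,5)[OF sS(1)] by auto
  have "vdim K U A1 \<le> vdim K U ?A1" "vdim K U A2 \<le> vdim K U ?A2"
    using fin_sub_mono(2)[OF dir_sum_vdim(2)[OF su(1) fA] dir_sumD(1)[OF sS(1)] sub(1)]
      fin_sub_mono(2)[OF dir_sum_vdim(3)[OF su(1) fA] dir_sumD(2)[OF sS(1)] sub(2)] .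
  then have "vdim K U A1 = vdim K U ?A1"
    using dir_sum_vdim(1)[OF sS(1) fA] dir_sum_vdim(1)[OF su(1) fA] by simp
  moreover have "even (vdim K U ?A1 + vdim K W ?C1)" by (simp add: linked_vdim[OF u(2)])
  ultimately have "odd (vdim K V B1 + vdim K W ?C1)" using o by simp
  then show "odd_split K V W B C x' y'" unfolding odd_split_def using d by blast
qed

section \<open>Existence of the neighbouring pairs\<close>

lemma linear_on_compose:
  "linear_on K U V A f \<Longrightarrow> linear_on K V W B g \<Longrightarrow> (\<And>a. a \<in> A \<Longrightarrow> f a \<in> B) \<Longrightarrow> linear_on K U W A (\<lambda>a. g (f a))"
  by (simp add: linear_on_def)

lemma linear_on_add:
  assumes W: "vectorspace K W" and f: "linear_on K V W A f" and g: "linear_on K V W A g"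
  shows "linear_on K V W A (\<lambda>a. f a \<oplus>\<^bsub>W\<^esub> g a)"
proof -
  interpret W: vectorspace K W by fact
  note F = linear_onD[OF f] and G = linear_onD[OF g]
  show ?thesis unfolding linear_on_def
    using F G by (simp add: W.M.a_ac W.smult_r_distr)
qed

lemma linear_on_inv:
  assumes A: "subspace K A V" and W: "vectorspace K W" and f: "linear_on K V W A f" and inj: "inj_on f A"
  shows "linear_on K W V (f ` A) (inv_into A f)"
proof -
  note S = subspaceD[OF A] and L = linear_onD[OF f]
  have "inv_into A f (f a \<oplus>\<^bsub>W\<^esub> f b) = inv_into A f (f a) \<oplus>\<^bsub>V\<^esub> inv_into A f (f b)" if "a \<in> A" "b \<in> A" for a b
    using that inj S(4) by (simp flip: L(2) add: inv_into_f_f)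
  moreover have "inv_into A f (c \<odot>\<^bsub>W\<^esub> f a) = c \<odot>\<^bsub>V\<^esub> inv_into A f (f a)" if "a \<in> A" "c \<in> carrier K" for a c
    using that inj S(5) by (simp flip: L(3) add: inv_into_f_f)
  ultimately show ?thesis
    unfolding linear_on_def using S(2) inj by (auto simp: inv_into_f_f)
qed

lemma proj_eq_zero_iff:
  assumes ds: "dir_sum K V A A1 A2" and a: "a \<in> A"
  shows "proj V A1 A2 a = \<zero>\<^bsub>V\<^esub> \<longleftrightarrow> a \<in> A2"
proof
  note D = dir_sumD[OF ds]
  interpret V: vectorspace K V by (rule subspaceD(1)[OF D(1)])
  have *: "proj V A2 A1 a \<in> A2" by (rule proj_closed[OF dir_sum_commute[OF ds] a])
  assume "proj V A1 A2 a = \<zero>\<^bsub>V\<^esub>"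
  then show "a \<in> A2" using proj_sum[OF ds a] * subspaceD(2)[OF D(2)] by fastforce
qed (rule proj_zero[OF ds])

text \<open>An embedding of \<open>V \<oplus> V\<close> into \<open>V\<close> keeps all iterated shifts of a pair within one space, and
  thus within one type, as needed for induction.\<close>
definition pairing :: "'k ring \<Rightarrow> ('k, 'v) module \<Rightarrow> ('v \<Rightarrow> 'v) \<Rightarrow> ('v \<Rightarrow> 'v) \<Rightarrow> bool" where
  "pairing K V J1 J2 \<longleftrightarrow> vectorspace K V \<and> linear_on K V V (carrier V) J1 \<and> linear_on K V V (carrier V) J2 \<and>
    (\<forall>v\<in>carrier V. \<forall>w\<in>carrier V. J1 v \<oplus>\<^bsub>V\<^esub> J2 w = \<zero>\<^bsub>V\<^esub> \<longrightarrow> v = \<zero>\<^bsub>V\<^esub> \<and> w = \<zero>\<^bsub>V\<^esub>)"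

lemma pairing_dir_sum:
  assumes P: "pairing K V J1 J2" and A: "fin_sub K V A"
  shows "dir_sum K V (plus_set V (J1 ` A) (J2 ` A)) (J1 ` A) (J2 ` A)"
    "fin_sub K V (J1 ` A)" "fin_sub K V (J2 ` A)" "inj_on J1 A" "inj_on J2 A"
    "linear_on K V V A J1" "linear_on K V V A J2"
proof -
  have V: "vectorspace K V" using P by (simp add: pairing_def)
  interpret V: vectorspace K V by fact
  note sA = fin_subD(1)[OF A] note Ac = subspaceD[OF sA]
  have AV: "A \<subseteq> carrier V" using Ac(2) by auto
  have J: "linear_on K V V (carrier V) J1" "linear_on K V V (carrier V) J2"
    and inj: "\<And>v w. v \<in> carrier V \<Longrightarrow> w \<in> carrier V \<Longrightarrow> J1 v \<oplus>\<^bsub>V\<^esub> J2 w = \<zero>\<^bsub>V\<^esub> \<Longrightarrow> v = \<zero>\<^bsub>V\<^esub> \<and> w = \<zero>\<^bsub>V\<^esub>"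
    using P by (auto simp: pairing_def)
  show lin: "linear_on K V V A J1" "linear_on K V V A J2"
    using J AV linear_on_subset by blast+
  show fs: "fin_sub K V (J1 ` A)" "fin_sub K V (J2 ` A)"
    using rank_nullity(1)[OF A V] lin by auto
  note z = linear_on_zero[OF sA V lin(1)] linear_on_zero[OF sA V lin(2)]
  note cl = linear_onD(1)[OF lin(1)] linear_onD(1)[OF lin(2)]
  show "inj_on J1 A" unfolding linear_on_inj_iff[OF sA V lin(1)]
    using inj[of _ "\<zero>\<^bsub>V\<^esub>"] z Ac(2) by auto
  show "inj_on J2 A" unfolding linear_on_inj_iff[OF sA V lin(2)]
    using inj[of "\<zero>\<^bsub>V\<^esub>"] z Ac(2) by auto
  show "dir_sum K V (plus_set V (J1 ` A) (J2 ` A)) (J1 ` A) (J2 ` A)"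
  proof -
    have "v = \<zero>\<^bsub>V\<^esub>" if v: "v \<in> J1 ` A" "v \<in> J2 ` A" for v
    proof -
      obtain a b where ab: "a \<in> A" "v = J1 a" "b \<in> A" "v = J2 b" using v by auto
      have "J1 a \<oplus>\<^bsub>V\<^esub> J2 (\<ominus>\<^bsub>V\<^esub> b) = \<zero>\<^bsub>V\<^esub>" using ab z(5)[of b] cl(1)[of a] by (simp add: V.M.r_neg)
      then have "a = \<zero>\<^bsub>V\<^esub>" using inj[of a "\<ominus>\<^bsub>V\<^esub> b"] ab Ac(2,6) by blast
      then show ?thesis using ab z(1) by simp
    qed
    then show ?thesis
      unfolding dir_sum_def using fin_subD(1)[OF fs(1)] fin_subD(1)[OF fs(2)] subspaceD(3) by blast
  qed
qed

text \<open>\<open>C\<close> is the cokernel of a \<mapsto> (y a, x a), with B + B realised as J1 B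
  + J2 B. A quotient would change the type, so \<open>C\<close> is a complement of the image, and
  \<open>q\<close> is the projection along the image. The absence of common kernel vectors is
  exactness on the left.\<close>

lemma linked_below:
  assumes P: "pairing K V J1 J2" and k: "kron K V V A B x y"
    and inj: "\<And>a. a \<in> A \<Longrightarrow> x a = \<zero>\<^bsub>V\<^esub> \<Longrightarrow> y a = \<zero>\<^bsub>V\<^esub> \<Longrightarrow> a = \<zero>\<^bsub>V\<^esub>"
  obtains C x' y' where "linked K V V V A B C x y x' y'"
proof -
  note k = kronD[OF assms(2)]
  interpret V: vectorspace K V by (rule k(9))
  note p = pairing_dir_sum[OF P k(2)]
  note Bc = subspaceD[OF k(8)]
  let ?D = "plus_set V (J1 ` B) (J2 ` B)"
  define s where "s a = J1 (y a) \<oplus>\<^bsub>V\<^esub> J2 (x a)" for a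
  have slin: "linear_on K V V A s" unfolding s_def
    by (intro linear_on_add k linear_on_compose[OF _ p(6)] linear_on_compose[OF _ p(7)])
  note S = rank_nullity(1)[OF k(1,9) slin]
  have SD: "s ` A \<subseteq> ?D" using k(5,6) by (auto simp: s_def intro!: plus_setI)
  obtain C where "dir_sum K V ?D (s ` A) C"
    using complement_exists[OF fin_sub_plus[OF p(2,3)] fin_subD(1)[OF S] SD] .
  then have C: "dir_sum K V ?D C (s ` A)" by (rule dir_sum_commute)
  note dC = dir_sumD[OF C] and dC' = dir_sum_vdim[OF C fin_sub_plus[OF p(2,3)]]
  define q where "q = proj V C (s ` A)"
  have qlin: "linear_on K V V ?D q" unfolding q_def by (rule linear_on_proj[OF C])
  have JD: "J1 b \<in> ?D" "J2 b \<in> ?D" if "b \<in> B" for b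
    using plus_set_upper[OF fin_subD(1)[OF p(2)] fin_subD(1)[OF p(3)]] that by auto
  have q: "q (J1 b) \<oplus>\<^bsub>V\<^esub> q (J2 b') = q (J1 b \<oplus>\<^bsub>V\<^esub> J2 b')" if "b \<in> B" "b' \<in> B" for b b'
    using linear_onD(2)[OF qlin] JD that by simp
  have "linked K V V V A B C x y (\<lambda>b. q (J1 b)) (\<lambda>b. q (J2 b))"
    unfolding linked_def
  proof (intro conjI ballI impI)
    show "kron K V V A B x y" by fact
    show "kron K V V B C (\<lambda>b. q (J1 b)) (\<lambda>b. q (J2 b))"
      unfolding kron_def
      using k(2) dC'(2) linear_on_compose[OF p(6) qlin JD(1)] linear_on_compose[OF p(7) qlin JD(2)]
        JD proj_closed[OF C] by (simp add: q_def)
    show "a = \<zero>\<^bsub>V\<^esub>" if "a \<in> A" "x a = \<zero>\<^bsub>V\<^esub>" "y a = \<zero>\<^bsub>V\<^esub>" for a by (rule inj[OF that])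
    show "q (J1 b) \<oplus>\<^bsub>V\<^esub> q (J2 b') = \<zero>\<^bsub>V\<^esub> \<longleftrightarrow> (\<exists>a\<in>A. b = y a \<and> b' = x a)" if b: "b \<in> B" "b' \<in> B" for b b'
    proof -
      have inD: "J1 b \<oplus>\<^bsub>V\<^esub> J2 b' \<in> ?D" using b by (auto simp: plus_set_def)
      have "q (J1 b) \<oplus>\<^bsub>V\<^esub> q (J2 b') = \<zero>\<^bsub>V\<^esub> \<longleftrightarrow> J1 b \<oplus>\<^bsub>V\<^esub> J2 b' \<in> s ` A"
        unfolding q[OF b] unfolding q_def by (rule proj_eq_zero_iff[OF C inD])
      also have "\<dots> \<longleftrightarrow> (\<exists>a\<in>A. b = y a \<and> b' = x a)"
      proof
        assume "J1 b \<oplus>\<^bsub>V\<^esub> J2 b' \<in> s ` A"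
        then obtain a where a: "a \<in> A" "J1 b \<oplus>\<^bsub>V\<^esub> J2 b' = J1 (y a) \<oplus>\<^bsub>V\<^esub> J2 (x a)" by (auto simp: s_def)
        have "J1 b = J1 (y a)" "J2 b' = J2 (x a)"
          using dir_sum_unique[OF p(1) imageI[OF b(1)] imageI[OF k(6)[OF a(1)]] imageI[OF b(2)] imageI[OF k(5)[OF a(1)]] a(2)] .
        then show "\<exists>a\<in>A. b = y a \<and> b' = x a"
          using inj_onD[OF p(4) _ b(1) k(6)[OF a(1)]] inj_onD[OF p(5) _ b(2) k(5)[OF a(1)]] a(1) by blast
      qed (auto simp: s_def)
      finally show ?thesis .
    qed
    show "C = plus_set V ((\<lambda>b. q (J1 b)) ` B) ((\<lambda>b. q (J2 b)) ` B)"
    proof (intro equalityI subsetI)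
      fix c assume c: "c \<in> C"
      then have "c \<in> ?D" "q c = c" using dC(4) proj_id[OF C] by (auto simp: q_def)
      then obtain b b' where "b \<in> B" "b' \<in> B" "c = J1 b \<oplus>\<^bsub>V\<^esub> J2 b'" by (auto simp: plus_set_def)
      then have "c = q (J1 b) \<oplus>\<^bsub>V\<^esub> q (J2 b')" using q[of b b'] \<open>q c = c\<close> by simp
      then show "c \<in> plus_set V ((\<lambda>b. q (J1 b)) ` B) ((\<lambda>b. q (J2 b)) ` B)"
        using \<open>b \<in> B\<close> \<open>b' \<in> B\<close> by (auto simp: plus_set_def)
    next
      fix c assume "c \<in> plus_set V ((\<lambda>b. q (J1 b)) ` B) ((\<lambda>b. q (J2 b)) ` B)"
      then obtain b b' where b: "b \<in> B" "b' \<in> B" "c = q (J1 b) \<oplus>\<^bsub>V\<^esub> q (J2 b')" by (auto simp: plus_set_def)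
      then show "c \<in> C" using q[of b b'] proj_closed[OF C] by (auto simp: q_def plus_set_def)
    qed
  qed
  then show thesis by (rule that)
qed

text \<open>\<open>C\<close> is the kernel of (a, b) \<mapsto> x a + y b inside J1 A + J2 A, and its
  maps are the two coordinates. That both images generate \<open>B\<close> is exactness on the
  right.\<close>

lemma linked_above:
  assumes P: "pairing K V J1 J2" and k: "kron K V V A B x y" and surj: "B = plus_set V (x ` A) (y ` A)"
  obtains C x' y' where "linked K V V V C A B x' y' x y"
proof -
  note k = kronD[OF assms(2)]
  interpret V: vectorspace K V by (rule k(9))
  note p = pairing_dir_sum[OF P k(1)]
  note Ac = subspaceD[OF k(7)]
  let ?D = "plus_set V (J1 ` A) (J2 ` A)"
  note D = fin_sub_plus[OF p(2,3)]
  define q1 where "q1 d = inv_into A J1 (proj V (J1 ` A) (J2 ` A) d)" for d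
  define q2 where "q2 d = inv_into A J2 (proj V (J2 ` A) (J1 ` A) d)" for d
  note ds = p(1) and ds' = dir_sum_commute[OF p(1)]
  have q1lin: "linear_on K V V ?D q1" unfolding q1_def
    by (rule linear_on_compose[OF linear_on_proj[OF ds] linear_on_inv[OF k(7) k(9) p(6,4)] proj_closed[OF ds]])
  have q2lin: "linear_on K V V ?D q2" unfolding q2_def
    by (rule linear_on_compose[OF linear_on_proj[OF ds'] linear_on_inv[OF k(7) k(9) p(7,5)] proj_closed[OF ds']])
  have q: "q1 (J1 a \<oplus>\<^bsub>V\<^esub> J2 b) = a" "q2 (J1 a \<oplus>\<^bsub>V\<^esub> J2 b) = b" if "a \<in> A" "b \<in> A" for a b
  proof -
    show "q1 (J1 a \<oplus>\<^bsub>V\<^esub> J2 b) = a"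
      unfolding q1_def using proj_add[OF ds, of "J1 a" "J2 b"] that p(4) by (simp add: inv_into_f_f)
    have "J1 a \<oplus>\<^bsub>V\<^esub> J2 b = J2 b \<oplus>\<^bsub>V\<^esub> J1 a"
      using linear_onD(1)[OF p(6)] linear_onD(1)[OF p(7)] that by (simp add: V.M.a_comm)
    then show "q2 (J1 a \<oplus>\<^bsub>V\<^esub> J2 b) = b"
      unfolding q2_def using proj_add[OF ds', of "J2 b" "J1 a"] that p(5) by (simp add: inv_into_f_f)
  qed
  have Dex: "\<exists>a\<in>A. \<exists>b\<in>A. d = J1 a \<oplus>\<^bsub>V\<^esub> J2 b" if "d \<in> ?D" for d using that by (auto simp: plus_set_def)
  have qA: "q1 d \<in> A" "q2 d \<in> A" if "d \<in> ?D" for d using Dex[OF that] q by auto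
  define e where "e d = x (q1 d) \<oplus>\<^bsub>V\<^esub> y (q2 d)" for d
  have elin: "linear_on K V V ?D e" unfolding e_def
    by (intro linear_on_add k(9) linear_on_compose[OF q1lin k(3)] linear_on_compose[OF q2lin k(4)] qA)
  define C where "C = {d \<in> ?D. e d \<in> {\<zero>\<^bsub>V\<^esub>}}"
  have sC: "subspace K C V" unfolding C_def
    by (rule subspace_vimage[OF fin_subD(1)[OF D] subspace_zero[OF k(9)] elin])
  have CD: "C \<subseteq> ?D" by (auto simp: C_def)
  have "linked K V V V C A B q2 q1 x y"
    unfolding linked_def
  proof (intro conjI ballI impI)
    show "kron K V V C A q2 q1"
      unfolding kron_def using fin_sub_mono(1)[OF D sC CD] k(1) linear_on_subset[OF q1lin CD] linear_on_subset[OF q2lin CD] qA CD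
      by auto
    show "kron K V V A B x y" by fact
    show "d = \<zero>\<^bsub>V\<^esub>" if d: "d \<in> C" "q2 d = \<zero>\<^bsub>V\<^esub>" "q1 d = \<zero>\<^bsub>V\<^esub>" for d
    proof -
      obtain a b where ab: "a \<in> A" "b \<in> A" "d = J1 a \<oplus>\<^bsub>V\<^esub> J2 b" using Dex d(1) CD by blast
      then have "a = \<zero>\<^bsub>V\<^esub>" "b = \<zero>\<^bsub>V\<^esub>" using q[OF ab(1,2)] d by auto
      then show ?thesis
        using ab(3) linear_on_zero(1)[OF k(7,9) p(6)] linear_on_zero(1)[OF k(7,9) p(7)] by simp
    qed
    show "x b \<oplus>\<^bsub>V\<^esub> y b' = \<zero>\<^bsub>V\<^esub> \<longleftrightarrow> (\<exists>a\<in>C. b = q1 a \<and> b' = q2 a)" if b: "b \<in> A" "b' \<in> A" for b b'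
    proof
      assume "x b \<oplus>\<^bsub>V\<^esub> y b' = \<zero>\<^bsub>V\<^esub>"
      then have "J1 b \<oplus>\<^bsub>V\<^esub> J2 b' \<in> C" using b q[OF b] by (auto simp: C_def e_def plus_set_def)
      then show "\<exists>a\<in>C. b = q1 a \<and> b' = q2 a" using q[OF b] by metis
    qed (auto simp: C_def e_def)
    show "B = plus_set V (x ` A) (y ` A)" by fact
  qed
  then show thesis by (rule that)
qed

section \<open>Odd summands from unbalanced dimensions\<close>

lemma fin_sub_trivial_split:
  assumes "fin_sub K V A"
  shows "dir_sum K V A {\<zero>\<^bsub>V\<^esub>} A" "dir_sum K V A A {\<zero>\<^bsub>V\<^esub>}"
proof -
  note D = fin_subD[OF assms]
  interpret V: vectorspace K V by (rule D(2))
  show "dir_sum K V A {\<zero>\<^bsub>V\<^esub>} A"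
    by (rule dir_sumI) (use D subspace_zero[OF D(2)] subspaceD[OF D(1)] in auto)
  then show "dir_sum K V A A {\<zero>\<^bsub>V\<^esub>}" by (rule dir_sum_commute)
qed

text \<open>With all elements of \<open>A\<close> that both maps send into \<open>B'\<close> in
  place of \<open>A'\<close>, the restricted triple is linked and equality holds. So dim A' - dim B'
  does not decrease on passing to the next pair.\<close>

lemma linked_sub_vdim:
  assumes L: "linked K U V W A B C x y x' y'"
    and A': "subspace K A' U" "A' \<subseteq> A" and B': "subspace K B' V" "B' \<subseteq> B"
    and xy: "\<And>a. a \<in> A' \<Longrightarrow> x a \<in> B' \<and> y a \<in> B'"
  shows "vdim K U A' + vdim K W (plus_set W (x' ` B') (y' ` B')) \<le> 2 * vdim K V B'"
proof -
  note l = linkedD[OF L]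
  note k = kronD[OF l(1)] and k' = kronD[OF l(2)]
  let ?A = "{a \<in> A. x a \<in> B' \<and> y a \<in> B'}" and ?C = "plus_set W (x' ` B') (y' ` B')"
  have "?A = {a \<in> A. x a \<in> B'} \<inter> {a \<in> A. y a \<in> B'}" by auto
  then have sA: "subspace K ?A U"
    using subspace_Int[OF subspace_vimage[OF k(7) B'(1) k(3)] subspace_vimage[OF k(7) B'(1) k(4)]] by simp
  have fA: "fin_sub K U ?A" by (rule fin_sub_mono(1)[OF k(1) sA]) auto
  have fB: "fin_sub K V B'" by (rule fin_sub_mono(1)[OF k(2) B'])
  note lin = linear_on_subset[OF k'(3) B'(2)] linear_on_subset[OF k'(4) B'(2)]
  note im = rank_nullity(1)[OF fB k'(10) lin(1)] rank_nullity(1)[OF fB k'(10) lin(2)]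
  note up = plus_set_upper[OF fin_subD(1)[OF im(1)] fin_subD(1)[OF im(2)]]
  have "linked K U V W ?A B' ?C x y x' y'"
    unfolding linked_def
  proof (intro conjI ballI impI)
    have "linear_on K U V ?A x" "linear_on K U V ?A y"
      using linear_on_subset[OF k(3)] linear_on_subset[OF k(4)] by auto
    then show "kron K U V ?A B' x y" unfolding kron_def using fA fB by auto
    show "kron K V W B' ?C x' y'" unfolding kron_def using fB fin_sub_plus[OF im] lin up by auto
    show "a = \<zero>\<^bsub>U\<^esub>" if "a \<in> ?A" "x a = \<zero>\<^bsub>V\<^esub>" "y a = \<zero>\<^bsub>V\<^esub>" for a using that l(3) by auto
    show "x' b \<oplus>\<^bsub>W\<^esub> y' b' = \<zero>\<^bsub>W\<^esub> \<longleftrightarrow> (\<exists>a\<in>?A. b = y a \<and> b' = x a)" if "b \<in> B'" "b' \<in> B'" for b b'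
      using that l(4)[of b b'] l(5) B'(2) by auto
  qed simp
  from linked_vdim[OF this] have "vdim K U ?A + vdim K W ?C = 2 * vdim K V B'" .
  moreover have "vdim K U A' \<le> vdim K U ?A"
    by (rule fin_sub_mono(2)[OF fA A'(1)]) (use A'(2) xy in auto)
  ultimately show ?thesis by simp
qed

text \<open>The vector splits off as a summand k -> 0, with any complement of its line in
  \<open>A\<close> and all of \<open>B\<close> on the other side.\<close>

lemma odd_split_if_common_kernel:
  assumes k: "kron K V W A B x y" and a: "a \<in> A" "a \<noteq> \<zero>\<^bsub>V\<^esub>" "x a = \<zero>\<^bsub>W\<^esub>" "y a = \<zero>\<^bsub>W\<^esub>"
  shows "odd_split K V W A B x y"
proof -
  note k = kronD[OF k]
  let ?L = "{c \<odot>\<^bsub>V\<^esub> a | c. c \<in> carrier K}"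
  note Ac = subspaceD[OF k(7)]
  interpret W: vectorspace K W by (rule k(10))
  note L = vdim_line[OF k(9) Ac(2)[OF a(1)] a(2)]
  have LA: "?L \<subseteq> A" using Ac(5) a(1) by auto
  obtain C where C: "dir_sum K V A ?L C" using complement_exists[OF k(1) fin_subD(1)[OF L(1)] LA] .
  have "kron_split K V W A B x y ?L C {\<zero>\<^bsub>W\<^esub>} B"
    unfolding kron_split_def
    using C fin_sub_trivial_split(1)[OF k(2)] linear_onD(3)[OF k(3)] linear_onD(3)[OF k(4)] a k(5,6) dir_sumD(5)[OF C]
    by (auto simp: subset_iff)
  then show ?thesis unfolding odd_split_def using L(2) vdim_zero[OF k(10)] by force
qed

text \<open>A vector of \<open>B\<close> outside the sum of the images splits off as a summand 0 ->
  k, once the complement of its line is chosen to contain both images.\<close>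

lemma odd_split_if_not_generated:
  assumes k: "kron K V W A B x y" and ne: "B \<noteq> plus_set W (x ` A) (y ` A)"
  shows "odd_split K V W A B x y"
proof -
  note k = kronD[OF k]
  interpret W: vectorspace K W by (rule k(10))
  note Bc = subspaceD[OF k(8)]
  note im = rank_nullity(1)[OF k(1,10,3)] rank_nullity(1)[OF k(1,10,4)]
  let ?S = "plus_set W (x ` A) (y ` A)"
  note S = fin_subD(1)[OF fin_sub_plus[OF im]] and up = plus_set_upper[OF fin_subD(1)[OF im(1)] fin_subD(1)[OF im(2)]]
  have SB: "?S \<subseteq> B" by (rule plus_set_least[OF k(8)]) (use k(5,6) in auto)
  then obtain v where v: "v \<in> B" "v \<notin> ?S" using ne by auto
  let ?L = "{c \<odot>\<^bsub>W\<^esub> v | c. c \<in> carrier K}"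
  have v0: "v \<noteq> \<zero>\<^bsub>W\<^esub>" using v subspaceD(3)[OF S] by auto
  note L = vdim_line[OF k(10) Bc(2)[OF v(1)] v0] and dL = dir_sum_line[OF S Bc(2)[OF v(1)] v(2)]
  have LB: "?L \<subseteq> B" using Bc(5) v(1) by auto
  have int: "?S \<inter> ?L = {\<zero>\<^bsub>W\<^esub>}" using dL unfolding dir_sum_def by blast
  obtain C where C: "?S \<subseteq> C" "dir_sum K W B C ?L"
    using complement_containing[OF k(2) S SB fin_subD(1)[OF L(1)] LB int] .
  have "kron_split K V W A B x y {\<zero>\<^bsub>V\<^esub>} A ?L C"
    unfolding kron_split_def
    using fin_sub_trivial_split(1)[OF k(1)] dir_sum_commute[OF C(2)] C(1) up
      linear_on_zero(1)[OF k(7,10,3)] linear_on_zero(1)[OF k(7,10,4)] subspaceD(3)[OF fin_subD(1)[OF L(1)]]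
    by (auto simp: subset_iff)
  then show ?thesis unfolding odd_split_def using L(2) vdim_zero[OF k(9)] by force
qed

text \<open>Unless some vector is killed by both maps, pass to the next pair B -> C and its subpair
  generated by \<open>B'\<close>. Its target has dimension at most 2 dim B' - dim A' < dim B', so
  the hypothesis persists, while the source falls from dim A' to dim B'. The descent has to end in a
  common kernel vector.\<close>

lemma odd_split_if_large_sub:
  assumes P: "pairing K V J1 J2" and "kron K V V A B x y"
    and "subspace K A' V" "A' \<subseteq> A" "subspace K B' V" "B' \<subseteq> B"
    and "\<And>a. a \<in> A' \<Longrightarrow> x a \<in> B' \<and> y a \<in> B'" and "vdim K V B' < vdim K V A'"
  shows "odd_split K V V A B x y"
  using assms(2-)
proof (induction "vdim K V A'" arbitrary: A B x y A' B' rule: less_induct)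
  case less
  note k = kronD[OF less.prems(1)]
  show ?case
  proof (cases "\<exists>a\<in>A. a \<noteq> \<zero>\<^bsub>V\<^esub> \<and> x a = \<zero>\<^bsub>V\<^esub> \<and> y a = \<zero>\<^bsub>V\<^esub>")
    case True
    then show ?thesis using odd_split_if_common_kernel[OF less.prems(1)] by blast
  next
    case False
    then obtain C x' y' where L: "linked K V V V A B C x y x' y'"
      using linked_below[OF P less.prems(1)] by blast
    note l = linkedD[OF L] note k' = kronD[OF l(2)]
    let ?C = "plus_set V (x' ` B') (y' ` B')"
    note lin = linear_on_subset[OF k'(3) less.prems(5)] linear_on_subset[OF k'(4) less.prems(5)]
    note im = subspace_image[OF less.prems(4) k(9) lin(1)] subspace_image[OF less.prems(4) k(9) lin(2)]
    have "vdim K V A' + vdim K V ?C \<le> 2 * vdim K V B'"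
      by (rule linked_sub_vdim[OF L less.prems(2-6)])
    then have "vdim K V ?C < vdim K V B'" using less.prems(7) by simp
    moreover have "?C \<subseteq> C" using l(6) less.prems(5) unfolding plus_set_def by blast
    ultimately have "odd_split K V V B C x' y'"
      using less.hyps[OF less.prems(7) l(2) less.prems(4,5) subspace_plus[OF im]] plus_set_upper[OF im] by blast
    then show ?thesis using linked_odd_split[OF L] by simp
  qed
qed

text \<open>The dual descent: if the images generate \<open>B\<close>, the previous pair C -> A has
  dim C = 2 dim A - dim B < dim A, so the hypothesis persists and the source shrinks. It has to end
  in a pair whose target is not generated.\<close>

lemma odd_split_if_larger_codomain:
  assumes P: "pairing K V J1 J2" and "kron K V V A B x y" and "vdim K V A < vdim K V B"
  shows "odd_split K V V A B x y"
  using assms(2-)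
proof (induction "vdim K V A" arbitrary: A B x y rule: less_induct)
  case less
  show ?case
  proof (cases "B = plus_set V (x ` A) (y ` A)")
    case False
    then show ?thesis by (rule odd_split_if_not_generated[OF less.prems(1)])
  next
    case True
    obtain C x' y' where L: "linked K V V V C A B x' y' x y"
      using linked_above[OF P less.prems(1) True] .
    have "vdim K V C + vdim K V B = 2 * vdim K V A" by (rule linked_vdim[OF L])
    then have "odd_split K V V C A x' y'"
      using less.hyps[OF _ linkedD(1)[OF L]] less.prems(2) by simp
    then show ?thesis using linked_odd_split[OF L] by simp
  qed
qed

section \<open>Transport into a space containing two copies of itself\<close>

lemma dir_sum_image:
  assumes ds: "dir_sum K V A A1 A2" and W: "vectorspace K W" and f: "linear_on K V W A f" and inj: "inj_on f A"
  shows "dir_sum K W (f ` A) (f ` A1) (f ` A2)"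
proof -
  note D = dir_sumD[OF ds]
  note lin = linear_on_subset[OF f D(4)] linear_on_subset[OF f D(5)]
  show ?thesis
  proof (rule dir_sumI)
    show "subspace K (f ` A1) W" "subspace K (f ` A2) W" "subspace K (f ` A) W"
      using subspace_image[OF D(1) W lin(1)] subspace_image[OF D(2) W lin(2)] subspace_image[OF D(3) W f] .
    fix b assume "b \<in> f ` A1" "b \<in> f ` A2"
    then obtain a a' where a: "a \<in> A1" "a' \<in> A2" "b = f a" "f a = f a'" by auto
    then have "a = a'" using inj_onD[OF inj] D(4,5) by blast
    then have "a = \<zero>\<^bsub>V\<^esub>" using D(6) a by blast
    then show "b = \<zero>\<^bsub>W\<^esub>" using a linear_on_zero(1)[OF D(3) W f] by simp
  next
    fix b assume "b \<in> f ` A"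
    then obtain a where a: "a \<in> A" "b = f a" by auto
    obtain a1 a2 where a12: "a1 \<in> A1" "a2 \<in> A2" "a = a1 \<oplus>\<^bsub>V\<^esub> a2" using D(8)[OF a(1)] by blast
    then have "b = f a1 \<oplus>\<^bsub>W\<^esub> f a2" using a linear_onD(2)[OF f] D(4,5) by blast
    then show "\<exists>a1\<in>f ` A1. \<exists>a2\<in>f ` A2. b = a1 \<oplus>\<^bsub>W\<^esub> a2" using a12 by blast
  qed (use D(4,5) in auto)
qed

text \<open>A nonzero finite dimensional space has no room for two copies of itself. Sequences have:
  one copy goes to the even indices, the other to the odd ones.\<close>

definition seq_space :: "('k, 'v) module \<Rightarrow> ('k, nat \<Rightarrow> 'v) module" where
  "seq_space V = \<lparr>carrier = {f. \<forall>n. f n \<in> carrier V}, mult = undefined, one = undefined,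
    zero = (\<lambda>n. \<zero>\<^bsub>V\<^esub>), add = (\<lambda>f g n. f n \<oplus>\<^bsub>V\<^esub> g n), smult = (\<lambda>c f n. c \<odot>\<^bsub>V\<^esub> f n)\<rparr>"

lemma seq_space_vectorspace:
  assumes "vectorspace K V"
  shows "vectorspace K (seq_space V)"
proof -
  interpret V: vectorspace K V by fact
  have "abelian_group (seq_space V)"
  proof (rule abelian_groupI)
    fix f assume "f \<in> carrier (seq_space V)"
    then show "\<exists>g\<in>carrier (seq_space V). g \<oplus>\<^bsub>seq_space V\<^esub> f = \<zero>\<^bsub>seq_space V\<^esub>"
      by (intro bexI[of _ "\<lambda>n. \<ominus>\<^bsub>V\<^esub> f n"]) (auto simp: seq_space_def V.M.l_neg)
  qed (auto simp: seq_space_def V.M.a_ac)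
  then have "module K (seq_space V)"
    by (intro moduleI V.R.cring_axioms)
      (auto simp: seq_space_def V.smult_l_distr V.smult_r_distr V.smult_assoc1)
  then show ?thesis
    by (simp add: vectorspace_def V.field_axioms)
qed

lemma pairing_seq_space:
  assumes "vectorspace K V"
  shows "pairing K (seq_space V) (\<lambda>f n. if even n then f (n div 2) else \<zero>\<^bsub>V\<^esub>)
    (\<lambda>f n. if even n then \<zero>\<^bsub>V\<^esub> else f (n div 2))"
proof -
  interpret V: vectorspace K V by fact
  show ?thesis
    unfolding pairing_def
  proof (intro conjI ballI impI)
    show "vectorspace K (seq_space V)" by (rule seq_space_vectorspace) fact
    fix f g assume fg: "f \<in> carrier (seq_space V)" "g \<in> carrier (seq_space V)"
      and 0: "(\<lambda>n. if even n then f (n div 2) else \<zero>\<^bsub>V\<^esub>) \<oplus>\<^bsub>seq_space V\<^esub>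
        (\<lambda>n. if even n then \<zero>\<^bsub>V\<^esub> else g (n div 2)) = \<zero>\<^bsub>seq_space V\<^esub>"
    have *: "(if even n then f (n div 2) else \<zero>\<^bsub>V\<^esub>) \<oplus>\<^bsub>V\<^esub> (if even n then \<zero>\<^bsub>V\<^esub> else g (n div 2)) = \<zero>\<^bsub>V\<^esub>" for n
      using fun_cong[OF 0, of n] by (simp add: seq_space_def)
    \<comment> \<open>The indices 2n and 2n + 1 both halve to n, the former reading off f and the
      latter g.\<close>
    have "f n = \<zero>\<^bsub>V\<^esub>" "g n = \<zero>\<^bsub>V\<^esub>" for n
      using *[of "2 * n"] *[of "2 * n + 1"] fg by (auto simp: seq_space_def)
    then show "f = \<zero>\<^bsub>seq_space V\<^esub>" "g = \<zero>\<^bsub>seq_space V\<^esub>" by (auto simp: seq_space_def)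
  qed (auto simp: linear_on_def seq_space_def fun_eq_iff)
qed

definition seq_single :: "('k, 'v) module \<Rightarrow> 'v \<Rightarrow> nat \<Rightarrow> 'v" where
  "seq_single V v n = (if n = 0 then v else \<zero>\<^bsub>V\<^esub>)"

text \<open>\<open>E\<close> puts a vector at index 0, and evaluation at 0 inverts it on its image.
  This evaluation carries a decomposition found among sequences back to \<open>V\<close> with the
  same dimensions, so the descents through iterated shifts become usable for the original
  pair.\<close>

lemma odd_split_seq_space:
  assumes k: "kron K V V A B x y"
  defines "E \<equiv> seq_single V"
  shows "linear_on K V (seq_space V) (carrier V) E" "inj_on E (carrier V)"
    "kron K (seq_space V) (seq_space V) (E ` A) (E ` B) (\<lambda>f. E (x (f 0))) (\<lambda>f. E (y (f 0)))"
    "odd_split K (seq_space V) (seq_space V) (E ` A) (E ` B) (\<lambda>f. E (x (f 0))) (\<lambda>f. E (y (f 0))) \<Longrightarrow>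
      odd_split K V V A B x y"
proof -
  note k = kronD[OF k]
  let ?S = "seq_space V"
  have S: "vectorspace K ?S" by (rule seq_space_vectorspace[OF k(9)])
  interpret V: vectorspace K V by (rule k(9))
  have E0: "E v 0 = v" for v by (simp add: E_def seq_single_def)
  show Elin: "linear_on K V ?S (carrier V) E"
    by (auto simp: linear_on_def seq_space_def E_def seq_single_def fun_eq_iff)
  show "inj_on E (carrier V)" by (metis E0 inj_onI)
  then have inj: "inj_on E C" for C by (metis E0 inj_onI)
  have lin: "linear_on K V ?S C E" if "subspace K C V" for C
    using linear_on_subset[OF Elin] subspaceD(2)[OF that] by blast
  have lin0: "linear_on K ?S V C (\<lambda>f. f 0)" if "C \<subseteq> carrier ?S" for C
    using that by (auto simp: linear_on_def seq_space_def)
  have inj0: "inj_on (\<lambda>f. f 0) (E ` C)" for C by (rule inj_onI) (auto simp: E0)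
  have EC: "E ` C \<subseteq> carrier ?S" if "subspace K C V" for C
    using subspaceD(2)[OF that] by (auto simp: E_def seq_single_def seq_space_def)
  have im0: "(\<lambda>f. f 0) ` E ` C = C" for C by (simp add: image_image E0)
  note fEA = rank_nullity(1)[OF k(1) S lin[OF k(7)]] and fEB = rank_nullity(1)[OF k(2) S lin[OF k(8)]]
  show "kron K ?S ?S (E ` A) (E ` B) (\<lambda>f. E (x (f 0))) (\<lambda>f. E (y (f 0)))"
    unfolding kron_def
  proof (intro conjI)
    show "linear_on K ?S ?S (E ` A) (\<lambda>f. E (x (f 0)))"
      by (rule linear_on_compose[OF linear_on_compose[OF lin0[OF EC[OF k(7)]] k(3)] Elin])
        (use k(5) subspaceD(2)[OF k(8)] in \<open>auto simp: E0\<close>)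
    show "linear_on K ?S ?S (E ` A) (\<lambda>f. E (y (f 0)))"
      by (rule linear_on_compose[OF linear_on_compose[OF lin0[OF EC[OF k(7)]] k(4)] Elin])
        (use k(6) subspaceD(2)[OF k(8)] in \<open>auto simp: E0\<close>)
  qed (use fEA fEB k(5,6) in \<open>auto simp: E0\<close>)
  assume "odd_split K ?S ?S (E ` A) (E ` B) (\<lambda>f. E (x (f 0))) (\<lambda>f. E (y (f 0)))"
  then obtain A1 A2 B1 B2 where "kron_split K ?S ?S (E ` A) (E ` B) (\<lambda>f. E (x (f 0))) (\<lambda>f. E (y (f 0))) A1 A2 B1 B2"
    and o: "odd (vdim K ?S A1 + vdim K ?S B1)" unfolding odd_split_def by blast
  note s = kron_splitD[OF this(1)]
  note dA = dir_sumD[OF s(1)] and dB = dir_sumD[OF s(2)]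
  let ?r = "\<lambda>f :: nat \<Rightarrow> _. f 0"
  have dsA: "dir_sum K V A (?r ` A1) (?r ` A2)"
    using dir_sum_image[OF s(1) k(9) lin0[OF EC[OF k(7)]] inj0] unfolding im0 .
  have dsB: "dir_sum K V B (?r ` B1) (?r ` B2)"
    using dir_sum_image[OF s(2) k(9) lin0[OF EC[OF k(8)]] inj0] unfolding im0 .
  have ER: "E (f 0) = f" if "f \<in> E ` C" for f C using that by (auto simp: E0)
  have "kron_split K V V A B x y (?r ` A1) (?r ` A2) (?r ` B1) (?r ` B2)"
    unfolding kron_split_def
  proof (intro conjI ballI dsA dsB)
    fix a assume "a \<in> ?r ` A1"
    then obtain f where f: "f \<in> A1" "a = f 0" by auto
    show "x a \<in> ?r ` B1" "y a \<in> ?r ` B1"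
      using imageI[OF s(3)[OF f(1)], of ?r] imageI[OF s(4)[OF f(1)], of ?r] f(2) by (simp_all add: E0)
  next
    fix a assume "a \<in> ?r ` A2"
    then obtain f where f: "f \<in> A2" "a = f 0" by auto
    show "x a \<in> ?r ` B2" "y a \<in> ?r ` B2"
      using imageI[OF s(5)[OF f(1)], of ?r] imageI[OF s(6)[OF f(1)], of ?r] f(2) by (simp_all add: E0)
  qed
  moreover have "vdim K V (?r ` A1) = vdim K ?S A1"
    by (rule vdim_image_inj[OF dir_sum_vdim(2)[OF s(1) fEA] k(9) lin0 inj_on_subset[OF inj0 dA(4)]])
      (use dA(4) EC[OF k(7)] in auto)
  moreover have "vdim K V (?r ` B1) = vdim K ?S B1"
    by (rule vdim_image_inj[OF dir_sum_vdim(2)[OF s(2) fEB] k(9) lin0 inj_on_subset[OF inj0 dB(4)]])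
      (use dB(4) EC[OF k(8)] in auto)
  ultimately show "odd_split K V V A B x y" unfolding odd_split_def using o by metis
qed

lemma no_odd_split_vdim_le:
  assumes k: "kron K V V A B x y" and no: "\<not> odd_split K V V A B x y"
  shows "vdim K V B \<le> vdim K V A"
    and "\<And>A' B'. subspace K A' V \<Longrightarrow> A' \<subseteq> A \<Longrightarrow> subspace K B' V \<Longrightarrow> B' \<subseteq> B \<Longrightarrow>
      (\<And>a. a \<in> A' \<Longrightarrow> x a \<in> B' \<and> y a \<in> B') \<Longrightarrow> vdim K V A' \<le> vdim K V B'"
proof -
  define E where "E = seq_single V"
  note sq = odd_split_seq_space[OF k, folded E_def]
  note kk = kronD[OF k]
  note P = pairing_seq_space[OF kk(9)]
  have S: "vectorspace K (seq_space V)" by (rule seq_space_vectorspace[OF kk(9)])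
  have E0: "E v 0 = v" for v by (simp add: E_def seq_single_def)
  have lin: "linear_on K V (seq_space V) C E" if "subspace K C V" for C
    using linear_on_subset[OF sq(1)] subspaceD(2)[OF that] by blast
  have inj: "inj_on E C" for C by (metis E0 inj_onI)
  have dim: "vdim K (seq_space V) (E ` C) = vdim K V C" if "fin_sub K V C" for C
    by (rule vdim_image_inj[OF that S lin[OF fin_subD(1)[OF that]] inj])
  show "vdim K V B \<le> vdim K V A"
    using odd_split_if_larger_codomain[OF P sq(3)] sq(4) no dim[OF kk(1)] dim[OF kk(2)] by fastforce
  fix A' B' assume A': "subspace K A' V" "A' \<subseteq> A" and B': "subspace K B' V" "B' \<subseteq> B"
    and xy: "\<And>a. a \<in> A' \<Longrightarrow> x a \<in> B' \<and> y a \<in> B'"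
  have "\<not> vdim K (seq_space V) (E ` B') < vdim K (seq_space V) (E ` A')"
  proof
    assume less: "vdim K (seq_space V) (E ` B') < vdim K (seq_space V) (E ` A')"
    have "odd_split K (seq_space V) (seq_space V) (E ` A) (E ` B) (\<lambda>f. E (x (f 0))) (\<lambda>f. E (y (f 0)))"
      by (rule odd_split_if_large_sub[OF P sq(3) subspace_image[OF A'(1) S lin[OF A'(1)]] image_mono[OF A'(2)]
              subspace_image[OF B'(1) S lin[OF B'(1)]] image_mono[OF B'(2)] _ less]) (use xy in \<open>auto simp: E0\<close>)
    then show False using sq(4) no by blast
  qed
  then show "vdim K V A' \<le> vdim K V B'"
    using dim[OF fin_sub_mono(1)[OF kk(1) A']] dim[OF fin_sub_mono(1)[OF kk(2) B']] by simp
qed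

text \<open>The vectors killed by a power of the relation \<open>y\<^sup>-\<^sup>1x\<close>.\<close>
inductive_set nilp :: "('k, 'v) module \<Rightarrow> 'v set \<Rightarrow> ('v \<Rightarrow> 'w) \<Rightarrow> ('v \<Rightarrow> 'w) \<Rightarrow> 'v set"
  for V A x y where
  zero: "\<zero>\<^bsub>V\<^esub> \<in> nilp V A x y"
| step: "s \<in> nilp V A x y \<Longrightarrow> a \<in> A \<Longrightarrow> x a = y s \<Longrightarrow> a \<in> nilp V A x y"

section \<open>Fitting decomposition of a pair\<close>

lemma subspace_nilp:
  assumes k: "kron K V W A B x y"
  shows "subspace K (nilp V A x y) V" "nilp V A x y \<subseteq> A"
    "\<And>a. a \<in> nilp V A x y \<Longrightarrow> \<exists>s\<in>nilp V A x y. x a = y s"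
proof -
  note k = kronD[OF k]
  interpret V: vectorspace K V by (rule k(9))
  note Ac = subspaceD[OF k(7)] note X = linear_onD[OF k(3)] and Y = linear_onD[OF k(4)]
  note z = linear_on_zero(1)[OF k(7,10,3)] linear_on_zero(1)[OF k(7,10,4)]
  have in_A: "a \<in> A" if "a \<in> nilp V A x y" for a
    using that by cases (auto simp: Ac(3))
  then show "nilp V A x y \<subseteq> A" by auto
  \<comment> \<open>Zero is its own predecessor, as x 0 = y 0. So every element has one, and chains
    of different lengths can be added as if the shorter were padded with zeros.\<close>
  show ex: "\<exists>s\<in>nilp V A x y. x a = y s" if "a \<in> nilp V A x y" for a
    using that
  proof cases
    case zero
    then show ?thesis using z nilp.zero by metis
  qed auto
  have add: "a \<oplus>\<^bsub>V\<^esub> b \<in> nilp V A x y" if "a \<in> nilp V A x y" "b \<in> nilp V A x y" for a b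
    using that
  proof (induction arbitrary: b)
    case zero
    then show ?case using in_A Ac(2) by simp
  next
    case (step s a)
    obtain t where t: "t \<in> nilp V A x y" "x b = y t" using ex step.prems by blast
    have "x (a \<oplus>\<^bsub>V\<^esub> b) = y (s \<oplus>\<^bsub>V\<^esub> t)"
      using X(2)[OF step.hyps(2) in_A[OF step.prems]] Y(2)[OF in_A[OF step.hyps(1)] in_A[OF t(1)]] step.hyps t by simp
    then show ?case using nilp.step[OF step.IH[OF t(1)] Ac(4)[OF step.hyps(2) in_A[OF step.prems]]] by simp
  qed
  have smult: "c \<odot>\<^bsub>V\<^esub> a \<in> nilp V A x y" if "a \<in> nilp V A x y" "c \<in> carrier K" for a c
    using that
  proof (induction)
    case zero
    then show ?case by (simp add: nilp.zero)
  next
    case (step s a)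
    then show ?case using nilp.step[OF step.IH Ac(5)] X(3) Y(3) in_A by simp
  qed
  show "subspace K (nilp V A x y) V"
    by (rule subspaceI[OF k(9)]) (use in_A Ac(2) nilp.zero add smult in auto)
qed

text \<open>For \<open>A1\<close> take the end points of chains starting at 0: there xN lies in yN,
  so the dimension bound makes \<open>y\<close> injective. For \<open>A2\<close> take a fixed point
  \<open>W\<close> of S \<mapsto> {a | y a lies in xS}, where yW lies in xW and \<open>x\<close> is
  injective for the same reason. It is found as a candidate of least dimension instead of the limit
  of a descending sequence.\<close>

theorem no_odd_split_decomposition:
  assumes k: "kron K V V A B x y" and no: "\<not> odd_split K V V A B x y"
  obtains A1 A2 where "dir_sum K V A A1 A2" "dir_sum K V B (y ` A1) (x ` A2)" "inj_on y A1" "inj_on x A2"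
    "x ` A1 \<subseteq> y ` A1" "y ` A2 \<subseteq> x ` A2"
proof -
  note kk = kronD[OF k]
  note le = no_odd_split_vdim_le[OF k no]
  note Ac = subspaceD[OF kk(7)] and Bc = subspaceD[OF kk(8)]
  note X = linear_onD[OF kk(3)] and Y = linear_onD[OF kk(4)]
  interpret V: vectorspace K V by (rule kk(9))
  let ?N = "nilp V A x y"
  note N = subspace_nilp[OF k]
  note fN = fin_sub_mono(1)[OF kk(1) N(1,2)]
  have AB: "vdim K V A = vdim K V B" using le(1) le(2)[OF kk(7) _ kk(8)] kk(5,6) by (simp add: le_antisym)
  have imY: "subspace K (y ` S) V" "y ` S \<subseteq> B" "linear_on K V V S y" if "subspace K S V" "S \<subseteq> A" for S
    using subspace_image[OF that(1) kk(9) linear_on_subset[OF kk(4) that(2)]] that(2) kk(6) linear_on_subset[OF kk(4) that(2)] by auto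
  have imX: "subspace K (x ` S) V" "x ` S \<subseteq> B" "linear_on K V V S x" if "subspace K S V" "S \<subseteq> A" for S
    using subspace_image[OF that(1) kk(9) linear_on_subset[OF kk(3) that(2)]] that(2) kk(5) linear_on_subset[OF kk(3) that(2)] by auto
  have injY: "inj_on y S" if "subspace K S V" "S \<subseteq> A" "x ` S \<subseteq> y ` S" for S
    using inj_on_if_vdim_le[OF fin_sub_mono(1)[OF kk(1) that(1,2)] kk(9) imY(3)[OF that(1,2)]]
      le(2)[OF that(1,2) imY(1,2)[OF that(1,2)]] that(3) by blast
  have injX: "inj_on x S" if "subspace K S V" "S \<subseteq> A" "y ` S \<subseteq> x ` S" for S
    using inj_on_if_vdim_le[OF fin_sub_mono(1)[OF kk(1) that(1,2)] kk(9) imX(3)[OF that(1,2)]]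
      le(2)[OF that(1,2) imX(1,2)[OF that(1,2)]] that(3) by blast
  have NxY: "x ` ?N \<subseteq> y ` ?N" using N(3) by blast
  have NyI: "inj_on y ?N" by (rule injY[OF N(1,2) NxY])
  \<comment> \<open>The kernel of \<open>x\<close> lies in \<open>?N\<close>, so dim xA - dim xN =
    dim A - dim N. Since xA meets yN in xN and dim yN = dim N, the sum has dimension dim A = dim
    B.\<close>
  have B_eq: "plus_set V (x ` A) (y ` ?N) = B"
  proof (rule subspace_eqI[OF kk(2)])
    note fXA = rank_nullity(1)[OF kk(1,9,3)] and fYN = rank_nullity(1)[OF fN kk(9) imY(3)[OF N(1,2)]]
    show "subspace K (plus_set V (x ` A) (y ` ?N)) V" using subspace_plus[OF fin_subD(1)[OF fXA] fin_subD(1)[OF fYN]] .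
    show "plus_set V (x ` A) (y ` ?N) \<subseteq> B"
      by (rule plus_set_least[OF kk(8)]) (use kk(5,6) N(2) in auto)
    have int: "x ` A \<inter> y ` ?N = x ` ?N"
    proof (intro equalityI subsetI)
      fix v assume "v \<in> x ` A \<inter> y ` ?N"
      then obtain a s where "a \<in> A" "s \<in> ?N" "v = x a" "x a = y s" by auto
      then show "v \<in> x ` ?N" using nilp.step[of s V A x y a] by blast
    qed (use NxY N(2) in auto)
    have ker: "{a \<in> A. x a = \<zero>\<^bsub>V\<^esub>} = {a \<in> ?N. x a = \<zero>\<^bsub>V\<^esub>}"
      using nilp.step[OF nilp.zero, of _ A x y V] linear_on_zero(1)[OF kk(7,9,4)] N(2) by auto
    show "vdim K V B \<le> vdim K V (plus_set V (x ` A) (y ` ?N))"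
      using vdim_plus_Int[OF fXA fYN] rank_nullity(2)[OF kk(1,9,3)] rank_nullity(2)[OF fN kk(9) imX(3)[OF N(1,2)]]
        vdim_image_inj[OF fN kk(9) imY(3)[OF N(1,2)] NyI] AB unfolding int ker by simp
  qed
  define G where "G S = {a \<in> A. y a \<in> x ` S}" for S
  \<comment> \<open>Candidates for the complement: they span \<open>A\<close> together with
    \<open>?N\<close> and contain their preimage under \<open>G\<close>. \<open>A\<close> is one,
    and \<open>G\<close> sends candidates to candidates, so one of least dimension is fixed by
    \<open>G\<close>.\<close>
  define Q where "Q S \<longleftrightarrow> subspace K S V \<and> S \<subseteq> A \<and> plus_set V ?N S = A \<and> G S \<subseteq> S" for S
  have QA: "Q A"
    unfolding Q_def using kk(7) plus_set_least[OF kk(7) N(2) subset_refl] plus_set_upper(2)[OF N(1) kk(7)] by (auto simp: G_def)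
  have QG: "Q (G S)" if "Q S" for S
  proof -
    have S: "subspace K S V" "S \<subseteq> A" "plus_set V ?N S = A" "G S \<subseteq> S" using that by (auto simp: Q_def)
    have sG: "subspace K (G S) V" unfolding G_def by (rule subspace_vimage[OF kk(7) imX(1)[OF S(1,2)] kk(4)])
    have "a \<in> plus_set V ?N (G S)" if a: "a \<in> A" for a
    proof -
      have "y a \<in> plus_set V (x ` A) (y ` ?N)" using kk(6)[OF a] B_eq by simp
      then obtain b n where b: "b \<in> A" "n \<in> ?N" "y a = x b \<oplus>\<^bsub>V\<^esub> y n" by (auto simp: plus_set_def)
      obtain m w where mw: "m \<in> ?N" "w \<in> S" "b = m \<oplus>\<^bsub>V\<^esub> w"
        using b(1) S(3) plus_setE by metis
      obtain m' where m': "m' \<in> ?N" "x m = y m'" using N(3)[OF mw(1)] by blast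
      have inA: "n \<in> A" "m \<in> A" "m' \<in> A" "w \<in> A" using b mw m' N(2) S(2) by auto
      \<comment> \<open>The component m of b in \<open>?N\<close> contributes x m = y m', which
        joins the y-part; what is left of y a is x w with w in \<open>S\<close>.\<close>
      let ?n = "m' \<oplus>\<^bsub>V\<^esub> n"
      have nN: "?n \<in> ?N" using subspaceD(4)[OF N(1) m'(1) b(2)] .
      have "y a = y ?n \<oplus>\<^bsub>V\<^esub> x w"
        using b(3) mw(3) X(2)[OF inA(2,4)] Y(2)[OF inA(3,1)] m'(2) X(1) Y(1) inA by (simp add: V.M.a_ac)
      then have "y (a \<ominus>\<^bsub>V\<^esub> ?n) = x w"
        using linear_on_zero(3)[OF kk(7,9,4) a, of ?n] nN N(2) vectorspace_add_diff(1)[OF kk(9)] X(1)[OF inA(4)] Y(1) by auto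
      then have "a \<ominus>\<^bsub>V\<^esub> ?n \<in> G S" using mw(2) Ac(7)[OF a] nN N(2) by (auto simp: G_def)
      moreover have "a = ?n \<oplus>\<^bsub>V\<^esub> (a \<ominus>\<^bsub>V\<^esub> ?n)"
        using vectorspace_add_diff(3)[OF kk(9), of a ?n] Ac(2) a nN N(2) by (simp add: V.M.a_comm subset_iff)
      ultimately show ?thesis using nN plus_setI by metis
    qed
    then have "plus_set V ?N (G S) = A"
      using plus_set_least[OF kk(7) N(2), of "G S"] by (auto simp: G_def)
    moreover have "G (G S) \<subseteq> G S" using S(4) by (auto simp: G_def)
    ultimately show ?thesis unfolding Q_def using sG by (auto simp: G_def)
  qed
  obtain W where W: "Q W" and min: "\<And>S. Q S \<Longrightarrow> vdim K V W \<le> vdim K V S"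
    using exists_least_iff[of "\<lambda>n. \<exists>S. Q S \<and> vdim K V S = n"] QA by (metis not_le_imp_less)
  have sW: "subspace K W V" "W \<subseteq> A" "plus_set V ?N W = A" "G W \<subseteq> W" using W by (auto simp: Q_def)
  have "subspace K (G W) V" using QG[OF W] by (simp add: Q_def)
  then have GW: "G W = W"
    using subspace_eqI[OF fin_sub_mono(1)[OF kk(1) sW(1,2)] _ sW(4) min[OF QG[OF W]]] by blast
  have WyX: "y ` W \<subseteq> x ` W" using GW by (auto simp: G_def)
  have WxI: "inj_on x W" by (rule injX[OF sW(1,2) WyX])
  \<comment> \<open>Along the chain of a: from x a = y s and a in \<open>W\<close>, the fixed point
    property puts s into \<open>W\<close>, so s = 0 by induction, and x a = 0 with \<open>x\<close>
    injective on \<open>W\<close>.\<close>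
  have NW: "a = \<zero>\<^bsub>V\<^esub>" if "a \<in> ?N" "a \<in> W" for a
    using that
  proof (induction)
    case (step s a)
    have "s \<in> A" "y s \<in> x ` W" using step.hyps(1,3) N(2) step.prems by (auto intro: image_eqI[of _ x a])
    then have "s \<in> W" using GW by (auto simp: G_def)
    then have "x a = x \<zero>\<^bsub>V\<^esub>" 
      using step.IH step.hyps linear_on_zero(1)[OF kk(7,9,3)] linear_on_zero(1)[OF kk(7,9,4)] by simp
    then show ?case using inj_onD[OF WxI _ step.prems subspaceD(3)[OF sW(1)]] by blast
  qed simp
  have dsA: "dir_sum K V A ?N W"
    unfolding dir_sum_def using N(1) sW(1,3) NW subspaceD(3)[OF N(1)] subspaceD(3)[OF sW(1)] by blast
  have dsB: "dir_sum K V B (y ` ?N) (x ` W)"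
  proof (rule dir_sumI[OF imY(1)[OF N(1,2)] imX(1)[OF sW(1,2)] _ kk(8) imY(2)[OF N(1,2)] imX(2)[OF sW(1,2)]])
    fix b assume "b \<in> y ` ?N" "b \<in> x ` W"
    then obtain n w where nw: "n \<in> ?N" "w \<in> W" "b = x w" "x w = y n" by auto
    then have "w \<in> ?N" using nilp.step[of n V A x y w] sW(2) by auto
    then show "b = \<zero>\<^bsub>V\<^esub>" using NW nw linear_on_zero(1)[OF kk(7,9,3)] by auto
  next
    fix b assume "b \<in> B"
    then obtain a n where a: "a \<in> A" "n \<in> ?N" "b = x a \<oplus>\<^bsub>V\<^esub> y n"
      using B_eq by (auto simp: plus_set_def)
    obtain m w where mw: "m \<in> ?N" "w \<in> W" "a = m \<oplus>\<^bsub>V\<^esub> w" using dir_sumD(8)[OF dsA a(1)] by blast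
    obtain m' where m': "m' \<in> ?N" "x m = y m'" using N(3)[OF mw(1)] by blast
    have inA: "n \<in> A" "m \<in> A" "m' \<in> A" "w \<in> A" using a mw m' N(2) sW(2) by auto
    have "b = y (m' \<oplus>\<^bsub>V\<^esub> n) \<oplus>\<^bsub>V\<^esub> x w"
      using a(3) mw(3) X(2)[OF inA(2,4)] Y(2)[OF inA(3,1)] m'(2) X(1) Y(1) inA by (simp add: V.M.a_ac)
    then show "\<exists>a1\<in>y ` ?N. \<exists>a2\<in>x ` W. b = a1 \<oplus>\<^bsub>V\<^esub> a2"
      using subspaceD(4)[OF N(1) m'(1) a(2)] mw(2) by blast
  qed
  show thesis by (rule that[OF dsA dsB NyI WxI NxY WyX])
qed

section \<open>The group algebra of the Klein four group\<close>

locale char2_field = field K for K :: "'k ring" (structure) +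
  assumes char2: "characteristic K = 2"
begin

abbreviation "R \<equiv> kV4 K"
abbreviation "s \<equiv> scalar K klein_four"

text \<open>In characteristic 2 these are \<open>g - 1\<close> for the two generators \<open>g = (1,0)\<close> and \<open>g = (0,1)\<close>.\<close>
definition "X = (\<lambda>g\<in>carrier klein_four. if snd g = 0 then \<one> else \<zero>)"
definition "Y = (\<lambda>g\<in>carrier klein_four. if fst g = 0 then \<one> else \<zero>)"

lemma add_self: "a \<in> carrier K \<Longrightarrow> a \<oplus> a = \<zero>"
proof -
  assume a: "a \<in> carrier K"
  have "group (add_monoid K)" by (rule add.group_axioms)
  then have "\<one> [^]\<^bsub>add_monoid K\<^esub> (2::nat) = \<zero>"
    using group.pow_ord_eq_1[of "add_monoid K" \<one>] char2 by (simp add: characteristic_def)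
  then have "\<one> \<oplus> \<one> = \<zero>" by (simp add: numeral_2_eq_2)
  then have "a \<otimes> (\<one> \<oplus> \<one>) = \<zero>" using a by simp
  then show ?thesis using a by (simp add: r_distr)
qed

lemma cring_R: "cring R"
  by (rule group_algebra_cring[OF cring_axioms comm_group_klein_four finite_klein_four])

sublocale R: cring R by (rule cring_R)

lemma carrier_klein: "carrier klein_four = {(0,0),(0,1),(1,0),(1,1)}"
proof -
  have "{0..<2::int} = {0,1}" by auto
  then show ?thesis by (auto simp: klein_four_def carrier_integer_mod_group)
qed

lemma klein_ops: "\<one>\<^bsub>klein_four\<^esub> = (0,0)"
  "(a,b) \<otimes>\<^bsub>klein_four\<^esub> (c,d) = ((a + c) mod 2, (b + d) mod 2)"
  by (auto simp: klein_four_def integer_mod_group_def DirProd_def)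

lemma klein_inv: "g \<in> carrier klein_four \<Longrightarrow> inv\<^bsub>klein_four\<^esub> g = g"
proof -
  interpret G: comm_group klein_four by (rule comm_group_klein_four)
  assume "g \<in> carrier klein_four"
  then show ?thesis by (intro G.inv_equality) (auto simp: carrier_klein klein_ops)
qed

lemma R_eqI: "f \<in> carrier R \<Longrightarrow> h \<in> carrier R \<Longrightarrow> (\<And>g. g \<in> carrier klein_four \<Longrightarrow> f g = h g) \<Longrightarrow> f = h"
  by (simp add: group_algebra_def) (meson PiE_ext)

lemma R_closed: "f \<in> carrier R \<Longrightarrow> g \<in> carrier klein_four \<Longrightarrow> f g \<in> carrier K"
  by (auto simp: group_algebra_def)

text \<open>Convolution written out; the inverses disappear because every group element is its own
  inverse. The basic identities of the algebra are checked on these four coordinates.\<close>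

lemma R_mult: 
  assumes "f \<in> carrier R" "h \<in> carrier R"
  shows "(f \<otimes>\<^bsub>R\<^esub> h) (0,0) = f (0,0) \<otimes> h (0,0) \<oplus> f (0,1) \<otimes> h (0,1) \<oplus> f (1,0) \<otimes> h (1,0) \<oplus> f (1,1) \<otimes> h (1,1)"
    "(f \<otimes>\<^bsub>R\<^esub> h) (0,1) = f (0,0) \<otimes> h (0,1) \<oplus> f (0,1) \<otimes> h (0,0) \<oplus> f (1,0) \<otimes> h (1,1) \<oplus> f (1,1) \<otimes> h (1,0)"
    "(f \<otimes>\<^bsub>R\<^esub> h) (1,0) = f (0,0) \<otimes> h (1,0) \<oplus> f (0,1) \<otimes> h (1,1) \<oplus> f (1,0) \<otimes> h (0,0) \<oplus> f (1,1) \<otimes> h (0,1)"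
    "(f \<otimes>\<^bsub>R\<^esub> h) (1,1) = f (0,0) \<otimes> h (1,1) \<oplus> f (0,1) \<otimes> h (1,0) \<oplus> f (1,0) \<otimes> h (0,1) \<oplus> f (1,1) \<otimes> h (0,0)"
proof -
  note cl = R_closed[OF assms(1)] R_closed[OF assms(2)]
  have "(f \<otimes>\<^bsub>R\<^esub> h) x = (\<Oplus>y\<in>{(0,0),(0,1),(1,0),(1,1)}. f y \<otimes> h (y \<otimes>\<^bsub>klein_four\<^esub> x))" if "x \<in> carrier klein_four" for x
  proof -
    have "(f \<otimes>\<^bsub>R\<^esub> h) x = (\<Oplus>y\<in>carrier klein_four. f y \<otimes> h (inv\<^bsub>klein_four\<^esub> y \<otimes>\<^bsub>klein_four\<^esub> x))"
      using that by (simp add: group_algebra_def)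
    also have "\<dots> = (\<Oplus>y\<in>{(0,0),(0,1),(1,0),(1,1)}. f y \<otimes> h (y \<otimes>\<^bsub>klein_four\<^esub> x))"
    proof (rule finsum_cong')
      show "carrier klein_four = {(0,0),(0,1),(1,0),(1,1)}" by (rule carrier_klein)
      have "y \<otimes>\<^bsub>klein_four\<^esub> x \<in> carrier klein_four" if "y \<in> carrier klein_four" for y
        using that \<open>x \<in> carrier klein_four\<close> comm_group_klein_four
        by (simp add: comm_group_def comm_monoid_def monoid.m_closed)
      then show "(\<lambda>y. f y \<otimes> h (y \<otimes>\<^bsub>klein_four\<^esub> x)) \<in> {(0,0),(0,1),(1,0),(1,1)} \<rightarrow> carrier K"
        using cl unfolding carrier_klein[symmetric] by (simp add: Pi_def)
    qed (simp add: klein_inv carrier_klein)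
    finally show ?thesis .
  qed
  note * = this
  show "(f \<otimes>\<^bsub>R\<^esub> h) (0,0) = f (0,0) \<otimes> h (0,0) \<oplus> f (0,1) \<otimes> h (0,1) \<oplus> f (1,0) \<otimes> h (1,0) \<oplus> f (1,1) \<otimes> h (1,1)"
    by (subst *) (use cl in \<open>simp_all add: carrier_klein klein_ops finsum_insert Pi_def a_assoc\<close>)
  show "(f \<otimes>\<^bsub>R\<^esub> h) (0,1) = f (0,0) \<otimes> h (0,1) \<oplus> f (0,1) \<otimes> h (0,0) \<oplus> f (1,0) \<otimes> h (1,1) \<oplus> f (1,1) \<otimes> h (1,0)"
    by (subst *) (use cl in \<open>simp_all add: carrier_klein klein_ops finsum_insert Pi_def a_assoc\<close>)
  show "(f \<otimes>\<^bsub>R\<^esub> h) (1,0) = f (0,0) \<otimes> h (1,0) \<oplus> f (0,1) \<otimes> h (1,1) \<oplus> f (1,0) \<otimes> h (0,0) \<oplus> f (1,1) \<otimes> h (0,1)"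
    by (subst *) (use cl in \<open>simp_all add: carrier_klein klein_ops finsum_insert Pi_def a_assoc\<close>)
  show "(f \<otimes>\<^bsub>R\<^esub> h) (1,1) = f (0,0) \<otimes> h (1,1) \<oplus> f (0,1) \<otimes> h (1,0) \<oplus> f (1,0) \<otimes> h (0,1) \<oplus> f (1,1) \<otimes> h (0,0)"
    by (subst *) (use cl in \<open>simp_all add: carrier_klein klein_ops finsum_insert Pi_def a_assoc\<close>)
qed

lemma R_add: "g \<in> carrier klein_four \<Longrightarrow> (f \<oplus>\<^bsub>R\<^esub> h) g = f g \<oplus> h g"
  and R_zero: "g \<in> carrier klein_four \<Longrightarrow> \<zero>\<^bsub>R\<^esub> g = \<zero>"
  and R_one: "g \<in> carrier klein_four \<Longrightarrow> \<one>\<^bsub>R\<^esub> g = (if g = (0,0) then \<one> else \<zero>)"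
  by (auto simp: group_algebra_def klein_ops)

lemma s_app: "g \<in> carrier klein_four \<Longrightarrow> s c g = (if g = (0,0) then c else \<zero>)"
  by (simp add: scalar_def klein_ops)

lemma X_app: "g \<in> carrier klein_four \<Longrightarrow> X g = (if snd g = 0 then \<one> else \<zero>)"
  and Y_app: "g \<in> carrier klein_four \<Longrightarrow> Y g = (if fst g = 0 then \<one> else \<zero>)"
  by (simp_all add: X_def Y_def)

lemma X_closed [simp]: "X \<in> carrier R" and Y_closed [simp]: "Y \<in> carrier R"
  by (auto simp: X_def Y_def group_algebra_def)

lemma s_closed [simp]: "c \<in> carrier K \<Longrightarrow> s c \<in> carrier R"
  by (auto simp: scalar_def group_algebra_def)

lemma s_add: "c \<in> carrier K \<Longrightarrow> d \<in> carrier K \<Longrightarrow> s (c \<oplus> d) = s c \<oplus>\<^bsub>R\<^esub> s d"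
  by (rule R_eqI) (auto simp: R_add s_app)

lemma s_one: "s \<one> = \<one>\<^bsub>R\<^esub>"
  by (rule R_eqI) (auto simp: R_one s_app)

lemma s_zero: "s \<zero> = \<zero>\<^bsub>R\<^esub>"
  by (rule R_eqI) (auto simp: R_zero s_app)

lemma s_mult: "c \<in> carrier K \<Longrightarrow> d \<in> carrier K \<Longrightarrow> s (c \<otimes> d) = s c \<otimes>\<^bsub>R\<^esub> s d"
proof (rule R_eqI)
  fix g assume cd: "c \<in> carrier K" "d \<in> carrier K" and "g \<in> carrier klein_four"
  then show "s (c \<otimes> d) g = (s c \<otimes>\<^bsub>R\<^esub> s d) g"
    by (auto simp: carrier_klein R_mult s_app)
qed auto

lemma X_sq: "X \<otimes>\<^bsub>R\<^esub> X = \<zero>\<^bsub>R\<^esub>"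
proof (rule R_eqI)
  fix g assume "g \<in> carrier klein_four"
  then show "(X \<otimes>\<^bsub>R\<^esub> X) g = \<zero>\<^bsub>R\<^esub> g"
    by (subst (asm) carrier_klein) (auto simp: R_mult R_zero carrier_klein X_app add_self)
qed auto

lemma Y_sq: "Y \<otimes>\<^bsub>R\<^esub> Y = \<zero>\<^bsub>R\<^esub>"
proof (rule R_eqI)
  fix g assume "g \<in> carrier klein_four"
  then show "(Y \<otimes>\<^bsub>R\<^esub> Y) g = \<zero>\<^bsub>R\<^esub> g"
    by (subst (asm) carrier_klein) (auto simp: R_mult R_zero carrier_klein Y_app add_self)
qed auto

text \<open>The product is the sum of all group elements, which spans the socle of the group
  algebra.\<close>

lemma XY_app: "g \<in> carrier klein_four \<Longrightarrow> (X \<otimes>\<^bsub>R\<^esub> Y) g = \<one>"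
  by (subst (asm) carrier_klein) (auto simp: R_mult carrier_klein X_app Y_app)

lemma s_mult_app:
  assumes "c \<in> carrier K" "f \<in> carrier R" "g \<in> carrier klein_four"
  shows "(s c \<otimes>\<^bsub>R\<^esub> f) g = c \<otimes> f g"
proof -
  have "f (0,0) \<in> carrier K" "f (0,1) \<in> carrier K" "f (1,0) \<in> carrier K" "f (1,1) \<in> carrier K"
    using R_closed[OF assms(2)] by (auto simp: carrier_klein)
  moreover have "g = (0,0) \<or> g = (0,1) \<or> g = (1,0) \<or> g = (1,1)"
    using assms(3) by (auto simp: carrier_klein)
  ultimately show ?thesis using assms(1,2) by (auto simp: R_mult carrier_klein s_app)
qed

lemma s_XY_eq_zero: "c \<in> carrier K \<Longrightarrow> s c \<otimes>\<^bsub>R\<^esub> (X \<otimes>\<^bsub>R\<^esub> Y) = \<zero>\<^bsub>R\<^esub> \<Longrightarrow> c = \<zero>"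
  using s_mult_app[of c "X \<otimes>\<^bsub>R\<^esub> Y" "(0,0)"] XY_app[of "(0,0)"] R_zero[of "(0,0)"] by (simp add: carrier_klein)

lemma R_decomp:
  assumes r: "r \<in> carrier R"
  obtains c0 c1 c2 c3 where "c0 \<in> carrier K" "c1 \<in> carrier K" "c2 \<in> carrier K" "c3 \<in> carrier K"
    "r = s c0 \<oplus>\<^bsub>R\<^esub> s c1 \<otimes>\<^bsub>R\<^esub> X \<oplus>\<^bsub>R\<^esub> s c2 \<otimes>\<^bsub>R\<^esub> Y \<oplus>\<^bsub>R\<^esub> s c3 \<otimes>\<^bsub>R\<^esub> (X \<otimes>\<^bsub>R\<^esub> Y)"
proof -
  have cl: "r (0,0) \<in> carrier K" "r (0,1) \<in> carrier K" "r (1,0) \<in> carrier K" "r (1,1) \<in> carrier K"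
    using R_closed[OF r] by (auto simp: carrier_klein)
  \<comment> \<open>Substitute (1,0) = 1 + X, (0,1) = 1 + Y and (1,1) = 1 + X + Y + XY into the
    expansion of \<open>r\<close> in group elements. In particular \<open>?c0\<close> is the
    augmentation of \<open>r\<close>.\<close>
  let ?c0 = "r (0,0) \<oplus> r (0,1) \<oplus> r (1,0) \<oplus> r (1,1)" and ?c1 = "r (1,0) \<oplus> r (1,1)" and ?c2 = "r (0,1) \<oplus> r (1,1)" and ?c3 = "r (1,1)"
  have z: "a \<oplus> (a \<oplus> b) = b" if "a \<in> carrier K" "b \<in> carrier K" for a b
    using that add_self by (simp flip: a_assoc)
  have "r = s ?c0 \<oplus>\<^bsub>R\<^esub> s ?c1 \<otimes>\<^bsub>R\<^esub> X \<oplus>\<^bsub>R\<^esub> s ?c2 \<otimes>\<^bsub>R\<^esub> Y \<oplus>\<^bsub>R\<^esub> s ?c3 \<otimes>\<^bsub>R\<^esub> (X \<otimes>\<^bsub>R\<^esub> Y)"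
  proof (rule R_eqI)
    fix g assume g: "g \<in> carrier klein_four"
    then have X: "X g = (if snd g = 0 then \<one> else \<zero>)" "Y g = (if fst g = 0 then \<one> else \<zero>)"
      by (simp_all add: X_app Y_app)
    show "r g = (s ?c0 \<oplus>\<^bsub>R\<^esub> s ?c1 \<otimes>\<^bsub>R\<^esub> X \<oplus>\<^bsub>R\<^esub> s ?c2 \<otimes>\<^bsub>R\<^esub> Y \<oplus>\<^bsub>R\<^esub> s ?c3 \<otimes>\<^bsub>R\<^esub> (X \<otimes>\<^bsub>R\<^esub> Y)) g"
      using g cl unfolding R_add[OF g]
      by (simp only: s_mult_app X_closed Y_closed R.m_closed XY_app s_app X a_closed)
        (auto simp: carrier_klein a_ac z add_self)
  qed (use r cl in auto)
  then show thesis using cl that[of ?c0 ?c1 ?c2 ?c3] by simp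
qed

end

section \<open>Modules over the group algebra\<close>

context char2_field
begin

abbreviation "vs \<equiv> vector_space_of K klein_four"

lemma vs_simps [simp]: "carrier (vs M) = carrier M" "add (vs M) = add M" "zero (vs M) = zero M"
  "smult (vs M) c v = s c \<odot>\<^bsub>M\<^esub> v" "(vs M)\<lparr>carrier := U\<rparr> = vs (M\<lparr>carrier := U\<rparr>)"
  by (simp_all add: vector_space_of_def)

lemma vs_minus [simp]: "a_inv (vs M) = a_inv M" "a_minus (vs M) = a_minus M"
  by (simp_all add: vector_space_of_def a_inv_def m_inv_def[abs_def] a_minus_def[abs_def])

lemma vdim_vs: "vdim K (vs M) U = kV4_dim K (M\<lparr>carrier := U\<rparr>)"
  by (simp add: vdim_def)

lemma R_add_self: "r \<in> carrier R \<Longrightarrow> r \<oplus>\<^bsub>R\<^esub> r = \<zero>\<^bsub>R\<^esub>"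
  by (rule R_eqI) (auto simp: R_add R_zero add_self R_closed)

lemma XX [simp]: "r \<in> carrier R \<Longrightarrow> X \<otimes>\<^bsub>R\<^esub> (X \<otimes>\<^bsub>R\<^esub> r) = \<zero>\<^bsub>R\<^esub>"
  and YY [simp]: "r \<in> carrier R \<Longrightarrow> Y \<otimes>\<^bsub>R\<^esub> (Y \<otimes>\<^bsub>R\<^esub> r) = \<zero>\<^bsub>R\<^esub>"
  by (simp_all flip: R.m_assoc add: X_sq Y_sq)

lemma X_mult_decomp:
  assumes "a \<in> carrier R" "b \<in> carrier R" "c \<in> carrier R" "d \<in> carrier R"
  shows "X \<otimes>\<^bsub>R\<^esub> (a \<oplus>\<^bsub>R\<^esub> b \<otimes>\<^bsub>R\<^esub> X \<oplus>\<^bsub>R\<^esub> c \<otimes>\<^bsub>R\<^esub> Y \<oplus>\<^bsub>R\<^esub> d \<otimes>\<^bsub>R\<^esub> (X \<otimes>\<^bsub>R\<^esub> Y))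
      = a \<otimes>\<^bsub>R\<^esub> X \<oplus>\<^bsub>R\<^esub> c \<otimes>\<^bsub>R\<^esub> (X \<otimes>\<^bsub>R\<^esub> Y)"
    "Y \<otimes>\<^bsub>R\<^esub> (a \<oplus>\<^bsub>R\<^esub> b \<otimes>\<^bsub>R\<^esub> X \<oplus>\<^bsub>R\<^esub> c \<otimes>\<^bsub>R\<^esub> Y \<oplus>\<^bsub>R\<^esub> d \<otimes>\<^bsub>R\<^esub> (X \<otimes>\<^bsub>R\<^esub> Y))
      = a \<otimes>\<^bsub>R\<^esub> Y \<oplus>\<^bsub>R\<^esub> b \<otimes>\<^bsub>R\<^esub> (X \<otimes>\<^bsub>R\<^esub> Y)"
proof -
  have "X \<otimes>\<^bsub>R\<^esub> a = a \<otimes>\<^bsub>R\<^esub> X" "X \<otimes>\<^bsub>R\<^esub> (b \<otimes>\<^bsub>R\<^esub> X) = \<zero>\<^bsub>R\<^esub>" "X \<otimes>\<^bsub>R\<^esub> (c \<otimes>\<^bsub>R\<^esub> Y) = c \<otimes>\<^bsub>R\<^esub> (X \<otimes>\<^bsub>R\<^esub> Y)"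
    "X \<otimes>\<^bsub>R\<^esub> (d \<otimes>\<^bsub>R\<^esub> (X \<otimes>\<^bsub>R\<^esub> Y)) = \<zero>\<^bsub>R\<^esub>"
    using assms R.m_comm[of X a] R.m_lcomm[of X b X] R.m_lcomm[of X c Y] R.m_lcomm[of X d "X \<otimes>\<^bsub>R\<^esub> Y"] X_sq by simp_all
  then show "X \<otimes>\<^bsub>R\<^esub> (a \<oplus>\<^bsub>R\<^esub> b \<otimes>\<^bsub>R\<^esub> X \<oplus>\<^bsub>R\<^esub> c \<otimes>\<^bsub>R\<^esub> Y \<oplus>\<^bsub>R\<^esub> d \<otimes>\<^bsub>R\<^esub> (X \<otimes>\<^bsub>R\<^esub> Y))
      = a \<otimes>\<^bsub>R\<^esub> X \<oplus>\<^bsub>R\<^esub> c \<otimes>\<^bsub>R\<^esub> (X \<otimes>\<^bsub>R\<^esub> Y)"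
    using assms by (simp add: R.r_distr)
  have "Y \<otimes>\<^bsub>R\<^esub> a = a \<otimes>\<^bsub>R\<^esub> Y" "Y \<otimes>\<^bsub>R\<^esub> (b \<otimes>\<^bsub>R\<^esub> X) = b \<otimes>\<^bsub>R\<^esub> (X \<otimes>\<^bsub>R\<^esub> Y)" "Y \<otimes>\<^bsub>R\<^esub> (c \<otimes>\<^bsub>R\<^esub> Y) = \<zero>\<^bsub>R\<^esub>"
    "Y \<otimes>\<^bsub>R\<^esub> (d \<otimes>\<^bsub>R\<^esub> (X \<otimes>\<^bsub>R\<^esub> Y)) = \<zero>\<^bsub>R\<^esub>"
    using assms R.m_comm[of Y a] R.m_lcomm[of Y b X] R.m_lcomm[of Y c Y] R.m_lcomm[of Y d "X \<otimes>\<^bsub>R\<^esub> Y"] Y_sq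
      R.m_comm[of Y X] R.m_lcomm[of Y X Y] by simp_all
  then show "Y \<otimes>\<^bsub>R\<^esub> (a \<oplus>\<^bsub>R\<^esub> b \<otimes>\<^bsub>R\<^esub> X \<oplus>\<^bsub>R\<^esub> c \<otimes>\<^bsub>R\<^esub> Y \<oplus>\<^bsub>R\<^esub> d \<otimes>\<^bsub>R\<^esub> (X \<otimes>\<^bsub>R\<^esub> Y))
      = a \<otimes>\<^bsub>R\<^esub> Y \<oplus>\<^bsub>R\<^esub> b \<otimes>\<^bsub>R\<^esub> (X \<otimes>\<^bsub>R\<^esub> Y)"
    using assms by (simp add: R.r_distr)
qed

text \<open>Write u = 1 + n, so that the square is 1 + 2n + n^2. In n^2 only the mixed term 2ab XY
  survives X^2 = Y^2 = 0, and both doubles vanish in characteristic 2. Such elements are thus their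
  own inverses.\<close>

lemma unit_sq:
  assumes "a \<in> carrier R" "b \<in> carrier R" "c \<in> carrier R"
  defines "u \<equiv> \<one>\<^bsub>R\<^esub> \<oplus>\<^bsub>R\<^esub> a \<otimes>\<^bsub>R\<^esub> X \<oplus>\<^bsub>R\<^esub> b \<otimes>\<^bsub>R\<^esub> Y \<oplus>\<^bsub>R\<^esub> c \<otimes>\<^bsub>R\<^esub> (X \<otimes>\<^bsub>R\<^esub> Y)"
  shows "u \<otimes>\<^bsub>R\<^esub> u = \<one>\<^bsub>R\<^esub>"
proof -
  define n where "n = a \<otimes>\<^bsub>R\<^esub> X \<oplus>\<^bsub>R\<^esub> b \<otimes>\<^bsub>R\<^esub> Y \<oplus>\<^bsub>R\<^esub> c \<otimes>\<^bsub>R\<^esub> (X \<otimes>\<^bsub>R\<^esub> Y)"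
  have n: "n \<in> carrier R" using assms by (simp add: n_def)
  have m4: "(t \<otimes>\<^bsub>R\<^esub> v) \<otimes>\<^bsub>R\<^esub> (t' \<otimes>\<^bsub>R\<^esub> v') = (t \<otimes>\<^bsub>R\<^esub> t') \<otimes>\<^bsub>R\<^esub> (v \<otimes>\<^bsub>R\<^esub> v')"
    if "t \<in> carrier R" "v \<in> carrier R" "t' \<in> carrier R" "v' \<in> carrier R" for t v t' v'
    using that by (simp add: R.m_ac)
  have XYX: "X \<otimes>\<^bsub>R\<^esub> Y \<otimes>\<^bsub>R\<^esub> X = \<zero>\<^bsub>R\<^esub>" "X \<otimes>\<^bsub>R\<^esub> Y \<otimes>\<^bsub>R\<^esub> Y = \<zero>\<^bsub>R\<^esub>" "Y \<otimes>\<^bsub>R\<^esub> (X \<otimes>\<^bsub>R\<^esub> Y) = \<zero>\<^bsub>R\<^esub>"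
    "X \<otimes>\<^bsub>R\<^esub> Y \<otimes>\<^bsub>R\<^esub> (X \<otimes>\<^bsub>R\<^esub> Y) = \<zero>\<^bsub>R\<^esub>" "Y \<otimes>\<^bsub>R\<^esub> X = X \<otimes>\<^bsub>R\<^esub> Y"
    using m4[of X Y X Y] R.m_assoc[of X Y X] R.m_assoc[of X Y Y] R.m_lcomm[of Y X Y] X_sq Y_sq
    by (simp_all add: R.m_comm[of Y X])
  define p where "p = (a \<otimes>\<^bsub>R\<^esub> b) \<otimes>\<^bsub>R\<^esub> (X \<otimes>\<^bsub>R\<^esub> Y)"
  have p: "p \<in> carrier R" using assms by (simp add: p_def)
  have prods: "(a \<otimes>\<^bsub>R\<^esub> X) \<otimes>\<^bsub>R\<^esub> (a \<otimes>\<^bsub>R\<^esub> X) = \<zero>\<^bsub>R\<^esub>" "(a \<otimes>\<^bsub>R\<^esub> X) \<otimes>\<^bsub>R\<^esub> (b \<otimes>\<^bsub>R\<^esub> Y) = p"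
    "(b \<otimes>\<^bsub>R\<^esub> Y) \<otimes>\<^bsub>R\<^esub> (a \<otimes>\<^bsub>R\<^esub> X) = p" "(b \<otimes>\<^bsub>R\<^esub> Y) \<otimes>\<^bsub>R\<^esub> (b \<otimes>\<^bsub>R\<^esub> Y) = \<zero>\<^bsub>R\<^esub>"
    "(a \<otimes>\<^bsub>R\<^esub> X) \<otimes>\<^bsub>R\<^esub> (c \<otimes>\<^bsub>R\<^esub> (X \<otimes>\<^bsub>R\<^esub> Y)) = \<zero>\<^bsub>R\<^esub>"
    "(b \<otimes>\<^bsub>R\<^esub> Y) \<otimes>\<^bsub>R\<^esub> (c \<otimes>\<^bsub>R\<^esub> (X \<otimes>\<^bsub>R\<^esub> Y)) = \<zero>\<^bsub>R\<^esub>"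
    "(c \<otimes>\<^bsub>R\<^esub> (X \<otimes>\<^bsub>R\<^esub> Y)) \<otimes>\<^bsub>R\<^esub> (a \<otimes>\<^bsub>R\<^esub> X) = \<zero>\<^bsub>R\<^esub>" "(c \<otimes>\<^bsub>R\<^esub> (X \<otimes>\<^bsub>R\<^esub> Y)) \<otimes>\<^bsub>R\<^esub> (b \<otimes>\<^bsub>R\<^esub> Y) = \<zero>\<^bsub>R\<^esub>"
    "(c \<otimes>\<^bsub>R\<^esub> (X \<otimes>\<^bsub>R\<^esub> Y)) \<otimes>\<^bsub>R\<^esub> (c \<otimes>\<^bsub>R\<^esub> (X \<otimes>\<^bsub>R\<^esub> Y)) = \<zero>\<^bsub>R\<^esub>"
    using assms(1-3) R.m_comm[of a b] by (simp_all add: p_def m4 X_sq Y_sq XYX)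
  have "n \<otimes>\<^bsub>R\<^esub> n = p \<oplus>\<^bsub>R\<^esub> p"
    unfolding n_def using assms(1-3) p by (simp add: R.l_distr R.r_distr prods)
  then have nn: "n \<otimes>\<^bsub>R\<^esub> n = \<zero>\<^bsub>R\<^esub>" using R_add_self[OF p] by simp
  have "u = \<one>\<^bsub>R\<^esub> \<oplus>\<^bsub>R\<^esub> n" using assms by (simp add: u_def n_def R.a_assoc)
  then have "u \<otimes>\<^bsub>R\<^esub> u = \<one>\<^bsub>R\<^esub> \<oplus>\<^bsub>R\<^esub> (n \<oplus>\<^bsub>R\<^esub> (n \<oplus>\<^bsub>R\<^esub> n \<otimes>\<^bsub>R\<^esub> n))"
    using n by (simp add: R.l_distr R.r_distr R.a_assoc)
  also have "\<dots> = \<one>\<^bsub>R\<^esub>" using n nn R_add_self[OF n] by simp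
  finally show ?thesis .
qed

end

locale char2_module = char2_field K + M: module "kV4 K" M
  for K :: "'k ring" and M :: "(int \<times> int \<Rightarrow> 'k, 'm) module" (structure)
begin

lemma vectorspace_vs: "vectorspace K (vs M)"
proof -
  have "abelian_group (vs M)"
  proof (rule abelian_groupI)
    fix v assume "v \<in> carrier (vs M)"
    then show "\<exists>y\<in>carrier (vs M). y \<oplus>\<^bsub>vs M\<^esub> v = \<zero>\<^bsub>vs M\<^esub>"
      by (intro bexI[of _ "\<ominus> v"]) (auto simp: M.l_neg)
  qed (auto simp: M.a_ac)
  then have "module K (vs M)"
    by (intro moduleI cring_axioms)
      (auto simp: s_add s_mult s_one M.smult_l_distr M.smult_r_distr M.smult_assoc1)
  then show ?thesis by (simp add: vectorspace_def field_axioms)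
qed

lemma M_add_self: "v \<in> carrier M \<Longrightarrow> v \<oplus> v = \<zero>"
proof -
  assume v: "v \<in> carrier M"
  have "(\<one>\<^bsub>R\<^esub> \<oplus>\<^bsub>R\<^esub> \<one>\<^bsub>R\<^esub>) \<odot> v = v \<oplus> v" using v by (simp add: M.smult_l_distr)
  then show ?thesis using v R_add_self[of "\<one>\<^bsub>R\<^esub>"] by simp
qed

lemma M_add_self2: "v \<in> carrier M \<Longrightarrow> w \<in> carrier M \<Longrightarrow> v \<oplus> (v \<oplus> w) = w"
  by (simp flip: M.a_assoc add: M_add_self)

lemma M_add_eq_zero_iff: "v \<in> carrier M \<Longrightarrow> w \<in> carrier M \<Longrightarrow> v \<oplus> w = \<zero> \<longleftrightarrow> v = w"
  using M_add_self M_add_self2[of v w] by auto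

lemma XX_smult [simp]: "v \<in> carrier M \<Longrightarrow> X \<odot> (X \<odot> v) = \<zero>"
  and YY_smult [simp]: "v \<in> carrier M \<Longrightarrow> Y \<odot> (Y \<odot> v) = \<zero>"
  and YX_smult: "v \<in> carrier M \<Longrightarrow> Y \<odot> (X \<odot> v) = X \<odot> (Y \<odot> v)"
  and smult_commute: "v \<in> carrier M \<Longrightarrow> a \<in> carrier R \<Longrightarrow> b \<in> carrier R \<Longrightarrow>
    a \<odot> (b \<odot> v) = b \<odot> (a \<odot> v)"
  using R.m_comm by (simp_all flip: M.smult_assoc1 add: X_sq Y_sq)

lemma smult_decomp:
  assumes r: "r \<in> carrier R"
  obtains c0 c1 c2 c3 where "c0 \<in> carrier K" "c1 \<in> carrier K" "c2 \<in> carrier K" "c3 \<in> carrier K"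
    "\<And>v. v \<in> carrier M \<Longrightarrow> r \<odot> v = s c0 \<odot> v \<oplus> s c1 \<odot> (X \<odot> v) \<oplus>
      s c2 \<odot> (Y \<odot> v) \<oplus> s c3 \<odot> (X \<odot> (Y \<odot> v))"
    "r = s c0 \<oplus>\<^bsub>R\<^esub> s c1 \<otimes>\<^bsub>R\<^esub> X \<oplus>\<^bsub>R\<^esub> s c2 \<otimes>\<^bsub>R\<^esub> Y \<oplus>\<^bsub>R\<^esub> s c3 \<otimes>\<^bsub>R\<^esub> (X \<otimes>\<^bsub>R\<^esub> Y)"
proof -
  obtain c0 c1 c2 c3 where c: "c0 \<in> carrier K" "c1 \<in> carrier K" "c2 \<in> carrier K" "c3 \<in> carrier K"
    and r: "r = s c0 \<oplus>\<^bsub>R\<^esub> s c1 \<otimes>\<^bsub>R\<^esub> X \<oplus>\<^bsub>R\<^esub> s c2 \<otimes>\<^bsub>R\<^esub> Y \<oplus>\<^bsub>R\<^esub> s c3 \<otimes>\<^bsub>R\<^esub> (X \<otimes>\<^bsub>R\<^esub> Y)"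
    using R_decomp[OF r] .
  have "r \<odot> v = s c0 \<odot> v \<oplus> s c1 \<odot> (X \<odot> v) \<oplus>
      s c2 \<odot> (Y \<odot> v) \<oplus> s c3 \<odot> (X \<odot> (Y \<odot> v))" if "v \<in> carrier M" for v
    unfolding r using c that by (simp add: M.smult_l_distr M.smult_assoc1)
  then show thesis using that c r by blast
qed

text \<open>Over the field the algebra is spanned by 1, \<open>X\<close>, \<open>Y\<close> and
  \<open>XY\<close>, so two operators decide. Together with \<open>module_hom_iff\<close> this turns
  statements on modules into linear algebra.\<close>

lemma submodule_iff:
  "submodule R U M \<longleftrightarrow> subspace K U (vs M) \<and> (\<forall>v\<in>U. X \<odot> v \<in> U \<and> Y \<odot> v \<in> U)"
proof
  assume U: "submodule R U M"
  show "subspace K U (vs M) \<and> (\<forall>v\<in>U. X \<odot> v \<in> U \<and> Y \<odot> v \<in> U)"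
    using U by (auto intro!: subspaceI vectorspace_vs simp: submodule_def)
next
  assume U: "subspace K U (vs M) \<and> (\<forall>v\<in>U. X \<odot> v \<in> U \<and> Y \<odot> v \<in> U)"
  note D = subspaceD[OF conjunct1[OF U], simplified]
  have "r \<odot> v \<in> U" if rv: "r \<in> carrier R" "v \<in> U" for r v
  proof -
    obtain c0 c1 c2 c3 where c: "c0 \<in> carrier K" "c1 \<in> carrier K" "c2 \<in> carrier K" "c3 \<in> carrier K"
      and r: "r \<odot> v = s c0 \<odot> v \<oplus> s c1 \<odot> (X \<odot> v) \<oplus>
      s c2 \<odot> (Y \<odot> v) \<oplus> s c3 \<odot> (X \<odot> (Y \<odot> v))"
      using smult_decomp[OF rv(1)] D(2)[OF rv(2)] by metis
    show ?thesis unfolding r using c U rv(2) by (intro D(4,5)) auto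
  qed
  then show "submodule R U M"
    using D M.module_axioms by (auto simp: submodule_def)
qed

lemma submoduleD:
  assumes "submodule R U M"
  shows "subspace K U (vs M)" "\<And>v. v \<in> U \<Longrightarrow> X \<odot> v \<in> U" "\<And>v. v \<in> U \<Longrightarrow> Y \<odot> v \<in> U"
    "\<And>v. v \<in> U \<Longrightarrow> v \<in> carrier M" "\<And>r v. r \<in> carrier R \<Longrightarrow> v \<in> U \<Longrightarrow> r \<odot> v \<in> U"
    "module R (M\<lparr>carrier := U\<rparr>)"
  using assms submodule_iff[of U] M.submodule_is_module[of U] by (auto simp: submodule_def)

lemma linear_on_smult: "r \<in> carrier R \<Longrightarrow> linear_on K (vs M) (vs M) (carrier M) (\<lambda>v. r \<odot> v)"
  by (simp add: linear_on_def M.smult_r_distr smult_commute)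

lemma fin_sub_vs: "fin_sub K (vs M) U \<longleftrightarrow> subspace K U (vs M) \<and> kV4_fin_dim K (M\<lparr>carrier := U\<rparr>)"
  by (simp add: fin_sub_def)

lemma fin_sub_carrier: "kV4_fin_dim K M \<longleftrightarrow> fin_sub K (vs M) (carrier M)"
  using subspace_carrier[OF vectorspace_vs] by (simp add: fin_sub_vs)

lemma direct_summand_iff:
  "direct_summand R U M \<longleftrightarrow>
    (\<exists>W. submodule R U M \<and> submodule R W M \<and> dir_sum K (vs M) (carrier M) U W)"
proof -
  have "M.submodule_sum U W = plus_set (vs M) U W" for W
    by (auto simp: M.submodule_sum_def plus_set_def)
  then show ?thesis
    unfolding direct_summand_def dir_sum_def using submoduleD(1) by auto
qed

lemma module_hom_iff:
  assumes N: "module R N"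
  shows "f \<in> module_hom R M N \<longleftrightarrow> linear_on K (vs M) (vs N) (carrier M) f \<and>
    (\<forall>v\<in>carrier M. f (X \<odot> v) = X \<odot>\<^bsub>N\<^esub> f v \<and> f (Y \<odot> v) = Y \<odot>\<^bsub>N\<^esub> f v)"
proof
  assume "f \<in> module_hom R M N"
  then show "linear_on K (vs M) (vs N) (carrier M) f \<and>
    (\<forall>v\<in>carrier M. f (X \<odot> v) = X \<odot>\<^bsub>N\<^esub> f v \<and> f (Y \<odot> v) = Y \<odot>\<^bsub>N\<^esub> f v)"
    by (auto simp: module_hom_def linear_on_def)
next
  assume *: "linear_on K (vs M) (vs N) (carrier M) f \<and>
    (\<forall>v\<in>carrier M. f (X \<odot> v) = X \<odot>\<^bsub>N\<^esub> f v \<and> f (Y \<odot> v) = Y \<odot>\<^bsub>N\<^esub> f v)"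
  note L = linear_onD[OF conjunct1[OF *], simplified]
  interpret N: module R N by (rule N)
  have "f (r \<odot> v) = r \<odot>\<^bsub>N\<^esub> f v" if r: "r \<in> carrier R" and v: "v \<in> carrier M" for r v
  proof -
    obtain c0 c1 c2 c3 where c: "c0 \<in> carrier K" "c1 \<in> carrier K" "c2 \<in> carrier K" "c3 \<in> carrier K"
      and rv: "r \<odot> v = s c0 \<odot> v \<oplus> s c1 \<odot> (X \<odot> v) \<oplus>
        s c2 \<odot> (Y \<odot> v) \<oplus> s c3 \<odot> (X \<odot> (Y \<odot> v))"
      and r: "r = s c0 \<oplus>\<^bsub>R\<^esub> s c1 \<otimes>\<^bsub>R\<^esub> X \<oplus>\<^bsub>R\<^esub> s c2 \<otimes>\<^bsub>R\<^esub> Y \<oplus>\<^bsub>R\<^esub> s c3 \<otimes>\<^bsub>R\<^esub> (X \<otimes>\<^bsub>R\<^esub> Y)"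
      using smult_decomp[OF r] v by metis
    show ?thesis unfolding rv unfolding r using c v L * by (simp add: N.smult_l_distr N.smult_assoc1)
  qed
  then show "f \<in> module_hom R M N" using L by (auto simp: module_hom_def)
qed

text \<open>A vector not killed by \<open>XY\<close> spans a free submodule. Because the group algebra is a Frobenius
  algebra, a linear form \<open>l\<close> with \<open>l (XYm) = 1\<close> extends to a module homomorphism onto the group
  algebra, so this free submodule splits off.\<close>
lemma projective_free_XY_zero:
  assumes fd: "kV4_fin_dim K M" and pf: "projective_free R M" and m: "m \<in> carrier M"
  shows "X \<odot> (Y \<odot> m) = \<zero>"
proof (rule ccontr)
  define w where "w = X \<odot> (Y \<odot> m)"
  assume "X \<odot> (Y \<odot> m) \<noteq> \<zero>"
  then have w: "w \<in> carrier M" "w \<noteq> \<zero>" using m by (auto simp: w_def)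
  interpret V: vectorspace K "vs M" by (rule vectorspace_vs)
  define L where "L = {c \<odot>\<^bsub>vs M\<^esub> w | c. c \<in> carrier K}"
  have fL: "fin_sub K (vs M) L" "w \<in> L" using vdim_line(1,3)[OF vectorspace_vs, of w] w by (auto simp: L_def)
  have LM: "L \<subseteq> carrier M" using w by (auto simp: L_def)
  obtain C where C: "dir_sum K (vs M) (carrier M) L C"
    using complement_exists[OF fd[unfolded fin_sub_carrier] fin_subD(1)[OF fL(1)] LM] .
  define p where "p = proj (vs M) L C"
  have plin: "linear_on K (vs M) (vs M) (carrier M) p" unfolding p_def by (rule linear_on_proj[OF C])
  note pl = linear_onD[OF plin, simplified]
  \<comment> \<open>The linear form that vanishes on \<open>C\<close> and has value 1 at w, read off
    from the projection onto the line of w.\<close>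
  define l where "l v = (SOME c. c \<in> carrier K \<and> p v = s c \<odot> w)" for v
  have l: "l v \<in> carrier K" "p v = s (l v) \<odot> w" if "v \<in> carrier M" for v
  proof -
    have "p v \<in> L" unfolding p_def by (rule proj_closed[OF C that])
    then have "\<exists>c. c \<in> carrier K \<and> p v = s c \<odot> w" by (auto simp: L_def)
    from someI_ex[OF this] show "l v \<in> carrier K" "p v = s (l v) \<odot> w" by (auto simp: l_def)
  qed
  have l_eq: "l v = c" if v: "v \<in> carrier M" and c: "c \<in> carrier K" and pv: "p v = s c \<odot> w" for v c
  proof -
    have "s (l v \<oplus>\<^bsub>K\<^esub> c) \<odot> w = \<zero>"
      using l[OF v] c pv w(1) by (simp add: s_add M.smult_l_distr M_add_self)
    then have "l v \<oplus>\<^bsub>K\<^esub> c = \<zero>\<^bsub>K\<^esub>"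
      using V.mult_inverse[of "l v \<oplus>\<^bsub>K\<^esub> c" w "\<zero>"] w l(1)[OF v] c inverse_exists[of "l v \<oplus>\<^bsub>K\<^esub> c"] by auto
    then show ?thesis using l(1)[OF v] c add_self by (metis add.inv_equality minus_equality)
  qed
  have l_add: "l (v \<oplus> v') = l v \<oplus>\<^bsub>K\<^esub> l v'" if "v \<in> carrier M" "v' \<in> carrier M" for v v'
    by (rule l_eq) (use that l(1) w pl(2)[of v v'] l(2)[of v] l(2)[of v'] in \<open>auto simp: s_add M.smult_l_distr\<close>)
  have l_smult: "l (s c \<odot> v) = c \<otimes>\<^bsub>K\<^esub> l v" if "v \<in> carrier M" "c \<in> carrier K" for c v
    by (rule l_eq) (use that l(1) w pl(3)[of c v] l(2)[of v] in \<open>auto simp: s_mult M.smult_assoc1\<close>)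
  have l_zero: "l \<zero> = \<zero>\<^bsub>K\<^esub>" using l_smult[of "\<zero>" "\<zero>\<^bsub>K\<^esub>"] l(1) by simp
  have lw: "l w = \<one>\<^bsub>K\<^esub>"
    by (rule l_eq) (use w proj_id[OF C fL(2)] in \<open>auto simp: p_def s_one\<close>)
  \<comment> \<open>The coefficient of \<open>XY\<close> is l v, and this forces the others: the
    coefficients of 1, \<open>X\<close> and \<open>Y\<close> in \<phi> v are the
    \<open>XY\<close>-coefficients after multiplication by \<open>XY\<close>, \<open>Y\<close> and
    \<open>X\<close>, so they are l(XYv), l(Yv) and l(Xv).\<close>
  define \<phi> where "\<phi> v = s (l (X \<odot> (Y \<odot> v))) \<oplus>\<^bsub>R\<^esub> s (l (Y \<odot> v)) \<otimes>\<^bsub>R\<^esub> X \<oplus>\<^bsub>R\<^esub>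
    s (l (X \<odot> v)) \<otimes>\<^bsub>R\<^esub> Y \<oplus>\<^bsub>R\<^esub> s (l v) \<otimes>\<^bsub>R\<^esub> (X \<otimes>\<^bsub>R\<^esub> Y)" for v
  have \<phi>_closed: "\<phi> v \<in> carrier R" if "v \<in> carrier M" for v
    unfolding \<phi>_def using that l(1) by simp
  have \<phi>_add: "\<phi> (v \<oplus> v') = \<phi> v \<oplus>\<^bsub>R\<^esub> \<phi> v'" if "v \<in> carrier M" "v' \<in> carrier M" for v v'
    unfolding \<phi>_def using that l(1)
    by (simp add: M.smult_r_distr l_add s_add R.l_distr R.a_ac)
  have \<phi>_scalar: "\<phi> (s c \<odot> v) = s c \<otimes>\<^bsub>R\<^esub> \<phi> v" if "v \<in> carrier M" "c \<in> carrier K" for v c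
  proof -
    have "X \<odot> (s c \<odot> v) = s c \<odot> (X \<odot> v)" "Y \<odot> (s c \<odot> v) = s c \<odot> (Y \<odot> v)"
      "X \<odot> (s c \<odot> (Y \<odot> v)) = s c \<odot> (X \<odot> (Y \<odot> v))"
      using that by (auto intro: smult_commute)
    then show ?thesis
      unfolding \<phi>_def using that l(1) by (simp add: l_smult s_mult R.r_distr R.m_assoc)
  qed
  have \<phi>_X: "\<phi> (X \<odot> v) = X \<otimes>\<^bsub>R\<^esub> \<phi> v" if "v \<in> carrier M" for v
    using that l(1) X_mult_decomp(1)
    by (simp add: \<phi>_def YX_smult l_zero s_zero)
  have \<phi>_Y: "\<phi> (Y \<odot> v) = Y \<otimes>\<^bsub>R\<^esub> \<phi> v" if "v \<in> carrier M" for v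
    using that l(1) X_mult_decomp(2)
    by (simp add: \<phi>_def YX_smult l_zero s_zero)
  have \<phi>_smult: "\<phi> (r \<odot> v) = r \<otimes>\<^bsub>R\<^esub> \<phi> v" if r: "r \<in> carrier R" and v: "v \<in> carrier M" for r v
  proof -
    obtain c0 c1 c2 c3 where c: "c0 \<in> carrier K" "c1 \<in> carrier K" "c2 \<in> carrier K" "c3 \<in> carrier K"
      and rv: "r \<odot> v = s c0 \<odot> v \<oplus> s c1 \<odot> (X \<odot> v) \<oplus>
        s c2 \<odot> (Y \<odot> v) \<oplus> s c3 \<odot> (X \<odot> (Y \<odot> v))"
      and r: "r = s c0 \<oplus>\<^bsub>R\<^esub> s c1 \<otimes>\<^bsub>R\<^esub> X \<oplus>\<^bsub>R\<^esub> s c2 \<otimes>\<^bsub>R\<^esub> Y \<oplus>\<^bsub>R\<^esub> s c3 \<otimes>\<^bsub>R\<^esub> (X \<otimes>\<^bsub>R\<^esub> Y)"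
      using smult_decomp[OF r] v by metis
    show ?thesis unfolding rv unfolding r using c v \<phi>_closed
      by (simp add: \<phi>_add \<phi>_scalar \<phi>_X \<phi>_Y R.l_distr R.m_assoc)
  qed
  define u where "u = \<phi> m"
  have u: "u \<in> carrier R" using \<phi>_closed[OF m] by (simp add: u_def)
  \<comment> \<open>The constant coefficient of \<phi> m is l w = 1, so u has the shape required by
    \<open>unit_sq\<close> and is its own inverse.\<close>
  have uu: "u \<otimes>\<^bsub>R\<^esub> u = \<one>\<^bsub>R\<^esub>"
    unfolding u_def \<phi>_def w_def[symmetric] lw s_one using m l(1) by (intro unit_sq) auto
  define U where "U = {r \<odot> m | r. r \<in> carrier R}"
  define W where "W = {v \<in> carrier M. \<phi> v = \<zero>\<^bsub>R\<^esub>}"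
  have sU: "submodule R U M"
    unfolding submodule_def U_def using m M.module_axioms
    by (auto simp flip: M.smult_l_distr M.smult_assoc1 intro: exI[of _ "\<zero>\<^bsub>R\<^esub>"] R.a_closed R.m_closed)
  have sW: "submodule R W M"
    unfolding submodule_def W_def using M.module_axioms \<phi>_smult[of "\<zero>\<^bsub>R\<^esub>" "\<zero>"] \<phi>_closed
    by (auto simp: \<phi>_add \<phi>_smult)
  have inv: "(\<phi> v \<otimes>\<^bsub>R\<^esub> u) \<odot> m = v" if v: "v \<in> U" for v
  proof -
    obtain r where r: "r \<in> carrier R" "v = r \<odot> m" using v by (auto simp: U_def)
    have "\<phi> v \<otimes>\<^bsub>R\<^esub> u = r" using r m u uu by (simp add: \<phi>_smult R.m_assoc u_def)
    then show ?thesis using r by simp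
  qed
  have "dir_sum K (vs M) (carrier M) U W"
  proof (rule dir_sumI)
    show "subspace K U (vs M)" "subspace K W (vs M)" using submoduleD(1) sU sW by auto
    show "subspace K (carrier M) (vs M)" using subspace_carrier[OF vectorspace_vs] by simp
    show "U \<subseteq> carrier M" "W \<subseteq> carrier M" using submoduleD(4) sU sW by auto
    show "v = \<zero>\<^bsub>vs M\<^esub>" if "v \<in> U" "v \<in> W" for v
      using inv[OF that(1)] that(2) u m by (simp add: W_def)
    fix v assume v: "v \<in> carrier M"
    \<comment> \<open>The component of v in \<open>U\<close>: multiplying by u twice gives \<phi> v1
      = \<phi> v, so the two differ by an element of \<open>W\<close>.\<close>
    define v1 where "v1 = (\<phi> v \<otimes>\<^bsub>R\<^esub> u) \<odot> m"
    have v1: "v1 \<in> carrier M" "v1 \<in> U" using v m u \<phi>_closed[OF v] by (auto simp: v1_def U_def)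
    have "\<phi> v1 = \<phi> v" unfolding v1_def using v m u \<phi>_closed[OF v] uu
      by (simp add: \<phi>_smult R.m_assoc flip: u_def)
    then have "v1 \<oplus> v \<in> W" using v v1 \<phi>_closed[OF v] by (simp add: W_def \<phi>_add R_add_self)
    moreover have "v = v1 \<oplus> (v1 \<oplus> v)" using v v1 by (simp add: M_add_self2)
    ultimately show "\<exists>a1\<in>U. \<exists>a2\<in>W. v = a1 \<oplus>\<^bsub>vs M\<^esub> a2" using v1(2) by auto
  qed
  then have "direct_summand R U M" using sU sW by (auto simp: direct_summand_iff)
  moreover have "projective R (M\<lparr>carrier := U\<rparr>)"
    unfolding projective_def
  proof (intro conjI allI impI)
    show "module R (M\<lparr>carrier := U\<rparr>)" by (rule submoduleD(6)[OF sU])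
    fix N :: "(int \<times> int \<Rightarrow> 'k, 'm \<Rightarrow> int \<times> int \<Rightarrow> 'k) module"
      and Q :: "(int \<times> int \<Rightarrow> 'k, 'm) module" and g f
    assume *: "mod_hom R N Q g \<and> g ` carrier N = carrier Q \<and> mod_hom R (M\<lparr>carrier := U\<rparr>) Q f"
    interpret g: mod_hom R N Q g using * by simp
    interpret f: mod_hom R "M\<lparr>carrier := U\<rparr>" Q f using * by simp
    have mU: "m \<in> U" using m by (auto simp: U_def intro!: exI[of _ "\<one>\<^bsub>R\<^esub>"])
    then have "f m \<in> g ` carrier N" using * f.f_im[of m] by simp
    then obtain n where n: "n \<in> carrier N" "g n = f m" by (metis imageE)
    have UM: "v \<in> carrier M" if "v \<in> U" for v using submoduleD(4)[OF sU that] .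
    show "\<exists>h\<in>module_hom R (M\<lparr>carrier := U\<rparr>) N. \<forall>x\<in>carrier (M\<lparr>carrier := U\<rparr>). g (h x) = f x"
    \<comment> \<open>\<open>U\<close> is free on m, the coefficient of v being the product of
      \<phi> v and u, so the lift may be prescribed by m \<mapsto> n.\<close>
    proof (intro bexI[of _ "\<lambda>v. (\<phi> v \<otimes>\<^bsub>R\<^esub> u) \<odot>\<^bsub>N\<^esub> n"] ballI)
      fix v assume "v \<in> carrier (M\<lparr>carrier := U\<rparr>)"
      then have v: "v \<in> U" by simp
      have "g ((\<phi> v \<otimes>\<^bsub>R\<^esub> u) \<odot>\<^bsub>N\<^esub> n) = (\<phi> v \<otimes>\<^bsub>R\<^esub> u) \<odot>\<^bsub>Q\<^esub> f m"
        using n u \<phi>_closed[OF UM[OF v]] by simp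
      also have "\<dots> = f ((\<phi> v \<otimes>\<^bsub>R\<^esub> u) \<odot> m)"
        using f.f_smult[of "\<phi> v \<otimes>\<^bsub>R\<^esub> u" m] mU u \<phi>_closed[OF UM[OF v]] by simp
      finally show "g ((\<phi> v \<otimes>\<^bsub>R\<^esub> u) \<odot>\<^bsub>N\<^esub> n) = f v" using inv[OF v] by simp
    next
      show "(\<lambda>v. (\<phi> v \<otimes>\<^bsub>R\<^esub> u) \<odot>\<^bsub>N\<^esub> n) \<in> module_hom R (M\<lparr>carrier := U\<rparr>) N"
        using n u \<phi>_closed UM
        by (auto simp: module_hom_def \<phi>_add \<phi>_smult R.l_distr g.M.smult_l_distr g.M.smult_assoc1 R.m_assoc)
    qed
  qed
  ultimately have "U = {\<zero>}" using pf by (auto simp: projective_free_def)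
  moreover have "m \<in> U" using m by (auto simp: U_def intro!: exI[of _ "\<one>\<^bsub>R\<^esub>"])
  ultimately have "m = \<zero>" by auto
  then show False using w by (simp add: w_def)
qed

end

section \<open>Minimal projective covers\<close>

locale char2_cover = char2_module K M
  for K :: "'k ring" and M :: "(int \<times> int \<Rightarrow> 'k, 'm) module" (structure) +
  fixes P :: "(int \<times> int \<Rightarrow> 'k, 'p) module" and \<pi> :: "'p \<Rightarrow> 'm"
  assumes fd: "fin_sub K (vs M) (carrier M)"
    and XY_zero: "\<And>v. v \<in> carrier M \<Longrightarrow> X \<odot> (Y \<odot> v) = \<zero>"
    and cover: "minimal_projective_cover R P M \<pi>"
begin

lemma module_P: "module R P" and hom_\<pi>: "mod_hom R P M \<pi>" and \<pi>_surj: "\<pi> ` carrier P = carrier M"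
  and cover_minimal: "\<And>U. submodule R U P \<Longrightarrow> \<pi> ` U = carrier M \<Longrightarrow> U = carrier P"
  and projective_P: "projective R P"
  using cover unfolding minimal_projective_cover_def projective_def by blast+

sublocale P: char2_module K P
  by (intro char2_module.intro char2_field_axioms module_P)

sublocale pi: mod_hom R P M \<pi> by (rule hom_\<pi>)

lemma linear_\<pi>: "linear_on K (vs P) (vs M) (carrier P) \<pi>"
  by (simp add: linear_on_def)

section \<open>The radical, and lifts of its complement to the cover\<close>

definition radical :: "'m set \<Rightarrow> 'm set" where
  "radical U = plus_set (vs M) ((\<lambda>v. X \<odot> v) ` U) ((\<lambda>v. Y \<odot> v) ` U)"

abbreviation "rad \<equiv> radical (carrier M)"

lemma subspace_carrier_M: "subspace K (carrier M) (vs M)"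
  by (rule fin_subD(1)[OF fd])

lemma subspace_carrier_P: "subspace K (carrier P) (vs P)"
  using subspace_carrier[OF P.vectorspace_vs] by simp

lemma subspace_radical:
  assumes "subspace K U (vs M)"
  shows "subspace K (radical U) (vs M)"
proof -
  have "linear_on K (vs M) (vs M) U (\<lambda>v. r \<odot> v)" if "r \<in> carrier R" for r
    using linear_on_subset[OF linear_on_smult[OF that]] subspaceD(2)[OF assms] by auto
  then show ?thesis
    unfolding radical_def by (intro subspace_plus subspace_image[OF assms vectorspace_vs]) auto
qed

lemma radical_mono: "U \<subseteq> W \<Longrightarrow> radical U \<subseteq> radical W"
  unfolding radical_def plus_set_def by blast

lemma radical_subset: "submodule R U M \<Longrightarrow> radical U \<subseteq> U"
  unfolding radical_def by (rule plus_set_least[OF submoduleD(1)]) (auto dest: submoduleD(2,3))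

lemma smult_rad: "v \<in> rad \<Longrightarrow> X \<odot> v = \<zero>" "v \<in> rad \<Longrightarrow> Y \<odot> v = \<zero>"
  by (auto simp: radical_def plus_set_def M.smult_r_distr YX_smult XY_zero)

lemma rad_closed: "v \<in> rad \<Longrightarrow> v \<in> carrier M"
  using subspaceD(2)[OF subspace_radical[OF subspace_carrier_M]] by simp

text \<open>\<open>X\<close> and \<open>Y\<close> kill the radical, so they agree on an element of
  \<open>U\<close> and on its component in \<open>A\<close>.\<close>

lemma radical_generated:
  assumes A: "dir_sum K (vs M) U A (radical U)" and U: "U \<subseteq> carrier M"
  shows "radical U = plus_set (vs M) ((\<lambda>v. X \<odot> v) ` A) ((\<lambda>v. Y \<odot> v) ` A)"
proof -
  note D = dir_sumD[OF A, simplified]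
  have *: "\<exists>a\<in>A. X \<odot> v = X \<odot> a \<and> Y \<odot> v = Y \<odot> a" if v: "v \<in> U" for v
  proof -
    obtain a j where aj: "a \<in> A" "j \<in> radical U" "v = a \<oplus> j" using D(8)[OF v] by blast
    then have "a \<in> carrier M" "j \<in> carrier M" "j \<in> rad" using D(4,5) U radical_mono[OF U] by auto
    then show ?thesis using aj smult_rad by (auto simp: M.smult_r_distr)
  qed
  show ?thesis
  proof (intro equalityI subsetI)
    fix v assume "v \<in> radical U"
    then obtain v1 v2 where "v1 \<in> U" "v2 \<in> U" "v = X \<odot> v1 \<oplus> Y \<odot> v2"
      by (auto simp: radical_def plus_set_def)
    then show "v \<in> plus_set (vs M) ((\<lambda>v. X \<odot> v) ` A) ((\<lambda>v. Y \<odot> v) ` A)"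
      using *[of v1] *[of v2] unfolding plus_set_def by force
  qed (use D(4) in \<open>auto simp: radical_def plus_set_def\<close>)
qed

lemma finsum_in_submodule:
  assumes "submodule R N P" "finite T" "\<And>t. t \<in> T \<Longrightarrow> f t \<in> N"
  shows "(\<Oplus>\<^bsub>P\<^esub>t\<in>T. f t) \<in> N"
  using assms(2,3)
proof (induction)
  case empty
  then show ?case using assms(1) by (simp add: submodule_def)
next
  case (insert t T)
  then have "f t \<in> carrier P" "f \<in> T \<rightarrow> carrier P" using P.submoduleD(4)[OF assms(1)] by auto
  then show ?case using insert assms(1) by (simp add: submodule_def)
qed

text \<open>It says that \<open>P\<close> is free on a basis of \<open>S\<close>, where
  \<open>S\<close> lifts \<open>A\<close> isomorphically. The first quantified condition is
  generation by \<open>S\<close>; the last one amounts to independence, because a nontrivial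
  relation can be multiplied by a suitable one of \<open>XY\<close>, \<open>X\<close>,
  \<open>Y\<close>, 1 until a nonzero element of \<open>S\<close> killed by \<open>XY\<close>
  remains.\<close>

definition lift :: "'m set \<Rightarrow> 'p set \<Rightarrow> bool" where
  "lift A S \<longleftrightarrow> fin_sub K (vs P) S \<and> \<pi> ` S = A \<and> inj_on \<pi> S \<and>
    (\<forall>v\<in>carrier P. \<exists>p0\<in>S. \<exists>p1\<in>S. \<exists>p2\<in>S. \<exists>p3\<in>S.
      v = p0 \<oplus>\<^bsub>P\<^esub> (X \<odot>\<^bsub>P\<^esub> p1 \<oplus>\<^bsub>P\<^esub> (Y \<odot>\<^bsub>P\<^esub> p2 \<oplus>\<^bsub>P\<^esub> X \<odot>\<^bsub>P\<^esub> (Y \<odot>\<^bsub>P\<^esub> p3)))) \<and>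
    (\<forall>p\<in>S. X \<odot>\<^bsub>P\<^esub> (Y \<odot>\<^bsub>P\<^esub> p) = \<zero>\<^bsub>P\<^esub> \<longrightarrow> p = \<zero>\<^bsub>P\<^esub>)"

text \<open>Nakayama's lemma: \<open>A\<close> generates \<open>M\<close>, since the radical is XA +
  YA. So \<open>U\<close> maps onto \<open>M\<close>, and minimality of the cover applies.\<close>

lemma submodule_covers:
  assumes A: "dir_sum K (vs M) (carrier M) A rad" and U: "submodule R U P" and AU: "A \<subseteq> \<pi> ` U"
  shows "U = carrier P"
proof (rule cover_minimal[OF U])
  note D = dir_sumD[OF A, simplified]
  note u = P.submoduleD[OF U]
  show "\<pi> ` U = carrier M"
  proof (intro equalityI subsetI)
    fix v assume "v \<in> carrier M"
    then obtain a j where aj: "a \<in> A" "j \<in> rad" "v = a \<oplus> j" using D(8) by blast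
    then obtain a1 a2 where a12: "a1 \<in> A" "a2 \<in> A" "j = X \<odot> a1 \<oplus> Y \<odot> a2"
      unfolding radical_generated[OF A subset_refl] by (auto simp: plus_set_def)
    obtain p where "p \<in> U" "a = \<pi> p" using AU aj(1) by blast
    moreover obtain p1 where "p1 \<in> U" "a1 = \<pi> p1" using AU a12(1) by blast
    moreover obtain p2 where "p2 \<in> U" "a2 = \<pi> p2" using AU a12(2) by blast
    ultimately have p: "p \<in> U" "a = \<pi> p" "p1 \<in> U" "a1 = \<pi> p1" "p2 \<in> U" "a2 = \<pi> p2" by auto
    have "v = \<pi> (p \<oplus>\<^bsub>P\<^esub> (X \<odot>\<^bsub>P\<^esub> p1 \<oplus>\<^bsub>P\<^esub> Y \<odot>\<^bsub>P\<^esub> p2))"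
      using aj(3) a12(3) p u(4) by simp
    moreover have "p \<oplus>\<^bsub>P\<^esub> (X \<odot>\<^bsub>P\<^esub> p1 \<oplus>\<^bsub>P\<^esub> Y \<odot>\<^bsub>P\<^esub> p2) \<in> U"
      using subspaceD(4)[OF u(1) p(1) subspaceD(4)[OF u(1) u(2)[OF p(3)] u(3)[OF p(5)]]] by simp
    ultimately show "v \<in> \<pi> ` U" by blast
  qed (use u(4) in auto)
qed

text \<open>The free module on a finite generating set \<open>T\<close> maps onto \<open>P\<close>, and projectivity splits this map
  by some \<open>h\<close>. If \<open>XYp = 0\<close>, then the coefficients of \<open>h p\<close> lie in the augmentation ideal,
  so \<open>p\<close> lies in the radical of \<open>P\<close>.\<close>
lemma lift_exists:
  assumes A: "dir_sum K (vs M) (carrier M) A rad"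
  obtains S where "lift A S"
proof -
  note D = dir_sumD[OF A, simplified]
  note fA = dir_sum_vdim(2)[OF A fd]
  interpret V: vectorspace K "vs M" by (rule vectorspace_vs)
  interpret Q: vectorspace K "vs P" by (rule P.vectorspace_vs)
  obtain \<beta> where \<beta>: "finite \<beta>" "\<beta> \<subseteq> A" "V.span \<beta> = A" "card \<beta> = vdim K (vs M) A"
    using fin_sub_basis[OF D(1) fA subset_refl] by metis
  have "\<beta> \<subseteq> \<pi> ` carrier P" unfolding \<pi>_surj using \<beta>(2) D(4) by (rule subset_trans)
  then have "\<forall>b\<in>\<beta>. \<exists>p\<in>carrier P. \<pi> p = b" by (auto simp: image_iff subset_iff)
  then obtain t where t: "\<And>b. b \<in> \<beta> \<Longrightarrow> t b \<in> carrier P" "\<And>b. b \<in> \<beta> \<Longrightarrow> \<pi> (t b) = b" by metis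
  define T where "T = t ` \<beta>"
  have T: "finite T" "T \<subseteq> carrier P" "\<pi> ` T = \<beta>" "card T \<le> card \<beta>"
    using \<beta>(1) t card_image_le by (auto simp: T_def image_image)
  define S where "S = Q.span T"
  have fS: "fin_sub K (vs P) S"
    unfolding fin_sub_iff_span[OF P.vectorspace_vs] S_def using T(1,2) by auto
  note sS = fin_subD(1)[OF fS]
  note Sc = subspaceD[OF sS, simplified]
  have SP: "S \<subseteq> carrier P" using Sc(2) by auto
  have TS: "T \<subseteq> S" unfolding S_def using T(2) Q.in_own_span by simp
  have Qspan: "Q.span T \<subseteq> N" if "subspace K N (vs P)" "T \<subseteq> N" for N
    using Q.span_is_subset[OF that(2)] that(1) by simp
  note lin = linear_on_subset[OF linear_\<pi> SP]
  note sp = subspace_image[OF sS vectorspace_vs lin]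
  have \<pi>S: "\<pi> ` S = A"
  proof (intro equalityI)
    have "S \<subseteq> {p \<in> carrier P. \<pi> p \<in> A}" unfolding S_def
      using Qspan[OF subspace_vimage[OF subspace_carrier_P D(1) linear_\<pi>]] T \<beta>(2) by auto
    then show "\<pi> ` S \<subseteq> A" by auto
    have "\<beta> \<subseteq> \<pi> ` S" using TS T(3) by blast
    then show "A \<subseteq> \<pi> ` S" using V.span_is_subset[of \<beta> "\<pi> ` S"] sp \<beta>(3) by simp
  qed
  \<comment> \<open>\<open>S\<close> is spanned by lifts of a basis of \<open>A\<close> and maps
    onto \<open>A\<close>. It has no room for a kernel.\<close>
  have "vdim K (vs P) S \<le> card T"
  proof -
    interpret S: vectorspace K "(vs P)\<lparr>carrier := S\<rparr>" using fS by (rule fin_subD)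
    have "S.span T = S" using Q.span_li_not_depend(1)[OF TS] sS S_def by simp
    then show ?thesis unfolding vdim_def using S.gen_ge_dim[of T] T(1) TS by simp
  qed
  then have inj: "inj_on \<pi> S"
    using inj_on_if_vdim_le[OF fS vectorspace_vs lin] \<pi>S T(4) \<beta>(4) by simp
  \<comment> \<open>The submodule generated by \<open>S\<close>, written in the basis 1,
    \<open>X\<close>, \<open>Y\<close>, \<open>XY\<close> of the algebra.\<close>
  define U where "U = {p0 \<oplus>\<^bsub>P\<^esub> (X \<odot>\<^bsub>P\<^esub> p1 \<oplus>\<^bsub>P\<^esub> (Y \<odot>\<^bsub>P\<^esub> p2 \<oplus>\<^bsub>P\<^esub> X \<odot>\<^bsub>P\<^esub> (Y \<odot>\<^bsub>P\<^esub> p3))) | p0 p1 p2 p3.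
    p0 \<in> S \<and> p1 \<in> S \<and> p2 \<in> S \<and> p3 \<in> S}"
  have UI: "p0 \<oplus>\<^bsub>P\<^esub> (X \<odot>\<^bsub>P\<^esub> p1 \<oplus>\<^bsub>P\<^esub> (Y \<odot>\<^bsub>P\<^esub> p2 \<oplus>\<^bsub>P\<^esub> X \<odot>\<^bsub>P\<^esub> (Y \<odot>\<^bsub>P\<^esub> p3))) \<in> U"
    if "p0 \<in> S" "p1 \<in> S" "p2 \<in> S" "p3 \<in> S" for p0 p1 p2 p3 using that unfolding U_def by blast
  have UE: "\<exists>p0\<in>S. \<exists>p1\<in>S. \<exists>p2\<in>S. \<exists>p3\<in>S.
      v = p0 \<oplus>\<^bsub>P\<^esub> (X \<odot>\<^bsub>P\<^esub> p1 \<oplus>\<^bsub>P\<^esub> (Y \<odot>\<^bsub>P\<^esub> p2 \<oplus>\<^bsub>P\<^esub> X \<odot>\<^bsub>P\<^esub> (Y \<odot>\<^bsub>P\<^esub> p3)))" if "v \<in> U" for v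
    using that unfolding U_def by blast
  have sU: "submodule R U P"
    unfolding P.submodule_iff
  proof (intro conjI ballI)
    show "subspace K U (vs P)"
    proof (rule subspaceI[OF P.vectorspace_vs], simp_all)
      show "U \<subseteq> carrier P" using Sc(2) by (auto simp: U_def)
      show "\<zero>\<^bsub>P\<^esub> \<in> U" using UI[OF Sc(3) Sc(3) Sc(3) Sc(3)] by simp
    next
      fix v w assume "v \<in> U" "w \<in> U"
      obtain p0 p1 p2 p3 where S: "p0 \<in> S" "p1 \<in> S" "p2 \<in> S" "p3 \<in> S"
        and v: "v = p0 \<oplus>\<^bsub>P\<^esub> (X \<odot>\<^bsub>P\<^esub> p1 \<oplus>\<^bsub>P\<^esub> (Y \<odot>\<^bsub>P\<^esub> p2 \<oplus>\<^bsub>P\<^esub> X \<odot>\<^bsub>P\<^esub> (Y \<odot>\<^bsub>P\<^esub> p3)))" using UE[OF \<open>v \<in> U\<close>] by blast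
      obtain q0 q1 q2 q3 where S': "q0 \<in> S" "q1 \<in> S" "q2 \<in> S" "q3 \<in> S"
        and w: "w = q0 \<oplus>\<^bsub>P\<^esub> (X \<odot>\<^bsub>P\<^esub> q1 \<oplus>\<^bsub>P\<^esub> (Y \<odot>\<^bsub>P\<^esub> q2 \<oplus>\<^bsub>P\<^esub> X \<odot>\<^bsub>P\<^esub> (Y \<odot>\<^bsub>P\<^esub> q3)))" using UE[OF \<open>w \<in> U\<close>] by blast
      note S = S S'
      have "v \<oplus>\<^bsub>P\<^esub> w = (p0 \<oplus>\<^bsub>P\<^esub> q0) \<oplus>\<^bsub>P\<^esub> (X \<odot>\<^bsub>P\<^esub> (p1 \<oplus>\<^bsub>P\<^esub> q1) \<oplus>\<^bsub>P\<^esub> (Y \<odot>\<^bsub>P\<^esub> (p2 \<oplus>\<^bsub>P\<^esub> q2) \<oplus>\<^bsub>P\<^esub> X \<odot>\<^bsub>P\<^esub> (Y \<odot>\<^bsub>P\<^esub> (p3 \<oplus>\<^bsub>P\<^esub> q3))))"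
        unfolding v w using S Sc(2) by (simp add: P.M.smult_r_distr P.M.a_ac)
      then show "v \<oplus>\<^bsub>P\<^esub> w \<in> U" using UI[OF Sc(4) Sc(4) Sc(4) Sc(4)] S by simp
    next
      fix c v assume c: "c \<in> carrier K" and "v \<in> U"
      then obtain p0 p1 p2 p3 where S: "p0 \<in> S" "p1 \<in> S" "p2 \<in> S" "p3 \<in> S"
        and v: "v = p0 \<oplus>\<^bsub>P\<^esub> (X \<odot>\<^bsub>P\<^esub> p1 \<oplus>\<^bsub>P\<^esub> (Y \<odot>\<^bsub>P\<^esub> p2 \<oplus>\<^bsub>P\<^esub> X \<odot>\<^bsub>P\<^esub> (Y \<odot>\<^bsub>P\<^esub> p3)))" unfolding U_def by blast
      have sm: "s c \<odot>\<^bsub>P\<^esub> (X \<odot>\<^bsub>P\<^esub> q) = X \<odot>\<^bsub>P\<^esub> (s c \<odot>\<^bsub>P\<^esub> q)" "s c \<odot>\<^bsub>P\<^esub> (Y \<odot>\<^bsub>P\<^esub> q) = Y \<odot>\<^bsub>P\<^esub> (s c \<odot>\<^bsub>P\<^esub> q)"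
        if "q \<in> carrier P" for q using that c by (auto intro: P.smult_commute)
      have "s c \<odot>\<^bsub>P\<^esub> v = (s c \<odot>\<^bsub>P\<^esub> p0) \<oplus>\<^bsub>P\<^esub> (X \<odot>\<^bsub>P\<^esub> (s c \<odot>\<^bsub>P\<^esub> p1) \<oplus>\<^bsub>P\<^esub> (Y \<odot>\<^bsub>P\<^esub> (s c \<odot>\<^bsub>P\<^esub> p2) \<oplus>\<^bsub>P\<^esub> X \<odot>\<^bsub>P\<^esub> (Y \<odot>\<^bsub>P\<^esub> (s c \<odot>\<^bsub>P\<^esub> p3))))"
        unfolding v using S Sc(2) c by (simp add: P.M.smult_r_distr sm)
      then show "s c \<odot>\<^bsub>P\<^esub> v \<in> U" using UI[OF Sc(5) Sc(5) Sc(5) Sc(5)] S c by simp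
    qed
    fix v assume "v \<in> U"
    then obtain p0 p1 p2 p3 where S: "p0 \<in> S" "p1 \<in> S" "p2 \<in> S" "p3 \<in> S"
      and v: "v = p0 \<oplus>\<^bsub>P\<^esub> (X \<odot>\<^bsub>P\<^esub> p1 \<oplus>\<^bsub>P\<^esub> (Y \<odot>\<^bsub>P\<^esub> p2 \<oplus>\<^bsub>P\<^esub> X \<odot>\<^bsub>P\<^esub> (Y \<odot>\<^bsub>P\<^esub> p3)))" unfolding U_def by blast
    have "X \<odot>\<^bsub>P\<^esub> v = \<zero>\<^bsub>P\<^esub> \<oplus>\<^bsub>P\<^esub> (X \<odot>\<^bsub>P\<^esub> p0 \<oplus>\<^bsub>P\<^esub> (Y \<odot>\<^bsub>P\<^esub> \<zero>\<^bsub>P\<^esub> \<oplus>\<^bsub>P\<^esub> X \<odot>\<^bsub>P\<^esub> (Y \<odot>\<^bsub>P\<^esub> p2)))"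
      unfolding v using S Sc(2) by (simp add: P.M.smult_r_distr)
    then show "X \<odot>\<^bsub>P\<^esub> v \<in> U" using UI[OF Sc(3) S(1) Sc(3) S(3)] by simp
    have "Y \<odot>\<^bsub>P\<^esub> v = \<zero>\<^bsub>P\<^esub> \<oplus>\<^bsub>P\<^esub> (X \<odot>\<^bsub>P\<^esub> \<zero>\<^bsub>P\<^esub> \<oplus>\<^bsub>P\<^esub> (Y \<odot>\<^bsub>P\<^esub> p0 \<oplus>\<^bsub>P\<^esub> X \<odot>\<^bsub>P\<^esub> (Y \<odot>\<^bsub>P\<^esub> p1)))"
      unfolding v using S Sc(2) P.YX_smult[of p1] P.YX_smult[of "Y \<odot>\<^bsub>P\<^esub> p3"] by (simp add: P.M.smult_r_distr)
    then show "Y \<odot>\<^bsub>P\<^esub> v \<in> U" using UI[OF Sc(3) Sc(3) S(1) S(2)] by simp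
  qed
  have "S \<subseteq> U"
  proof
    fix p assume p: "p \<in> S"
    show "p \<in> U" using UI[OF p Sc(3) Sc(3) Sc(3)] Sc(2)[OF p] by simp
  qed
  then have U: "U = carrier P" by (intro submodule_covers[OF A sU]) (use \<pi>S in blast)
  have "P.M.span T = carrier P"
  proof (rule submodule_covers[OF A])
    show sub: "submodule R (P.M.span T) P" by (rule P.M.span_is_submodule[OF T(2)])
    have "S \<subseteq> P.M.span T" unfolding S_def
      by (rule Qspan[OF P.submoduleD(1)[OF sub] P.M.in_own_span[OF T(2)]])
    then show "A \<subseteq> \<pi> ` P.M.span T" using \<pi>S by blast
  qed
  \<comment> \<open>The free module on \<open>T\<close>. Its elements are functions on the type of
    \<open>P\<close>, so it is among the test modules of \<open>projective\<close>.\<close>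
  define F where "F = R.func_space T"
  interpret g: mod_hom R F P "\<lambda>a. P.M.lincomb a T"
    unfolding F_def by (rule P.M.lincomb_is_mod_hom[OF T(1,2)])
  have "(\<lambda>a. P.M.lincomb a T) ` carrier F = carrier P"
  proof (intro equalityI subsetI)
    fix v assume "v \<in> carrier P"
    then obtain a where a: "a \<in> T \<rightarrow> carrier R" "v = P.M.lincomb a T"
      using P.M.finite_span[OF T(1,2)] \<open>P.M.span T = carrier P\<close> by auto
    then have "v = P.M.lincomb (restrict a T) T" using T(2) by (auto intro: P.M.lincomb_cong)
    moreover have "restrict a T \<in> carrier F" using a by (auto simp: F_def R.func_space_def)
    ultimately show "v \<in> (\<lambda>a. P.M.lincomb a T) ` carrier F" by blast
  qed auto
  moreover have "mod_hom R P P (\<lambda>x. x)"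
    by (intro mod_hom.intro mod_hom_axioms.intro module_P) (simp add: module_hom_def)
  ultimately obtain h where h: "h \<in> module_hom R P F" "\<And>x. x \<in> carrier P \<Longrightarrow> P.M.lincomb (h x) T = x"
    using projective_P g.mod_hom_axioms unfolding projective_def by metis
  interpret h: mod_hom R P F h
    by (intro mod_hom.intro mod_hom_axioms.intro module_P g.M.module_axioms h)
  \<comment> \<open>The radical of \<open>P\<close>, which \<pi> maps into the radical of
    \<open>M\<close>. It will contain every p of \<open>S\<close> killed by \<open>XY\<close>, so
    \<pi> p lies in both \<open>A\<close> and the radical.\<close>
  define N where "N = plus_set (vs P) ((\<lambda>v. X \<odot>\<^bsub>P\<^esub> v) ` carrier P) ((\<lambda>v. Y \<odot>\<^bsub>P\<^esub> v) ` carrier P)"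
  have NI: "X \<odot>\<^bsub>P\<^esub> v \<oplus>\<^bsub>P\<^esub> Y \<odot>\<^bsub>P\<^esub> w \<in> N" if "v \<in> carrier P" "w \<in> carrier P" for v w
    using that by (auto simp: N_def plus_set_def)
  have sN: "submodule R N P"
    unfolding P.submodule_iff
  proof (intro conjI ballI)
    show "subspace K N (vs P)" unfolding N_def
      by (intro subspace_plus subspace_image[OF subspace_carrier_P P.vectorspace_vs] P.linear_on_smult) auto
    fix v assume "v \<in> N"
    then have v: "v \<in> carrier P" by (auto simp: N_def plus_set_def)
    show "X \<odot>\<^bsub>P\<^esub> v \<in> N" "Y \<odot>\<^bsub>P\<^esub> v \<in> N" using NI[OF v P.M.zero_closed] NI[OF P.M.zero_closed v] v by auto
  qed
  have free: "p = \<zero>\<^bsub>P\<^esub>" if p: "p \<in> S" "X \<odot>\<^bsub>P\<^esub> (Y \<odot>\<^bsub>P\<^esub> p) = \<zero>\<^bsub>P\<^esub>" for p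
  proof -
    have pP: "p \<in> carrier P" using p(1) Sc(2) by simp
    have hF: "h p \<in> carrier F" using pP by simp
    have "X \<odot>\<^bsub>F\<^esub> (Y \<odot>\<^bsub>F\<^esub> h p) = h (X \<odot>\<^bsub>P\<^esub> (Y \<odot>\<^bsub>P\<^esub> p))" using pP by simp
    then have XY0: "X \<odot>\<^bsub>F\<^esub> (Y \<odot>\<^bsub>F\<^esub> h p) = \<zero>\<^bsub>F\<^esub>" using p(2) by simp
    have "h p b \<odot>\<^bsub>P\<^esub> b \<in> N" if b: "b \<in> T" for b
    proof -
      have r: "h p b \<in> carrier R" using hF b by (auto simp: F_def R.func_space_def)
      have bP: "b \<in> carrier P" using b T(2) by auto
      have XYr: "X \<otimes>\<^bsub>R\<^esub> (Y \<otimes>\<^bsub>R\<^esub> h p b) = \<zero>\<^bsub>R\<^esub>"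
        using fun_cong[OF XY0, of b] b by (simp add: F_def R.func_space_def)
      obtain c0 c1 c2 c3 where c: "c0 \<in> carrier K" "c1 \<in> carrier K" "c2 \<in> carrier K" "c3 \<in> carrier K"
        and hb: "h p b \<odot>\<^bsub>P\<^esub> b = s c0 \<odot>\<^bsub>P\<^esub> b \<oplus>\<^bsub>P\<^esub> s c1 \<odot>\<^bsub>P\<^esub> (X \<odot>\<^bsub>P\<^esub> b) \<oplus>\<^bsub>P\<^esub>
          s c2 \<odot>\<^bsub>P\<^esub> (Y \<odot>\<^bsub>P\<^esub> b) \<oplus>\<^bsub>P\<^esub> s c3 \<odot>\<^bsub>P\<^esub> (X \<odot>\<^bsub>P\<^esub> (Y \<odot>\<^bsub>P\<^esub> b))"
        and rd: "h p b = s c0 \<oplus>\<^bsub>R\<^esub> s c1 \<otimes>\<^bsub>R\<^esub> X \<oplus>\<^bsub>R\<^esub> s c2 \<otimes>\<^bsub>R\<^esub> Y \<oplus>\<^bsub>R\<^esub> s c3 \<otimes>\<^bsub>R\<^esub> (X \<otimes>\<^bsub>R\<^esub> Y)"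
        using P.smult_decomp[OF r] bP by metis
      \<comment> \<open>Multiplication by \<open>XY\<close> leaves only the constant coefficient, so
        an element killed by \<open>XY\<close> has c0 = 0.\<close>
      have "Y \<otimes>\<^bsub>R\<^esub> h p b = s c0 \<otimes>\<^bsub>R\<^esub> Y \<oplus>\<^bsub>R\<^esub> s c1 \<otimes>\<^bsub>R\<^esub> (X \<otimes>\<^bsub>R\<^esub> Y)"
        unfolding rd by (rule X_mult_decomp(2)) (use c in auto)
      then have "X \<otimes>\<^bsub>R\<^esub> (Y \<otimes>\<^bsub>R\<^esub> h p b) = s c0 \<otimes>\<^bsub>R\<^esub> (X \<otimes>\<^bsub>R\<^esub> Y)"
        using c R.m_lcomm[of X "s c0" Y] R.m_lcomm[of X "s c1" "X \<otimes>\<^bsub>R\<^esub> Y"] by (simp add: R.r_distr)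
      then have "c0 = \<zero>\<^bsub>K\<^esub>" using XYr s_XY_eq_zero[OF c(1)] by simp
      then have "h p b \<odot>\<^bsub>P\<^esub> b = X \<odot>\<^bsub>P\<^esub> (s c1 \<odot>\<^bsub>P\<^esub> b) \<oplus>\<^bsub>P\<^esub> Y \<odot>\<^bsub>P\<^esub> (s c2 \<odot>\<^bsub>P\<^esub> b \<oplus>\<^bsub>P\<^esub> s c3 \<odot>\<^bsub>P\<^esub> (X \<odot>\<^bsub>P\<^esub> b))"
        unfolding hb using c bP P.smult_commute[of b X "s c1"] P.smult_commute[of b Y "s c2"]
          P.smult_commute[of "X \<odot>\<^bsub>P\<^esub> b" Y "s c3"] P.YX_smult[of b]
        by (simp add: s_zero P.M.smult_r_distr P.M.a_assoc)
      then show ?thesis using NI c bP by simp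
    qed
    then have "P.M.lincomb (h p) T \<in> N"
      unfolding P.M.lincomb_def by (rule finsum_in_submodule[OF sN T(1)])
    then have "p \<in> N" using h(2)[OF pP] by simp
    then have "\<pi> p \<in> rad" unfolding N_def radical_def
      by (auto elim!: plus_setE intro!: plus_setI[of _ _ _ _ "vs M", simplified])
    moreover have "\<pi> p \<in> A" using \<pi>S p(1) by blast
    ultimately have "\<pi> p = \<zero>" using D(6) by blast
    then have "\<pi> p = \<pi> \<zero>\<^bsub>P\<^esub>" by simp
    then show ?thesis using inj_onD[OF inj _ p(1) Sc(3)] by blast
  qed
  have "lift A S"
    unfolding lift_def
  proof (intro conjI ballI impI)
    fix v assume "v \<in> carrier P"
    then have "v \<in> U" using U by simp
    then show "\<exists>p0\<in>S. \<exists>p1\<in>S. \<exists>p2\<in>S. \<exists>p3\<in>S.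
      v = p0 \<oplus>\<^bsub>P\<^esub> (X \<odot>\<^bsub>P\<^esub> p1 \<oplus>\<^bsub>P\<^esub> (Y \<odot>\<^bsub>P\<^esub> p2 \<oplus>\<^bsub>P\<^esub> X \<odot>\<^bsub>P\<^esub> (Y \<odot>\<^bsub>P\<^esub> p3)))"
      unfolding U_def by blast
  qed (use fS \<pi>S inj free in auto)
  then show thesis by (rule that)
qed

end

section \<open>The Heller shift\<close>

locale char2_lift = char2_cover K M P \<pi>
  for K :: "'k ring" and M :: "(int \<times> int \<Rightarrow> 'k, 'm) module" (structure)
    and P :: "(int \<times> int \<Rightarrow> 'k, 'p) module" and \<pi> +
  fixes A :: "'m set" and S :: "'p set"
  assumes A: "dir_sum K (vs M) (carrier M) A rad" and S: "lift A S"
begin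

lemma fin_S: "fin_sub K (vs P) S" and \<pi>_S: "\<pi> ` S = A" and inj_\<pi>: "inj_on \<pi> S"
  and P_decomp: "\<And>v. v \<in> carrier P \<Longrightarrow> \<exists>p0\<in>S. \<exists>p1\<in>S. \<exists>p2\<in>S. \<exists>p3\<in>S.
      v = p0 \<oplus>\<^bsub>P\<^esub> (X \<odot>\<^bsub>P\<^esub> p1 \<oplus>\<^bsub>P\<^esub> (Y \<odot>\<^bsub>P\<^esub> p2 \<oplus>\<^bsub>P\<^esub> X \<odot>\<^bsub>P\<^esub> (Y \<odot>\<^bsub>P\<^esub> p3)))"
  and XY_S: "\<And>p. p \<in> S \<Longrightarrow> X \<odot>\<^bsub>P\<^esub> (Y \<odot>\<^bsub>P\<^esub> p) = \<zero>\<^bsub>P\<^esub> \<Longrightarrow> p = \<zero>\<^bsub>P\<^esub>"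
  using S unfolding lift_def by blast+

lemma sub_S: "subspace K S (vs P)" by (rule fin_subD(1)[OF fin_S])

lemmas S_closed = subspaceD(2-5)[OF sub_S, simplified]
lemmas A_dir = dir_sumD[OF A, simplified]

lemma fin_A: "fin_sub K (vs M) A" and fin_rad: "fin_sub K (vs M) rad"
  using dir_sum_vdim(2,3)[OF A fd] .

lemma \<pi>_in_A: "p \<in> S \<Longrightarrow> \<pi> p \<in> A"
  using \<pi>_S by blast

lemma A_closed: "a \<in> A \<Longrightarrow> a \<in> carrier M"
  using A_dir(4) by blast

lemma \<pi>_closed: "p \<in> S \<Longrightarrow> \<pi> p \<in> carrier M"
  using S_closed(1) by simp

lemma \<pi>_eq_zero: "p \<in> S \<Longrightarrow> \<pi> p = \<zero> \<Longrightarrow> p = \<zero>\<^bsub>P\<^esub>"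
  using inj_onD[OF inj_\<pi> _ _ S_closed(2), of p] by simp

text \<open>Multiplication by \<open>XY\<close> leaves XY p0 alone, so p0 = 0. Then \<open>Y\<close>
  isolates XY p1, \<open>X\<close> isolates XY p2, and XY p3 is what remains.\<close>

lemma lift_independent:
  assumes p: "p0 \<in> S" "p1 \<in> S" "p2 \<in> S" "p3 \<in> S"
    and 0: "p0 \<oplus>\<^bsub>P\<^esub> (X \<odot>\<^bsub>P\<^esub> p1 \<oplus>\<^bsub>P\<^esub> (Y \<odot>\<^bsub>P\<^esub> p2 \<oplus>\<^bsub>P\<^esub> X \<odot>\<^bsub>P\<^esub> (Y \<odot>\<^bsub>P\<^esub> p3))) = \<zero>\<^bsub>P\<^esub>"
  shows "p0 = \<zero>\<^bsub>P\<^esub>" "p1 = \<zero>\<^bsub>P\<^esub>" "p2 = \<zero>\<^bsub>P\<^esub>" "p3 = \<zero>\<^bsub>P\<^esub>"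
proof -
  note c = p[THEN S_closed(1)]
  let ?v = "p0 \<oplus>\<^bsub>P\<^esub> (X \<odot>\<^bsub>P\<^esub> p1 \<oplus>\<^bsub>P\<^esub> (Y \<odot>\<^bsub>P\<^esub> p2 \<oplus>\<^bsub>P\<^esub> X \<odot>\<^bsub>P\<^esub> (Y \<odot>\<^bsub>P\<^esub> p3)))"
  have Yv: "Y \<odot>\<^bsub>P\<^esub> ?v = Y \<odot>\<^bsub>P\<^esub> p0 \<oplus>\<^bsub>P\<^esub> X \<odot>\<^bsub>P\<^esub> (Y \<odot>\<^bsub>P\<^esub> p1)"
    using c P.YX_smult[of p1] P.YX_smult[of "Y \<odot>\<^bsub>P\<^esub> p3"] by (simp add: P.M.smult_r_distr)
  have Xv: "X \<odot>\<^bsub>P\<^esub> ?v = X \<odot>\<^bsub>P\<^esub> p0 \<oplus>\<^bsub>P\<^esub> X \<odot>\<^bsub>P\<^esub> (Y \<odot>\<^bsub>P\<^esub> p2)"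
    using c by (simp add: P.M.smult_r_distr)
  have "X \<odot>\<^bsub>P\<^esub> (Y \<odot>\<^bsub>P\<^esub> ?v) = X \<odot>\<^bsub>P\<^esub> (Y \<odot>\<^bsub>P\<^esub> p0)"
    unfolding Yv using c by (simp add: P.M.smult_r_distr)
  then show p0: "p0 = \<zero>\<^bsub>P\<^esub>" using 0 XY_S[OF p(1)] by simp
  show p1: "p1 = \<zero>\<^bsub>P\<^esub>" using Yv 0 p0 XY_S[OF p(2)] c by simp
  show p2: "p2 = \<zero>\<^bsub>P\<^esub>" using Xv 0 p0 XY_S[OF p(3)] c by simp
  show "p3 = \<zero>\<^bsub>P\<^esub>" using 0 p0 p1 p2 XY_S[OF p(4)] c by simp
qed

text \<open>Coordinates on the radical of \<open>P\<close>, which contains the kernel of the cover;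
  the coordinate along 1 vanishes there.\<close>

definition comb :: "'p \<Rightarrow> 'p \<Rightarrow> 'p \<Rightarrow> 'p" where
  "comb p1 p2 p3 = X \<odot>\<^bsub>P\<^esub> p1 \<oplus>\<^bsub>P\<^esub> (Y \<odot>\<^bsub>P\<^esub> p2 \<oplus>\<^bsub>P\<^esub> X \<odot>\<^bsub>P\<^esub> (Y \<odot>\<^bsub>P\<^esub> p3))"

lemma comb_closed: "p1 \<in> S \<Longrightarrow> p2 \<in> S \<Longrightarrow> p3 \<in> S \<Longrightarrow> comb p1 p2 p3 \<in> carrier P"
  using S_closed(1) by (simp add: comb_def)

lemma comb_add:
  assumes "p1 \<in> S" "p2 \<in> S" "p3 \<in> S" "q1 \<in> S" "q2 \<in> S" "q3 \<in> S"
  shows "comb p1 p2 p3 \<oplus>\<^bsub>P\<^esub> comb q1 q2 q3 = comb (p1 \<oplus>\<^bsub>P\<^esub> q1) (p2 \<oplus>\<^bsub>P\<^esub> q2) (p3 \<oplus>\<^bsub>P\<^esub> q3)"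
  using assms[THEN S_closed(1)] by (simp add: comb_def P.M.smult_r_distr P.M.a_ac)

lemma comb_smult:
  assumes "p1 \<in> S" "p2 \<in> S" "p3 \<in> S" "c \<in> carrier K"
  shows "s c \<odot>\<^bsub>P\<^esub> comb p1 p2 p3 = comb (s c \<odot>\<^bsub>P\<^esub> p1) (s c \<odot>\<^bsub>P\<^esub> p2) (s c \<odot>\<^bsub>P\<^esub> p3)"
proof -
  have sm: "s c \<odot>\<^bsub>P\<^esub> (X \<odot>\<^bsub>P\<^esub> q) = X \<odot>\<^bsub>P\<^esub> (s c \<odot>\<^bsub>P\<^esub> q)" "s c \<odot>\<^bsub>P\<^esub> (Y \<odot>\<^bsub>P\<^esub> q) = Y \<odot>\<^bsub>P\<^esub> (s c \<odot>\<^bsub>P\<^esub> q)"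
    if "q \<in> carrier P" for q using that assms(4) by (auto intro: P.smult_commute)
  show ?thesis using assms(1-3)[THEN S_closed(1)] assms(4) by (simp add: comb_def P.M.smult_r_distr sm)
qed

lemma comb_XY:
  assumes "p1 \<in> S" "p2 \<in> S" "p3 \<in> S"
  shows "X \<odot>\<^bsub>P\<^esub> comb p1 p2 p3 = comb \<zero>\<^bsub>P\<^esub> \<zero>\<^bsub>P\<^esub> p2" "Y \<odot>\<^bsub>P\<^esub> comb p1 p2 p3 = comb \<zero>\<^bsub>P\<^esub> \<zero>\<^bsub>P\<^esub> p1"
  using assms[THEN S_closed(1)] P.YX_smult[of p1] P.YX_smult[of "Y \<odot>\<^bsub>P\<^esub> p3"]
  by (simp_all add: comb_def P.M.smult_r_distr)

lemma comb_inject: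
  assumes p: "p1 \<in> S" "p2 \<in> S" "p3 \<in> S" and q: "q1 \<in> S" "q2 \<in> S" "q3 \<in> S"
    and eq: "comb p1 p2 p3 = comb q1 q2 q3"
  shows "p1 = q1 \<and> p2 = q2 \<and> p3 = q3"
proof -
  have "comb (p1 \<oplus>\<^bsub>P\<^esub> q1) (p2 \<oplus>\<^bsub>P\<^esub> q2) (p3 \<oplus>\<^bsub>P\<^esub> q3) = \<zero>\<^bsub>P\<^esub>"
    using comb_add[OF p q] P.M_add_self[OF comb_closed[OF q]] eq by simp
  then have "\<zero>\<^bsub>P\<^esub> \<oplus>\<^bsub>P\<^esub> comb (p1 \<oplus>\<^bsub>P\<^esub> q1) (p2 \<oplus>\<^bsub>P\<^esub> q2) (p3 \<oplus>\<^bsub>P\<^esub> q3) = \<zero>\<^bsub>P\<^esub>" by simp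
  from lift_independent(2-4)[OF S_closed(2) S_closed(3)[OF p(1) q(1)] S_closed(3)[OF p(2) q(2)]
      S_closed(3)[OF p(3) q(3)] this[unfolded comb_def]]
  show ?thesis using P.M_add_eq_zero_iff p q S_closed(1) by blast
qed

definition coord :: "'p \<Rightarrow> 'p \<times> 'p \<times> 'p" where
  "coord v = (SOME (p1, p2, p3). p1 \<in> S \<and> p2 \<in> S \<and> p3 \<in> S \<and> v = comb p1 p2 p3)"

definition "c1 v = fst (coord v)"
definition "c2 v = fst (snd (coord v))"
definition "c3 v = snd (snd (coord v))"

lemma coord_comb:
  assumes p: "p1 \<in> S" "p2 \<in> S" "p3 \<in> S"
  shows "c1 (comb p1 p2 p3) = p1" "c2 (comb p1 p2 p3) = p2" "c3 (comb p1 p2 p3) = p3"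
proof -
  have "coord (comb p1 p2 p3) = (p1, p2, p3)"
    unfolding coord_def
  proof (rule some_equality)
    fix q assume "case q of (q1, q2, q3) \<Rightarrow> q1 \<in> S \<and> q2 \<in> S \<and> q3 \<in> S \<and> comb p1 p2 p3 = comb q1 q2 q3"
    then show "q = (p1, p2, p3)"
      using comb_inject[OF p, of "fst q" "fst (snd q)" "snd (snd q)"] by (auto split: prod.splits)
  qed (use p in simp)
  then show "c1 (comb p1 p2 p3) = p1" "c2 (comb p1 p2 p3) = p2" "c3 (comb p1 p2 p3) = p3"
    by (simp_all add: c1_def c2_def c3_def)
qed

definition combs :: "'p set \<Rightarrow> 'p set" where
  "combs T = {comb p1 p2 p3 | p1 p2 p3. p1 \<in> T \<and> p2 \<in> T \<and> p3 \<in> T}"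

lemma combsE:
  assumes "v \<in> combs T"
  obtains p1 p2 p3 where "p1 \<in> T" "p2 \<in> T" "p3 \<in> T" "v = comb p1 p2 p3"
  using assms unfolding combs_def by blast

lemma linear_coord:
  "linear_on K (vs P) (vs P) (combs S) c1" "linear_on K (vs P) (vs P) (combs S) c2"
  "linear_on K (vs P) (vs P) (combs S) c3"
proof -
  have 1: "c1 v \<in> carrier P \<and> c2 v \<in> carrier P \<and> c3 v \<in> carrier P" if "v \<in> combs S" for v
    using that by (elim combsE) (simp add: coord_comb S_closed(1))
  have 2: "c1 (v \<oplus>\<^bsub>P\<^esub> w) = c1 v \<oplus>\<^bsub>P\<^esub> c1 w \<and> c2 (v \<oplus>\<^bsub>P\<^esub> w) = c2 v \<oplus>\<^bsub>P\<^esub> c2 w \<and> c3 (v \<oplus>\<^bsub>P\<^esub> w) = c3 v \<oplus>\<^bsub>P\<^esub> c3 w"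
    if "v \<in> combs S" "w \<in> combs S" for v w
    using that by (elim combsE) (simp add: coord_comb comb_add S_closed(3))
  have 3: "c1 (s c \<odot>\<^bsub>P\<^esub> v) = s c \<odot>\<^bsub>P\<^esub> c1 v \<and> c2 (s c \<odot>\<^bsub>P\<^esub> v) = s c \<odot>\<^bsub>P\<^esub> c2 v \<and> c3 (s c \<odot>\<^bsub>P\<^esub> v) = s c \<odot>\<^bsub>P\<^esub> c3 v"
    if "v \<in> combs S" "c \<in> carrier K" for v c
    using that by (elim combsE) (simp add: coord_comb comb_smult S_closed(4))
  show "linear_on K (vs P) (vs P) (combs S) c1" "linear_on K (vs P) (vs P) (combs S) c2"
    "linear_on K (vs P) (vs P) (combs S) c3"
    using 1 2 3 by (auto simp: linear_on_def)
qed

text \<open>For \<open>S\<close> itself this is the kernel of the cover; smaller \<open>T\<close>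
  will give the shifts of summands of \<open>M\<close>. The coordinate p3 is free because
  \<open>XY\<close> kills \<open>M\<close>.\<close>

definition Omega :: "'p set \<Rightarrow> 'p set" where
  "Omega T = {comb p1 p2 p3 | p1 p2 p3. p1 \<in> T \<and> p2 \<in> T \<and> p3 \<in> T \<and>
    X \<odot> \<pi> p1 \<oplus> Y \<odot> \<pi> p2 = \<zero>}"

lemma OmegaE:
  assumes "v \<in> Omega T"
  obtains p1 p2 p3 where "p1 \<in> T" "p2 \<in> T" "p3 \<in> T" "v = comb p1 p2 p3"
    "X \<odot> \<pi> p1 \<oplus> Y \<odot> \<pi> p2 = \<zero>"
  using assms unfolding Omega_def by blast

lemma OmegaI:
  "p1 \<in> T \<Longrightarrow> p2 \<in> T \<Longrightarrow> p3 \<in> T \<Longrightarrow> X \<odot> \<pi> p1 \<oplus> Y \<odot> \<pi> p2 = \<zero> \<Longrightarrow> comb p1 p2 p3 \<in> Omega T"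
  unfolding Omega_def by blast

lemma Omega_combs: "T \<subseteq> S \<Longrightarrow> Omega T \<subseteq> combs S"
  unfolding Omega_def combs_def by blast

text \<open>The image of p0 plus \<open>comb p1 p2 p3\<close> has the component \<pi> p0 in
  \<open>A\<close> and X \<pi> p1 + Y \<pi> p2 in the radical. Both vanish on the kernel, and \<pi>
  is injective on \<open>S\<close>.\<close>

lemma ker_eq_Omega: "pi.ker = Omega S"
proof (intro equalityI subsetI)
  fix v assume v: "v \<in> pi.ker"
  then obtain p0 p1 p2 p3 where p: "p0 \<in> S" "p1 \<in> S" "p2 \<in> S" "p3 \<in> S"
    and vp: "v = p0 \<oplus>\<^bsub>P\<^esub> comb p1 p2 p3"
    using P_decomp[of v] unfolding comb_def pi.ker_def by blast
  note c = p[THEN S_closed(1)]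
  have pv: "\<pi> v = \<pi> p0 \<oplus> (X \<odot> \<pi> p1 \<oplus> Y \<odot> \<pi> p2)"
    unfolding vp comb_def using c by (simp add: XY_zero)
  have "X \<odot> \<pi> p1 \<oplus> Y \<odot> \<pi> p2 \<in> rad" using c by (auto simp: radical_def plus_set_def)
  then have 0: "\<pi> p0 = \<zero>" "X \<odot> \<pi> p1 \<oplus> Y \<odot> \<pi> p2 = \<zero>"
    using dir_sum_eq_zero[OF A \<pi>_in_A[OF p(1)]] pv v by (auto simp: pi.ker_def)
  then have "v = comb p1 p2 p3" using vp \<pi>_eq_zero[OF p(1)] comb_closed[OF p(2-4)] by simp
  then show "v \<in> Omega S" using OmegaI[OF p(2-4) 0(2)] by simp
next
  fix v assume "v \<in> Omega S"
  then obtain p1 p2 p3 where p: "p1 \<in> S" "p2 \<in> S" "p3 \<in> S" "v = comb p1 p2 p3"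
    "X \<odot> \<pi> p1 \<oplus> Y \<odot> \<pi> p2 = \<zero>" by (rule OmegaE)
  note c = p(1-3)[THEN S_closed(1)]
  have "\<pi> v = X \<odot> \<pi> p1 \<oplus> Y \<odot> \<pi> p2" unfolding p(4) comb_def using c by (simp add: XY_zero)
  then show "v \<in> pi.ker" using p comb_closed by (simp add: pi.ker_def)
qed

lemma submodule_Omega:
  assumes T: "subspace K T (vs P)" "T \<subseteq> S"
  shows "submodule R (Omega T) P"
  unfolding P.submodule_iff
proof (intro conjI ballI)
  note Tc = subspaceD[OF T(1), simplified]
  have TS: "p \<in> S" if "p \<in> T" for p using that T(2) by auto
  have z: "comb \<zero>\<^bsub>P\<^esub> \<zero>\<^bsub>P\<^esub> p \<in> Omega T" if "p \<in> T" for p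
    using OmegaI[OF Tc(3) Tc(3) that] by simp
  show "subspace K (Omega T) (vs P)"
  proof (rule subspaceI[OF P.vectorspace_vs], simp_all)
    show "Omega T \<subseteq> carrier P" using comb_closed TS by (auto elim!: OmegaE)
    show "\<zero>\<^bsub>P\<^esub> \<in> Omega T" using z[OF Tc(3)] by (simp add: comb_def)
  next
    fix v w assume "v \<in> Omega T" "w \<in> Omega T"
    then show "v \<oplus>\<^bsub>P\<^esub> w \<in> Omega T"
    proof (elim OmegaE)
      fix p1 p2 p3 q1 q2 q3 assume p: "p1 \<in> T" "p2 \<in> T" "p3 \<in> T" "v = comb p1 p2 p3"
        "X \<odot> \<pi> p1 \<oplus> Y \<odot> \<pi> p2 = \<zero>"
        and q: "q1 \<in> T" "q2 \<in> T" "q3 \<in> T" "w = comb q1 q2 q3"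
        "X \<odot> \<pi> q1 \<oplus> Y \<odot> \<pi> q2 = \<zero>"
      note c = p(1-3)[THEN Tc(2)] q(1-3)[THEN Tc(2)]
      have eq: "v \<oplus>\<^bsub>P\<^esub> w = comb (p1 \<oplus>\<^bsub>P\<^esub> q1) (p2 \<oplus>\<^bsub>P\<^esub> q2) (p3 \<oplus>\<^bsub>P\<^esub> q3)"
        using comb_add p q TS by simp
      have "X \<odot> \<pi> (p1 \<oplus>\<^bsub>P\<^esub> q1) \<oplus> Y \<odot> \<pi> (p2 \<oplus>\<^bsub>P\<^esub> q2)
          = (X \<odot> \<pi> p1 \<oplus> Y \<odot> \<pi> p2) \<oplus> (X \<odot> \<pi> q1 \<oplus> Y \<odot> \<pi> q2)"
        using c by (simp add: M.smult_r_distr M.a_ac)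
      also have "\<dots> = \<zero>" unfolding p(5) q(5) by simp
      finally show ?thesis unfolding eq
        by (rule OmegaI[OF Tc(4)[OF p(1) q(1)] Tc(4)[OF p(2) q(2)] Tc(4)[OF p(3) q(3)]])
    qed
  next
    fix c v assume cK: "c \<in> carrier K" and "v \<in> Omega T"
    then show "s c \<odot>\<^bsub>P\<^esub> v \<in> Omega T"
    proof (elim OmegaE)
      fix p1 p2 p3 assume p: "p1 \<in> T" "p2 \<in> T" "p3 \<in> T" "v = comb p1 p2 p3"
        "X \<odot> \<pi> p1 \<oplus> Y \<odot> \<pi> p2 = \<zero>"
      note c = p(1-3)[THEN Tc(2)]
      have eq: "s c \<odot>\<^bsub>P\<^esub> v = comb (s c \<odot>\<^bsub>P\<^esub> p1) (s c \<odot>\<^bsub>P\<^esub> p2) (s c \<odot>\<^bsub>P\<^esub> p3)"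
        using comb_smult p TS cK by simp
      have "X \<odot> \<pi> (s c \<odot>\<^bsub>P\<^esub> p1) \<oplus> Y \<odot> \<pi> (s c \<odot>\<^bsub>P\<^esub> p2)
          = s c \<odot> (X \<odot> \<pi> p1 \<oplus> Y \<odot> \<pi> p2)"
        using c cK smult_commute[of "\<pi> p1" X "s c"] smult_commute[of "\<pi> p2" Y "s c"] by (simp add: M.smult_r_distr)
      also have "\<dots> = \<zero>" unfolding p(5) using cK by simp
      finally show ?thesis unfolding eq
        by (rule OmegaI[OF Tc(5)[OF cK p(1)] Tc(5)[OF cK p(2)] Tc(5)[OF cK p(3)]])
    qed
  qed
  show "X \<odot>\<^bsub>P\<^esub> v \<in> Omega T" "Y \<odot>\<^bsub>P\<^esub> v \<in> Omega T" if "v \<in> Omega T" for v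
    using that by (auto elim!: OmegaE simp: comb_XY TS z)
qed

text \<open>For \<open>T\<close> inside \<open>S\<close> this is the radical of the submodule
  generated by the image of \<open>T\<close>.\<close>

definition gen :: "'p set \<Rightarrow> 'm set" where
  "gen T = plus_set (vs M) ((\<lambda>p. X \<odot> \<pi> p) ` T) ((\<lambda>p. Y \<odot> \<pi> p) ` T)"

lemma linear_XY\<pi>:
  assumes "T \<subseteq> S"
  shows "linear_on K (vs P) (vs M) T (\<lambda>p. X \<odot> \<pi> p)" "linear_on K (vs P) (vs M) T (\<lambda>p. Y \<odot> \<pi> p)"
proof -
  have "linear_on K (vs P) (vs M) T \<pi>"
    using linear_on_subset[OF linear_\<pi>] assms S_closed(1) by blast
  then show "linear_on K (vs P) (vs M) T (\<lambda>p. X \<odot> \<pi> p)" "linear_on K (vs P) (vs M) T (\<lambda>p. Y \<odot> \<pi> p)"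
    using linear_on_compose[OF _ linear_on_smult[OF X_closed]] linear_on_compose[OF _ linear_on_smult[OF Y_closed]]
      assms \<pi>_closed by blast+
qed

lemma fin_gen:
  assumes T: "fin_sub K (vs P) T" "T \<subseteq> S"
  shows "fin_sub K (vs M) (gen T)"
  unfolding gen_def using rank_nullity(1)[OF T(1) vectorspace_vs] linear_XY\<pi>[OF T(2)] by (intro fin_sub_plus)

lemma XY_image:
  assumes T: "fin_sub K (vs P) T" "T \<subseteq> S"
  shows "fin_sub K (vs P) ((\<lambda>p. X \<odot>\<^bsub>P\<^esub> (Y \<odot>\<^bsub>P\<^esub> p)) ` T)"
    "vdim K (vs P) ((\<lambda>p. X \<odot>\<^bsub>P\<^esub> (Y \<odot>\<^bsub>P\<^esub> p)) ` T) = vdim K (vs P) T"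
proof -
  have "linear_on K (vs P) (vs P) (carrier P) (\<lambda>p. X \<odot>\<^bsub>P\<^esub> (Y \<odot>\<^bsub>P\<^esub> p))"
    by (rule linear_on_compose[OF P.linear_on_smult P.linear_on_smult]) auto
  then have lin: "linear_on K (vs P) (vs P) T (\<lambda>p. X \<odot>\<^bsub>P\<^esub> (Y \<odot>\<^bsub>P\<^esub> p))"
    using linear_on_subset T(2) S_closed(1) by blast
  have inj: "inj_on (\<lambda>p. X \<odot>\<^bsub>P\<^esub> (Y \<odot>\<^bsub>P\<^esub> p)) T"
    unfolding linear_on_inj_iff[OF fin_subD(1)[OF T(1)] P.vectorspace_vs lin] using XY_S T(2) by auto
  show "fin_sub K (vs P) ((\<lambda>p. X \<odot>\<^bsub>P\<^esub> (Y \<odot>\<^bsub>P\<^esub> p)) ` T)"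
    by (rule rank_nullity(1)[OF T(1) P.vectorspace_vs lin])
  show "vdim K (vs P) ((\<lambda>p. X \<odot>\<^bsub>P\<^esub> (Y \<odot>\<^bsub>P\<^esub> p)) ` T) = vdim K (vs P) T"
    by (rule vdim_image_inj[OF T(1) P.vectorspace_vs lin inj])
qed

text \<open>\<open>Omega T\<close> is the sum of XY T, of dimension dim T, and the part
  \<open>N\<close> with p3 = 0. The pair from \<open>N\<close> to \<open>T\<close> is the shift of T
  -> gen T, so \<open>N\<close> and \<open>gen T\<close> have dimension 2 dim T together. This makes
  3 dim T in all.\<close>

lemma vdim_Omega:
  assumes T: "fin_sub K (vs P) T" "T \<subseteq> S"
  shows "fin_sub K (vs P) (Omega T)"
    "vdim K (vs P) (Omega T) + vdim K (vs M) (gen T) = 3 * vdim K (vs P) T"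
proof -
  note sT = fin_subD(1)[OF T(1)]
  note Tc = subspaceD[OF sT, simplified]
  have TS: "p \<in> S" if "p \<in> T" for p using that T(2) by auto
  note sO = P.submoduleD(1)[OF submodule_Omega[OF sT T(2)]]
  note OC = Omega_combs[OF T(2)]
  note lin = linear_on_subset[OF linear_coord(1) OC] linear_on_subset[OF linear_coord(2) OC] linear_on_subset[OF linear_coord(3) OC]
  let ?XY = "(\<lambda>p. X \<odot>\<^bsub>P\<^esub> (Y \<odot>\<^bsub>P\<^esub> p)) ` T"
  note xy = XY_image[OF T]
  define N where "N = {v \<in> Omega T. c3 v \<in> {\<zero>\<^bsub>P\<^esub>}}"
  have sN: "subspace K N (vs P)" unfolding N_def
    using subspace_vimage[OF sO subspace_zero[OF P.vectorspace_vs] lin(3)] by simp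
  have NE: "\<exists>p1\<in>T. \<exists>p2\<in>T. v = comb p1 p2 \<zero>\<^bsub>P\<^esub> \<and> X \<odot> \<pi> p1 \<oplus> Y \<odot> \<pi> p2 = \<zero>" if "v \<in> N" for v
  proof -
    have v: "v \<in> Omega T" "c3 v = \<zero>\<^bsub>P\<^esub>" using that by (auto simp: N_def)
    from v(1) show ?thesis by (rule OmegaE) (use v(2) coord_comb(3) TS in fastforce)
  qed
  have NI: "comb p1 p2 \<zero>\<^bsub>P\<^esub> \<in> N" if "p1 \<in> T" "p2 \<in> T" "X \<odot> \<pi> p1 \<oplus> Y \<odot> \<pi> p2 = \<zero>" for p1 p2
    using OmegaI[OF that(1,2) Tc(3) that(3)] coord_comb(3)[OF TS[OF that(1)] TS[OF that(2)] S_closed(2)] by (simp add: N_def)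
  have XYO: "X \<odot>\<^bsub>P\<^esub> (Y \<odot>\<^bsub>P\<^esub> p) = comb \<zero>\<^bsub>P\<^esub> \<zero>\<^bsub>P\<^esub> p" if "p \<in> T" for p
    using Tc(2)[OF that] by (simp add: comb_def)
  have ds: "dir_sum K (vs P) (Omega T) N ?XY"
  proof (rule dir_sumI[OF sN fin_subD(1)[OF xy(1)] _ sO])
    show "N \<subseteq> Omega T" by (auto simp: N_def)
    show "?XY \<subseteq> Omega T" using XYO OmegaI[OF Tc(3) Tc(3)] by auto
    show "v = \<zero>\<^bsub>vs P\<^esub>" if v: "v \<in> N" "v \<in> ?XY" for v
    proof -
      obtain p where p: "p \<in> T" "v = comb \<zero>\<^bsub>P\<^esub> \<zero>\<^bsub>P\<^esub> p" using v(2) XYO by auto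
      have "p = \<zero>\<^bsub>P\<^esub>" using coord_comb(3)[OF S_closed(2) S_closed(2) TS[OF p(1)]] v(1) p(2) by (simp add: N_def)
      then show ?thesis using p(2) by (simp add: comb_def)
    qed
    fix v assume "v \<in> Omega T"
    then show "\<exists>a1\<in>N. \<exists>a2\<in>?XY. v = a1 \<oplus>\<^bsub>vs P\<^esub> a2"
    proof (rule OmegaE)
      fix p1 p2 p3 assume p: "p1 \<in> T" "p2 \<in> T" "p3 \<in> T" "v = comb p1 p2 p3" "X \<odot> \<pi> p1 \<oplus> Y \<odot> \<pi> p2 = \<zero>"
      have "v = comb p1 p2 \<zero>\<^bsub>P\<^esub> \<oplus>\<^bsub>P\<^esub> X \<odot>\<^bsub>P\<^esub> (Y \<odot>\<^bsub>P\<^esub> p3)"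
        using p Tc(2) by (simp add: comb_def P.M.a_ac)
      then show ?thesis using NI[OF p(1,2,5)] p(3) by auto
    qed
  qed
  \<comment> \<open>In \<open>linked\<close> the relation is x' (y a) + y' (x a) = 0, so the
    coordinate multiplied by \<open>X\<close> stands in the place of y: hence \<open>c2\<close>
    before \<open>c1\<close>.\<close>
  have "linked K (vs P) (vs P) (vs M) N T (gen T) c2 c1 (\<lambda>p. X \<odot> \<pi> p) (\<lambda>p. Y \<odot> \<pi> p)"
    if fN: "fin_sub K (vs P) N"
    unfolding linked_def
  proof (intro conjI ballI impI)
    have NO: "N \<subseteq> Omega T" by (auto simp: N_def)
    have cN: "c1 (comb p1 p2 \<zero>\<^bsub>P\<^esub>) = p1" "c2 (comb p1 p2 \<zero>\<^bsub>P\<^esub>) = p2" if "p1 \<in> T" "p2 \<in> T" for p1 p2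
      using coord_comb[OF TS[OF that(1)] TS[OF that(2)] S_closed(2)] by auto
    show "kron K (vs P) (vs P) N T c2 c1"
      unfolding kron_def using fN T(1) linear_on_subset[OF lin(2) NO] linear_on_subset[OF lin(1) NO] NE cN by force
    have "plus_set (vs M) ((\<lambda>p. X \<odot> \<pi> p) ` T) ((\<lambda>p. Y \<odot> \<pi> p) ` T) = gen T" by (simp add: gen_def)
    then have "X \<odot> \<pi> p \<in> gen T" "Y \<odot> \<pi> p \<in> gen T" if "p \<in> T" for p
      using plus_set_upper[OF subspace_image[OF sT vectorspace_vs linear_XY\<pi>(1)[OF T(2)]]
          subspace_image[OF sT vectorspace_vs linear_XY\<pi>(2)[OF T(2)]]] that by auto
    then show "kron K (vs P) (vs M) T (gen T) (\<lambda>p. X \<odot> \<pi> p) (\<lambda>p. Y \<odot> \<pi> p)"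
      unfolding kron_def using T(1) fin_gen[OF T] linear_XY\<pi>[OF T(2)] by simp
    show "v = \<zero>\<^bsub>vs P\<^esub>" if v: "v \<in> N" "c2 v = \<zero>\<^bsub>vs P\<^esub>" "c1 v = \<zero>\<^bsub>vs P\<^esub>" for v
    proof -
      obtain p1 p2 where p: "p1 \<in> T" "p2 \<in> T" "v = comb p1 p2 \<zero>\<^bsub>P\<^esub>" using NE[OF v(1)] by blast
      then have "v = comb \<zero>\<^bsub>P\<^esub> \<zero>\<^bsub>P\<^esub> \<zero>\<^bsub>P\<^esub>" using v(2,3) cN[OF p(1,2)] by simp
      then show ?thesis by (simp add: comb_def)
    qed
    show "X \<odot> \<pi> p \<oplus>\<^bsub>vs M\<^esub> Y \<odot> \<pi> q = \<zero>\<^bsub>vs M\<^esub> \<longleftrightarrow> (\<exists>a\<in>N. p = c1 a \<and> q = c2 a)" if pq: "p \<in> T" "q \<in> T" for p q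
    proof
      assume "X \<odot> \<pi> p \<oplus>\<^bsub>vs M\<^esub> Y \<odot> \<pi> q = \<zero>\<^bsub>vs M\<^esub>"
      then show "\<exists>a\<in>N. p = c1 a \<and> q = c2 a" using NI[OF pq] cN[OF pq] by force
    next
      assume "\<exists>a\<in>N. p = c1 a \<and> q = c2 a"
      then show "X \<odot> \<pi> p \<oplus>\<^bsub>vs M\<^esub> Y \<odot> \<pi> q = \<zero>\<^bsub>vs M\<^esub>" using NE cN by force
    qed
  qed (simp add: gen_def)
  moreover have "fin_sub K (vs P) N"
  proof (rule fin_sub_mono(1)[OF _ sN])
    have linX: "linear_on K (vs P) (vs P) T (\<lambda>p. X \<odot>\<^bsub>P\<^esub> p)" "linear_on K (vs P) (vs P) T (\<lambda>p. Y \<odot>\<^bsub>P\<^esub> p)"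
      using linear_on_subset[OF P.linear_on_smult] Tc(2) by (meson X_closed Y_closed subsetI)+
    show "fin_sub K (vs P) (plus_set (vs P) ((\<lambda>p. X \<odot>\<^bsub>P\<^esub> p) ` T) ((\<lambda>p. Y \<odot>\<^bsub>P\<^esub> p) ` T))"
      using rank_nullity(1)[OF T(1) P.vectorspace_vs] linX by (intro fin_sub_plus)
    show "N \<subseteq> plus_set (vs P) ((\<lambda>p. X \<odot>\<^bsub>P\<^esub> p) ` T) ((\<lambda>p. Y \<odot>\<^bsub>P\<^esub> p) ` T)"
    proof
      fix v assume "v \<in> N"
      then obtain p1 p2 where p: "p1 \<in> T" "p2 \<in> T" "v = comb p1 p2 \<zero>\<^bsub>P\<^esub>" using NE by blast
      then have "v = X \<odot>\<^bsub>P\<^esub> p1 \<oplus>\<^bsub>P\<^esub> Y \<odot>\<^bsub>P\<^esub> p2" using Tc(2) by (simp add: comb_def)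
      then show "v \<in> plus_set (vs P) ((\<lambda>p. X \<odot>\<^bsub>P\<^esub> p) ` T) ((\<lambda>p. Y \<odot>\<^bsub>P\<^esub> p) ` T)"
        using p by (auto simp: plus_set_def)
    qed
  qed
  ultimately have dimN: "vdim K (vs P) N + vdim K (vs M) (gen T) = 2 * vdim K (vs P) T" and fN: "fin_sub K (vs P) N"
    using linked_vdim by blast+
  show fO: "fin_sub K (vs P) (Omega T)" by (rule dir_sum_fin_sub[OF ds fN xy(1)])
  show "vdim K (vs P) (Omega T) + vdim K (vs M) (gen T) = 3 * vdim K (vs P) T"
    using dir_sum_vdim(1)[OF ds fO] xy(2) dimN by simp
qed

end

section \<open>Even dimensional modules\<close>

text \<open>Assembles summands of \<open>M\<close> from those of \<open>A\<close> and of the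
  radical, and a complement of the radical from complements inside two summands.\<close>

lemma dir_sum_interchange:
  assumes UW: "dir_sum K V A U W" and U: "dir_sum K V U U1 U2" and W: "dir_sum K V W W1 W2"
  shows "dir_sum K V A (plus_set V U1 W1) (plus_set V U2 W2)"
    "dir_sum K V (plus_set V U1 W1) U1 W1"
proof -
  note D = dir_sumD[OF UW] and DU = dir_sumD[OF U] and DW = dir_sumD[OF W]
  interpret V: vectorspace K V by (rule subspaceD(1)[OF D(1)])
  have sub: "subspace K (plus_set V U1 W1) V" "subspace K (plus_set V U2 W2) V"
    by (intro subspace_plus DU DW)+
  show "dir_sum K V A (plus_set V U1 W1) (plus_set V U2 W2)"
  proof (rule dir_sumI[OF sub _ D(3)])
    fix v assume "v \<in> plus_set V U1 W1" "v \<in> plus_set V U2 W2"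
    then obtain u1 w1 u2 w2 where v: "u1 \<in> U1" "w1 \<in> W1" "v = u1 \<oplus>\<^bsub>V\<^esub> w1" "u2 \<in> U2" "w2 \<in> W2" "v = u2 \<oplus>\<^bsub>V\<^esub> w2"
      by (elim plus_setE) blast
    have "u1 = u2" "w1 = w2"
      using dir_sum_unique[OF UW subsetD[OF DU(4) v(1)] subsetD[OF DU(5) v(4)] subsetD[OF DW(4) v(2)] subsetD[OF DW(5) v(5)]]
        v(3,6) by auto
    then have "u1 = \<zero>\<^bsub>V\<^esub>" "w1 = \<zero>\<^bsub>V\<^esub>" using DU(6) DW(6) v by auto
    then show "v = \<zero>\<^bsub>V\<^esub>" using v(3) by simp
  next
    show "plus_set V U1 W1 \<subseteq> A" "plus_set V U2 W2 \<subseteq> A"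
      using plus_set_least[OF D(3)] DU(4,5) DW(4,5) D(4,5) by (meson subset_trans)+
    fix a assume "a \<in> A"
    then obtain u w where uw: "u \<in> U" "w \<in> W" "a = u \<oplus>\<^bsub>V\<^esub> w" using D(8) by meson
    obtain u1 u2 where u: "u1 \<in> U1" "u2 \<in> U2" "u = u1 \<oplus>\<^bsub>V\<^esub> u2" using DU(8)[OF uw(1)] by blast
    obtain w1 w2 where w: "w1 \<in> W1" "w2 \<in> W2" "w = w1 \<oplus>\<^bsub>V\<^esub> w2" using DW(8)[OF uw(2)] by blast
    have "a = (u1 \<oplus>\<^bsub>V\<^esub> w1) \<oplus>\<^bsub>V\<^esub> (u2 \<oplus>\<^bsub>V\<^esub> w2)"
      using uw u w subspaceD(2)[OF DU(1)] subspaceD(2)[OF DU(2)] subspaceD(2)[OF DW(1)] subspaceD(2)[OF DW(2)]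
      by (simp add: V.M.a_ac)
    then show "\<exists>a1\<in>plus_set V U1 W1. \<exists>a2\<in>plus_set V U2 W2. a = a1 \<oplus>\<^bsub>V\<^esub> a2"
      using plus_setI[OF u(1) w(1), of V] plus_setI[OF u(2) w(2), of V] by blast
  qed
  show "dir_sum K V (plus_set V U1 W1) U1 W1"
    unfolding dir_sum_def using DU(1,4) DW(1,4) D(6) subspaceD(3)[OF DU(1)] subspaceD(3)[OF DW(1)] by blast
qed

lemma dir_sum_assoc:
  assumes UW: "dir_sum K V A U W" and U: "dir_sum K V U U1 U2"
  shows "dir_sum K V A U1 (plus_set V U2 W)"
proof -
  note D = dir_sumD[OF UW] and DU = dir_sumD[OF U]
  interpret V: vectorspace K V by (rule subspaceD(1)[OF D(1)])
  show ?thesis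
  proof (rule dir_sumI[OF DU(1) subspace_plus[OF DU(2) D(2)] _ D(3)])
    fix v assume v: "v \<in> U1" "v \<in> plus_set V U2 W"
    then obtain u2 w where uw: "u2 \<in> U2" "w \<in> W" "v = u2 \<oplus>\<^bsub>V\<^esub> w" by (elim plus_setE)
    have "v \<oplus>\<^bsub>V\<^esub> \<zero>\<^bsub>V\<^esub> = u2 \<oplus>\<^bsub>V\<^esub> w" using uw v(1) subspaceD(2)[OF DU(1)] by simp
    then have "v = u2"
      using dir_sum_unique(1)[OF UW subsetD[OF DU(4) v(1)] subsetD[OF DU(5) uw(1)] subspaceD(3)[OF D(2)] uw(2)] by simp
    then show "v = \<zero>\<^bsub>V\<^esub>" using DU(6) v uw by blast
  next
    show "U1 \<subseteq> A" "plus_set V U2 W \<subseteq> A"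
      using plus_set_least[OF D(3)] DU(4,5) D(4,5) by (meson subset_trans)+
    fix a assume "a \<in> A"
    then obtain u w where uw: "u \<in> U" "w \<in> W" "a = u \<oplus>\<^bsub>V\<^esub> w" using D(8) by meson
    obtain u1 u2 where u: "u1 \<in> U1" "u2 \<in> U2" "u = u1 \<oplus>\<^bsub>V\<^esub> u2" using DU(8)[OF uw(1)] by blast
    have "a = u1 \<oplus>\<^bsub>V\<^esub> (u2 \<oplus>\<^bsub>V\<^esub> w)"
      using uw u subspaceD(2)[OF DU(1)] subspaceD(2)[OF DU(2)] subspaceD(2)[OF D(2)]
      by (simp add: V.M.a_assoc)
    then show "\<exists>a1\<in>U1. \<exists>a2\<in>plus_set V U2 W. a = a1 \<oplus>\<^bsub>V\<^esub> a2"
      using u(1) plus_setI[OF u(2) uw(2), of V] by blast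
  qed
qed

context char2_module
begin

lemma submodule_plus:
  assumes "submodule R U M" "submodule R W M"
  shows "submodule R (plus_set (vs M) U W) M"
  unfolding submodule_iff
proof (intro conjI ballI)
  note u = submoduleD[OF assms(1)] and w = submoduleD[OF assms(2)]
  show "subspace K (plus_set (vs M) U W) (vs M)" by (intro subspace_plus u w)
  fix v assume "v \<in> plus_set (vs M) U W"
  then obtain a b where ab: "a \<in> U" "b \<in> W" "v = a \<oplus> b" by (auto simp: plus_set_def)
  show "X \<odot> v \<in> plus_set (vs M) U W" "Y \<odot> v \<in> plus_set (vs M) U W"
    using plus_setI[OF u(2)[OF ab(1)] w(2)[OF ab(2)], of "vs M"] plus_setI[OF u(3)[OF ab(1)] w(3)[OF ab(2)], of "vs M"]
      ab u(4)[OF ab(1)] w(4)[OF ab(2)] by (simp_all add: M.smult_r_distr)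
qed

lemma submodule_submodule:
  assumes U: "submodule R U M"
  shows "submodule R W (M\<lparr>carrier := U\<rparr>) \<longleftrightarrow> submodule R W M \<and> W \<subseteq> U"
  using submoduleD(4,6)[OF U] M.module_axioms by (auto simp: submodule_def)

lemma subspace_restrict_iff:
  assumes U: "submodule R U M"
  shows "subspace K W (vs (M\<lparr>carrier := U\<rparr>)) \<longleftrightarrow> subspace K W (vs M) \<and> W \<subseteq> U"
proof -
  have "char2_module K (M\<lparr>carrier := U\<rparr>)"
    by (intro char2_module.intro char2_field_axioms submoduleD(6)[OF U])
  from char2_module.vectorspace_vs[OF this] vectorspace_vs submoduleD(4)[OF U]
  show ?thesis
    unfolding subspace_def submodule_def vectorspace_def by auto
qed

lemma dir_sum_restrict_iff:
  assumes U: "submodule R U M"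
  shows "dir_sum K (vs (M\<lparr>carrier := U\<rparr>)) U W1 W2 \<longleftrightarrow> dir_sum K (vs M) U W1 W2"
proof -
  have "plus_set (vs (M\<lparr>carrier := U\<rparr>)) W1 W2 = plus_set (vs M) W1 W2" by (simp add: plus_set_def)
  then show ?thesis
    using plus_set_upper[of K W1 "vs M" W2] subspace_restrict_iff[OF U] by (auto simp: dir_sum_def)
qed

text \<open>If an odd-dimensional summand decomposes, one of its parts is odd-dimensional, smaller,
  and again a summand of \<open>M\<close>.\<close>

lemma odd_indecomposable_summand:
  assumes fd: "fin_sub K (vs M) (carrier M)" and "direct_summand R U M" and "odd (vdim K (vs M) U)"
  shows "\<exists>U'. direct_summand R U' M \<and> indecomposable R (M\<lparr>carrier := U'\<rparr>) \<and> odd (vdim K (vs M) U')"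
  using assms(2,3)
proof (induction "vdim K (vs M) U" arbitrary: U rule: less_induct)
  case less
  obtain W where U: "submodule R U M" and W: "submodule R W M" and UW: "dir_sum K (vs M) (carrier M) U W"
    using less.prems(1) unfolding direct_summand_iff by blast
  have fU: "fin_sub K (vs M) U" by (rule dir_sum_vdim(2)[OF UW fd])
  show ?case
  proof (cases "indecomposable R (M\<lparr>carrier := U\<rparr>)")
    case True
    then show ?thesis using less.prems by blast
  next
    case False
    interpret MU: char2_module K "M\<lparr>carrier := U\<rparr>"
      by (intro char2_module.intro char2_field_axioms submoduleD(6)[OF U])
    have "U \<noteq> {\<zero>}" using less.prems(2) vdim_zero[OF vectorspace_vs] by auto
    with False obtain V where V: "direct_summand R V (M\<lparr>carrier := U\<rparr>)" "V \<noteq> {\<zero>}" "V \<noteq> U"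
      unfolding indecomposable_def by auto
    then obtain V' where V': "submodule R V M" "submodule R V' M" "dir_sum K (vs M) U V V'"
      unfolding MU.direct_summand_iff by (auto simp: submodule_submodule[OF U] dir_sum_restrict_iff[OF U])
    note D = dir_sumD[OF V'(3), simplified] and dim = dir_sum_vdim[OF V'(3) fU]
    have "V' \<noteq> {\<zero>}"
    proof
      assume V0: "V' = {\<zero>}"
      have "U \<subseteq> V"
      proof
        fix u assume "u \<in> U"
        then obtain v where v: "v \<in> V" "u = v \<oplus> \<zero>" using D(8) V0 by blast
        then show "u \<in> V" using submoduleD(4)[OF V'(1)] by simp
      qed
      then show False using D(4) V(3) by blast
    qed
    then have pos: "vdim K (vs M) V > 0" "vdim K (vs M) V' > 0"
      using vdim_eq_0_iff[OF dim(2)] vdim_eq_0_iff[OF dim(3)] V(2) by auto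
    have sV: "direct_summand R V M"
      unfolding direct_summand_iff using V'(1) submodule_plus[OF V'(2) W] dir_sum_assoc[OF UW V'(3)] by blast
    have sV': "direct_summand R V' M"
      unfolding direct_summand_iff
      using V'(2) submodule_plus[OF V'(1) W] dir_sum_assoc[OF UW dir_sum_commute[OF V'(3)]] by blast
    show ?thesis
    proof (cases "odd (vdim K (vs M) V)")
      case True
      then show ?thesis using less.hyps[OF _ sV] dim(1) pos by simp
    next
      case False
      then show ?thesis using less.hyps[OF _ sV'] dim(1) pos less.prems(2) by simp
    qed
  qed
qed

lemma even_dimensional_iff:
  assumes fd: "fin_sub K (vs M) (carrier M)"
  shows "even_dimensional K M \<longleftrightarrow> (\<forall>U. direct_summand R U M \<longrightarrow> even (vdim K (vs M) U))"
  using odd_indecomposable_summand[OF fd] unfolding even_dimensional_def vdim_vs by blast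

end

context char2_lift
begin

lemma gen_eq: "T \<subseteq> S \<Longrightarrow> gen T = plus_set (vs M) ((\<lambda>v. X \<odot> v) ` \<pi> ` T) ((\<lambda>v. Y \<odot> v) ` \<pi> ` T)"
  by (simp add: gen_def image_image)

lemma gen_S: "gen S = rad"
  using radical_generated[OF A subset_refl] gen_eq[of S] \<pi>_S by simp

lemma linear_\<pi>_S: "linear_on K (vs P) (vs M) S \<pi>"
  using linear_on_subset[OF linear_\<pi>] S_closed(1) by blast

lemma vdim_S: "vdim K (vs P) S = vdim K (vs M) A"
  using vdim_image_inj[OF fin_S vectorspace_vs linear_\<pi>_S inj_\<pi>] \<pi>_S by simp

lemma kron_A: "kron K (vs M) (vs M) A rad (\<lambda>v. X \<odot> v) (\<lambda>v. Y \<odot> v)"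
proof -
  have "X \<odot> a \<in> rad \<and> Y \<odot> a \<in> rad" if "a \<in> A" for a
  proof -
    have "X \<odot> a \<oplus> Y \<odot> \<zero> \<in> rad" "X \<odot> \<zero> \<oplus> Y \<odot> a \<in> rad"
      using plus_setI[OF imageI[OF A_closed[OF that]] imageI[OF M.zero_closed], of "vs M" "\<lambda>v. X \<odot> v" "\<lambda>v. Y \<odot> v"]
        plus_setI[OF imageI[OF M.zero_closed] imageI[OF A_closed[OF that]], of "vs M" "\<lambda>v. X \<odot> v" "\<lambda>v. Y \<odot> v"]
      by (simp_all add: radical_def del: M.smult_r_null)
    then show ?thesis using A_closed[OF that] by simp
  qed
  then show ?thesis
    unfolding kron_def using fin_A fin_rad linear_on_subset[OF linear_on_smult A_dir(4)] by simp
qed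

text \<open>\<open>X\<close> and \<open>Y\<close> kill the radical and map \<open>A1\<close> into
  \<open>B1\<close>, so A1 + B1 is a submodule, and likewise for the other half. A decomposition of
  the pair is one of the module.\<close>

lemma odd_split_odd_summand:
  assumes "odd_split K (vs M) (vs M) A rad (\<lambda>v. X \<odot> v) (\<lambda>v. Y \<odot> v)"
  shows "\<exists>U. direct_summand R U M \<and> odd (vdim K (vs M) U)"
proof -
  obtain A1 A2 B1 B2 where sp: "kron_split K (vs M) (vs M) A rad (\<lambda>v. X \<odot> v) (\<lambda>v. Y \<odot> v) A1 A2 B1 B2"
    and o: "odd (vdim K (vs M) A1 + vdim K (vs M) B1)" using assms unfolding odd_split_def by blast
  note D = kron_splitD[OF sp]
  note DA = dir_sumD[OF D(1), simplified] and DB = dir_sumD[OF D(2), simplified]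
  note I = dir_sum_interchange[OF A D(1,2)]
  have sub: "submodule R (plus_set (vs M) T B) M"
    if T: "subspace K T (vs M)" "subspace K B (vs M)" "B \<subseteq> rad" "\<And>a. a \<in> T \<Longrightarrow> X \<odot> a \<in> B \<and> Y \<odot> a \<in> B" for T B
    unfolding submodule_iff
  proof (intro conjI ballI)
    show "subspace K (plus_set (vs M) T B) (vs M)" by (rule subspace_plus[OF T(1,2)])
    fix v assume "v \<in> plus_set (vs M) T B"
    then obtain a b where ab: "a \<in> T" "b \<in> B" "v = a \<oplus> b" by (auto simp: plus_set_def)
    have "b \<in> rad" using ab(2) T(3) by blast
    then have "X \<odot> v = X \<odot> a" "Y \<odot> v = Y \<odot> a"
      using ab rad_closed smult_rad subspaceD(2)[OF T(1)] by (simp_all add: M.smult_r_distr)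
    then show "X \<odot> v \<in> plus_set (vs M) T B" "Y \<odot> v \<in> plus_set (vs M) T B"
      using T(4)[OF ab(1)] plus_set_upper(2)[OF T(1,2)] by auto
  qed
  have "direct_summand R (plus_set (vs M) A1 B1) M"
    unfolding direct_summand_iff
    using I(1) sub[OF DA(1) DB(1,4)] sub[OF DA(2) DB(2,5)] D(3-6) by blast
  moreover have "vdim K (vs M) (plus_set (vs M) A1 B1) = vdim K (vs M) A1 + vdim K (vs M) B1"
    by (rule dir_sum_vdim(1)[OF I(2) dir_sum_vdim(2)[OF I(1) fd]])
  ultimately show ?thesis using o by metis
qed

lemma submodule_ker: "submodule R (Omega S) P"
  by (rule submodule_Omega[OF sub_S subset_refl])

lemma heller: "heller_shift P M \<pi> = P\<lparr>carrier := Omega S\<rparr>"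
  by (simp add: heller_shift_def ker_eq_Omega)

lemma heller_hom_iff:
  "f \<in> module_hom R (heller_shift P M \<pi>) M \<longleftrightarrow> linear_on K (vs P) (vs M) (Omega S) f \<and>
    (\<forall>v\<in>Omega S. f (X \<odot>\<^bsub>P\<^esub> v) = X \<odot> f v \<and> f (Y \<odot>\<^bsub>P\<^esub> v) = Y \<odot> f v)"
proof -
  interpret H: char2_module K "P\<lparr>carrier := Omega S\<rparr>"
    by (intro char2_module.intro char2_field_axioms P.submoduleD(6)[OF submodule_ker])
  show ?thesis
    unfolding heller H.module_hom_iff[OF M.module_axioms] by (simp add: linear_on_def)
qed

text \<open>On \<open>A1\<close>, where \<open>Y\<close> is invertible, an element \<open>Xp1 + Yp2 + XYp3\<close> of the Heller shift is
  determined by \<open>p1\<close> and \<open>p3\<close>; on \<open>A2\<close>, where \<open>X\<close> is invertible, by \<open>p2\<close> and \<open>p3\<close>.\<close>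
lemma isomorphic_if_no_odd_split:
  assumes no: "\<not> odd_split K (vs M) (vs M) A rad (\<lambda>v. X \<odot> v) (\<lambda>v. Y \<odot> v)"
  shows "isomorphic_modules R (heller_shift P M \<pi>) M"
proof -
  obtain A1 A2 where A12: "dir_sum K (vs M) A A1 A2"
    and B12: "dir_sum K (vs M) rad ((\<lambda>v. Y \<odot> v) ` A1) ((\<lambda>v. X \<odot> v) ` A2)"
    and inj: "inj_on (\<lambda>v. Y \<odot> v) A1" "inj_on (\<lambda>v. X \<odot> v) A2"
    and sub: "(\<lambda>v. X \<odot> v) ` A1 \<subseteq> (\<lambda>v. Y \<odot> v) ` A1" "(\<lambda>v. Y \<odot> v) ` A2 \<subseteq> (\<lambda>v. X \<odot> v) ` A2"
    using no_odd_split_decomposition[OF kron_A no] by blast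
  note D = dir_sumD[OF A12, simplified]
  note A12' = dir_sum_commute[OF A12]
  let ?p = "proj (vs M) A1 A2" and ?q = "proj (vs M) A2 A1"
  have pc: "?p a \<in> A1" "?q a \<in> A2" if "a \<in> A" for a
    using proj_closed[OF A12 that] proj_closed[OF A12' that] .
  have pM: "?p a \<in> carrier M" "?q a \<in> carrier M" if "a \<in> A" for a
    using pc[OF that] D(4,5) A_closed by auto
  have psum: "?p a \<oplus> ?q a = a" if "a \<in> A" for a using proj_sum[OF A12 that] by simp
  have pz: "?p \<zero> = \<zero>" "?q \<zero> = \<zero>"
    using linear_on_zero(1)[OF dir_sumD(3)[OF A12] vectorspace_vs linear_on_proj[OF A12]]
      linear_on_zero(1)[OF dir_sumD(3)[OF A12] vectorspace_vs linear_on_proj[OF A12']] by simp_all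
  \<comment> \<open>On the \<open>A1\<close> part, v = Xp1 + Yp2 + XYp3 goes to \<pi> p1 + Y \<pi>
    p3. Then Yv = XYp1 goes to Y \<pi> p1 as it should, and Xv = XYp2 goes to Y \<pi> p2, which is X
    \<pi> p1 by the defining relation. On the \<open>A2\<close> part \<open>X\<close> and
    \<open>Y\<close> exchange roles.\<close>
  define \<psi> where "\<psi> v = (?p (\<pi> (c1 v)) \<oplus> ?q (\<pi> (c2 v))) \<oplus>
    (Y \<odot> ?p (\<pi> (c3 v)) \<oplus> X \<odot> ?q (\<pi> (c3 v)))" for v
  have \<psi>_comb: "\<psi> (comb p1 p2 p3) = (?p (\<pi> p1) \<oplus> ?q (\<pi> p2)) \<oplus> (Y \<odot> ?p (\<pi> p3) \<oplus> X \<odot> ?q (\<pi> p3))"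
    if "p1 \<in> S" "p2 \<in> S" "p3 \<in> S" for p1 p2 p3
    using that by (simp add: \<psi>_def coord_comb)
  \<comment> \<open>As X A1 lies in Y A1 and Y A2 in X A2, the two components of the relation lie in
    complementary summands of the radical. Each vanishes, and in characteristic 2 its two terms
    agree.\<close>
  have rel: "X \<odot> ?p a = Y \<odot> ?p b" "X \<odot> ?q a = Y \<odot> ?q b"
    if ab: "a \<in> A" "b \<in> A" "X \<odot> a \<oplus> Y \<odot> b = \<zero>" for a b
  proof -
    note c = pM[OF ab(1)] pM[OF ab(2)]
    have "X \<odot> a \<oplus> Y \<odot> b = X \<odot> (?p a \<oplus> ?q a) \<oplus> Y \<odot> (?p b \<oplus> ?q b)"
      using psum ab(1,2) by simp
    also have "\<dots> = (X \<odot> ?p a \<oplus> Y \<odot> ?p b) \<oplus> (X \<odot> ?q a \<oplus> Y \<odot> ?q b)"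
      using c by (simp add: M.smult_r_distr M.a_ac)
    finally have "(X \<odot> ?p a \<oplus> Y \<odot> ?p b) \<oplus>\<^bsub>vs M\<^esub> (X \<odot> ?q a \<oplus> Y \<odot> ?q b) = \<zero>\<^bsub>vs M\<^esub>"
      using ab(3) by simp
    moreover have "X \<odot> ?p a \<oplus> Y \<odot> ?p b \<in> (\<lambda>v. Y \<odot> v) ` A1"
      using subspaceD(4)[OF dir_sumD(1)[OF B12] subsetD[OF sub(1) imageI[OF pc(1)[OF ab(1)]]] imageI[OF pc(1)[OF ab(2)]]] by simp
    moreover have "X \<odot> ?q a \<oplus> Y \<odot> ?q b \<in> (\<lambda>v. X \<odot> v) ` A2"
      using subspaceD(4)[OF dir_sumD(2)[OF B12] imageI[OF pc(2)[OF ab(1)]] subsetD[OF sub(2) imageI[OF pc(2)[OF ab(2)]]]] by simp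
    ultimately have "X \<odot> ?p a \<oplus> Y \<odot> ?p b = \<zero>" "X \<odot> ?q a \<oplus> Y \<odot> ?q b = \<zero>"
      using dir_sum_eq_zero[OF B12] by auto
    then show "X \<odot> ?p a = Y \<odot> ?p b" "X \<odot> ?q a = Y \<odot> ?q b"
      using M_add_eq_zero_iff c by auto
  qed
  note OC = Omega_combs[OF subset_refl]
  have coordS: "c1 v \<in> S \<and> c2 v \<in> S \<and> c3 v \<in> S" if "v \<in> Omega S" for v
    using that by (elim OmegaE) (simp add: coord_comb)
  have lin_c: "linear_on K (vs P) (vs M) (Omega S) (\<lambda>v. g (\<pi> (c v)))"
    if "c \<in> {c1, c2, c3}" "linear_on K (vs M) (vs M) A g" for c g
  proof (rule linear_on_compose[OF linear_on_compose[OF _ linear_\<pi>_S] that(2)])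
    show "linear_on K (vs P) (vs P) (Omega S) c"
      using that(1) linear_coord linear_on_subset[OF _ OC] by auto
  qed (use that(1) coordS \<pi>_in_A in auto)
  have lin_X: "linear_on K (vs M) (vs M) A (\<lambda>v. X \<odot> ?q v)" "linear_on K (vs M) (vs M) A (\<lambda>v. Y \<odot> ?p v)"
    using linear_on_compose[OF linear_on_proj[OF A12'] linear_on_smult[OF X_closed]]
      linear_on_compose[OF linear_on_proj[OF A12] linear_on_smult[OF Y_closed]] pM by blast+
  have lin: "linear_on K (vs P) (vs M) (Omega S) \<psi>"
    using linear_on_add[OF vectorspace_vs
        linear_on_add[OF vectorspace_vs lin_c[of c1, OF _ linear_on_proj[OF A12]] lin_c[of c2, OF _ linear_on_proj[OF A12']]]
        linear_on_add[OF vectorspace_vs lin_c[of c3, OF _ lin_X(2)] lin_c[of c3, OF _ lin_X(1)]]]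
    by (simp add: \<psi>_def[abs_def])
  have hom: "\<psi> (X \<odot>\<^bsub>P\<^esub> v) = X \<odot> \<psi> v \<and> \<psi> (Y \<odot>\<^bsub>P\<^esub> v) = Y \<odot> \<psi> v" if "v \<in> Omega S" for v
    using that
  proof (rule OmegaE)
    fix p1 p2 p3 assume p: "p1 \<in> S" "p2 \<in> S" "p3 \<in> S" "v = comb p1 p2 p3" "X \<odot> \<pi> p1 \<oplus> Y \<odot> \<pi> p2 = \<zero>"
    note c = pM[OF \<pi>_in_A[OF p(1)]] pM[OF \<pi>_in_A[OF p(2)]] pM[OF \<pi>_in_A[OF p(3)]]
    have "\<psi> (X \<odot>\<^bsub>P\<^esub> v) = Y \<odot> ?p (\<pi> p2) \<oplus> X \<odot> ?q (\<pi> p2)"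
      "\<psi> (Y \<odot>\<^bsub>P\<^esub> v) = Y \<odot> ?p (\<pi> p1) \<oplus> X \<odot> ?q (\<pi> p1)"
      using p c by (simp_all add: comb_XY \<psi>_comb S_closed(2) pz)
    moreover have "X \<odot> \<psi> v = X \<odot> ?p (\<pi> p1) \<oplus> X \<odot> ?q (\<pi> p2)"
      "Y \<odot> \<psi> v = Y \<odot> ?p (\<pi> p1) \<oplus> Y \<odot> ?q (\<pi> p2)"
      using p c by (simp_all add: \<psi>_comb M.smult_r_distr YX_smult XY_zero)
    ultimately show ?thesis using rel[OF \<pi>_in_A[OF p(1)] \<pi>_in_A[OF p(2)] p(5)] by simp
  qed
  note sO = P.submoduleD(1)[OF submodule_ker] and fO = vdim_Omega[OF fin_S subset_refl]
  have inj_\<psi>: "inj_on \<psi> (Omega S)"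
    unfolding linear_on_inj_iff[OF sO vectorspace_vs lin]
  proof (intro ballI impI)
    fix v assume "v \<in> Omega S" and v0: "\<psi> v = \<zero>\<^bsub>vs M\<^esub>"
    from this(1) show "v = \<zero>\<^bsub>vs P\<^esub>"
    proof (rule OmegaE)
      fix p1 p2 p3 assume p: "p1 \<in> S" "p2 \<in> S" "p3 \<in> S" "v = comb p1 p2 p3" "X \<odot> \<pi> p1 \<oplus> Y \<odot> \<pi> p2 = \<zero>"
      note a = p(1-3)[THEN \<pi>_in_A]
      note c = pM[OF a(1)] pM[OF a(2)] pM[OF a(3)]
      have "?p (\<pi> p1) \<oplus> ?q (\<pi> p2) \<in> A"
        using subspaceD(4)[OF A_dir(1)] pc a D(4,5) by (simp add: subset_iff)
      moreover have "Y \<odot> ?p (\<pi> p3) \<oplus> X \<odot> ?q (\<pi> p3) \<in> rad"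
        using plus_setI[OF imageI[OF pc(1)[OF a(3)]] imageI[OF pc(2)[OF a(3)]], of "vs M" "\<lambda>v. Y \<odot> v" "\<lambda>v. X \<odot> v"]
          dir_sumD(7)[OF B12] by simp
      ultimately have 0: "?p (\<pi> p1) \<oplus> ?q (\<pi> p2) = \<zero>" "Y \<odot> ?p (\<pi> p3) \<oplus> X \<odot> ?q (\<pi> p3) = \<zero>"
        using dir_sum_eq_zero[OF A, simplified] v0 \<psi>_comb[OF p(1-3)] p(4) by auto
      have 1: "?p (\<pi> p1) = \<zero>" "?q (\<pi> p2) = \<zero>"
        using dir_sum_eq_zero[OF A12 pc(1)[OF a(1)] pc(2)[OF a(2)]] 0(1) by auto
      have Y3: "Y \<odot> ?p (\<pi> p3) = \<zero>" "X \<odot> ?q (\<pi> p3) = \<zero>"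
        using dir_sum_eq_zero[OF B12 imageI[OF pc(1)[OF a(3)]] imageI[OF pc(2)[OF a(3)]]] 0(2) by auto
      have injY: "a = \<zero>" if "a \<in> A1" "Y \<odot> a = \<zero>" for a
        using inj_onD[OF inj(1) _ that(1) subspaceD(3)[OF D(1)]] that(2) by simp
      have injX: "a = \<zero>" if "a \<in> A2" "X \<odot> a = \<zero>" for a
        using inj_onD[OF inj(2) _ that(1) subspaceD(3)[OF D(2)]] that(2) by simp
      note r = rel[OF a(1,2) p(5)]
      have "?p (\<pi> p2) = \<zero>" using injY[OF pc(1)[OF a(2)]] r(1) 1(1) by simp
      moreover have "?q (\<pi> p1) = \<zero>" using injX[OF pc(2)[OF a(1)]] r(2) 1(2) by simp
      moreover have "?p (\<pi> p3) = \<zero>" "?q (\<pi> p3) = \<zero>"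
        using injY[OF pc(1)[OF a(3)]] injX[OF pc(2)[OF a(3)]] Y3 by auto
      moreover have "a = \<zero>" if "a \<in> A" "?p a = \<zero>" "?q a = \<zero>" for a
        using psum[OF that(1)] unfolding that(2,3) by simp
      ultimately have "\<pi> p1 = \<zero>" "\<pi> p2 = \<zero>" "\<pi> p3 = \<zero>"
        using a 1 by blast+
      then have "p1 = \<zero>\<^bsub>P\<^esub>" "p2 = \<zero>\<^bsub>P\<^esub>" "p3 = \<zero>\<^bsub>P\<^esub>" using \<pi>_eq_zero p(1-3) by auto
      then show ?thesis using p(4) by (simp add: comb_def)
    qed
  qed
  \<comment> \<open>The two injective maps give dim rad = dim A, so the shift has dimension 3 dim A
    - dim A = dim M, and injectivity suffices.\<close>
  have "vdim K (vs M) rad = vdim K (vs M) A"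
  proof -
    note f12 = dir_sum_vdim[OF A12 fin_A]
    have "linear_on K (vs M) (vs M) A1 (\<lambda>v. Y \<odot> v)" "linear_on K (vs M) (vs M) A2 (\<lambda>v. X \<odot> v)"
      using linear_on_subset[OF linear_on_smult] D(4,5) A_dir(4) by (meson X_closed Y_closed subset_trans)+
    then show ?thesis
      using dir_sum_vdim(1)[OF B12 fin_rad] f12(1) vdim_image_inj[OF f12(2) vectorspace_vs _ inj(1)]
        vdim_image_inj[OF f12(3) vectorspace_vs _ inj(2)] by simp
  qed
  then have "vdim K (vs M) (carrier M) = vdim K (vs P) (Omega S)"
    using dir_sum_vdim(1)[OF A fd] fO(2) gen_S vdim_S by simp
  then have "\<psi> ` Omega S = carrier M"
    using subspace_eqI[OF fd subspace_image[OF sO vectorspace_vs lin]] linear_onD(1)[OF lin]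
      vdim_image_inj[OF fO(1) vectorspace_vs lin inj_\<psi>] by auto
  then have "bij_betw \<psi> (carrier (heller_shift P M \<pi>)) (carrier M)"
    using inj_\<psi> by (simp add: heller bij_betw_def)
  moreover have "\<psi> \<in> module_hom R (heller_shift P M \<pi>) M"
    unfolding heller_hom_iff using lin hom by blast
  ultimately show ?thesis unfolding isomorphic_modules_def by blast
qed

end

context char2_lift
begin

section \<open>Decompositions of the Heller shift\<close>

lemma gen_eq_radical:
  assumes T: "T \<subseteq> S" and U: "dir_sum K (vs M) U (\<pi> ` T) (radical U)" "U \<subseteq> carrier M"
  shows "gen T = radical U"
  using gen_eq[OF T] radical_generated[OF U] by simp

lemma Omega_mono: "T \<subseteq> T' \<Longrightarrow> Omega T \<subseteq> Omega T'"
  unfolding Omega_def by blast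

text \<open>Uniqueness of coordinates makes the sum direct. For an element of \<open>Omega S\<close>
  the two components of its relation lie in \<open>U\<close> and in \<open>W\<close>, so they vanish
  separately.\<close>

lemma Omega_dir_sum:
  assumes ST: "dir_sum K (vs P) S S1 S2" and UW: "dir_sum K (vs M) (carrier M) U W"
    and gen: "gen S1 \<subseteq> U" "gen S2 \<subseteq> W"
  shows "dir_sum K (vs P) (Omega S) (Omega S1) (Omega S2)"
proof -
  note D = dir_sumD[OF ST, simplified]
  show ?thesis
  proof (rule dir_sumI)
    show "subspace K (Omega S1) (vs P)" "subspace K (Omega S2) (vs P)" "subspace K (Omega S) (vs P)"
      using submodule_Omega D(1,2,4,5) sub_S P.submoduleD(1) by auto
    show "Omega S1 \<subseteq> Omega S" "Omega S2 \<subseteq> Omega S" using Omega_mono D(4,5) by auto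
    fix v assume "v \<in> Omega S1" "v \<in> Omega S2"
    then obtain p1 p2 p3 q1 q2 q3 where p: "p1 \<in> S1" "p2 \<in> S1" "p3 \<in> S1" "v = comb p1 p2 p3"
      and q: "q1 \<in> S2" "q2 \<in> S2" "q3 \<in> S2" "v = comb q1 q2 q3"
      by (elim OmegaE)
    have "p1 = q1 \<and> p2 = q2 \<and> p3 = q3"
      by (rule comb_inject) (use p q D(4,5) in auto)
    then have "p1 = \<zero>\<^bsub>P\<^esub>" "p2 = \<zero>\<^bsub>P\<^esub>" "p3 = \<zero>\<^bsub>P\<^esub>" using D(6) p q by auto
    then show "v = \<zero>\<^bsub>vs P\<^esub>" using p(4) by (simp add: comb_def)
  next
    fix v assume "v \<in> Omega S"
    then obtain p1 p2 p3 where p: "p1 \<in> S" "p2 \<in> S" "p3 \<in> S" "v = comb p1 p2 p3"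
      and 0: "X \<odot> \<pi> p1 \<oplus> Y \<odot> \<pi> p2 = \<zero>" by (elim OmegaE)
    obtain u1 w1 where 1: "u1 \<in> S1" "w1 \<in> S2" "p1 = u1 \<oplus>\<^bsub>P\<^esub> w1" using D(8)[OF p(1)] by blast
    obtain u2 w2 where 2: "u2 \<in> S1" "w2 \<in> S2" "p2 = u2 \<oplus>\<^bsub>P\<^esub> w2" using D(8)[OF p(2)] by blast
    obtain u3 w3 where 3: "u3 \<in> S1" "w3 \<in> S2" "p3 = u3 \<oplus>\<^bsub>P\<^esub> w3" using D(8)[OF p(3)] by blast
    have inS: "u1 \<in> S" "u2 \<in> S" "u3 \<in> S" "w1 \<in> S" "w2 \<in> S" "w3 \<in> S" using 1 2 3 D(4,5) by auto
    note c = inS[THEN S_closed(1)]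
    let ?u = "X \<odot> \<pi> u1 \<oplus> Y \<odot> \<pi> u2" and ?w = "X \<odot> \<pi> w1 \<oplus> Y \<odot> \<pi> w2"
    have "X \<odot> \<pi> p1 \<oplus> Y \<odot> \<pi> p2 = ?u \<oplus> ?w"
      unfolding 1(3) 2(3) using c by (simp add: M.smult_r_distr M.a_ac)
    then have "?u \<oplus>\<^bsub>vs M\<^esub> ?w = \<zero>\<^bsub>vs M\<^esub>" using 0 by simp
    moreover have "?u \<in> gen S1" "?w \<in> gen S2" using 1 2 by (auto simp: gen_def plus_set_def)
    ultimately have "?u = \<zero>" "?w = \<zero>"
      using dir_sum_eq_zero[OF UW subsetD[OF gen(1)] subsetD[OF gen(2)]] by simp_all
    then have "comb u1 u2 u3 \<in> Omega S1" "comb w1 w2 w3 \<in> Omega S2"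
      using OmegaI 1 2 3 by auto
    moreover have "v = comb u1 u2 u3 \<oplus>\<^bsub>vs P\<^esub> comb w1 w2 w3"
      using comb_add inS p(4) 1(3) 2(3) 3(3) by simp
    ultimately show "\<exists>a1\<in>Omega S1. \<exists>a2\<in>Omega S2. v = a1 \<oplus>\<^bsub>vs P\<^esub> a2" by blast
  qed
qed

lemma submodule_hom_image:
  assumes f: "f \<in> module_hom R (heller_shift P M \<pi>) M" and U: "submodule R U P" "U \<subseteq> Omega S"
  shows "submodule R (f ` U) M"
proof -
  note u = P.submoduleD[OF U(1)]
  have F: "linear_on K (vs P) (vs M) (Omega S) f"
    "\<And>v. v \<in> Omega S \<Longrightarrow> f (X \<odot>\<^bsub>P\<^esub> v) = X \<odot> f v" "\<And>v. v \<in> Omega S \<Longrightarrow> f (Y \<odot>\<^bsub>P\<^esub> v) = Y \<odot> f v"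
    using f unfolding heller_hom_iff by auto
  show ?thesis
    unfolding submodule_iff
    using subspace_image[OF u(1) vectorspace_vs linear_on_subset[OF F(1) U(2)]] u(2,3) F(2,3) U(2)
    by (auto simp: subset_iff simp flip: F(2,3))
qed

end

context char2_cover
begin

section \<open>Iterating an isomorphism between the Heller shift and the module\<close>

lemma rad_eq_plus_radical:
  assumes UW: "dir_sum K (vs M) (carrier M) U W"
  shows "rad = plus_set (vs M) (radical U) (radical W)"
proof (intro equalityI subsetI)
  note D = dir_sumD[OF UW, simplified]
  fix v assume "v \<in> rad"
  then obtain m n where mn: "m \<in> carrier M" "n \<in> carrier M" "v = X \<odot> m \<oplus> Y \<odot> n"
    by (auto simp: radical_def plus_set_def)
  obtain u w where m: "u \<in> U" "w \<in> W" "m = u \<oplus> w" using D(8)[OF mn(1)] by blast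
  obtain u' w' where n: "u' \<in> U" "w' \<in> W" "n = u' \<oplus> w'" using D(8)[OF mn(2)] by blast
  have c: "u \<in> carrier M" "w \<in> carrier M" "u' \<in> carrier M" "w' \<in> carrier M" using m n D(4,5) by auto
  have "v = (X \<odot> u \<oplus> Y \<odot> u') \<oplus>\<^bsub>vs M\<^esub> (X \<odot> w \<oplus> Y \<odot> w')"
    unfolding mn(3) m(3) n(3) using c by (simp add: M.smult_r_distr M.a_ac)
  moreover have "X \<odot> u \<oplus> Y \<odot> u' \<in> radical U" "X \<odot> w \<oplus> Y \<odot> w' \<in> radical W"
    using m n by (auto simp: radical_def plus_set_def)
  ultimately show "v \<in> plus_set (vs M) (radical U) (radical W)" by (metis plus_setI)
next
  note D = dir_sumD[OF UW, simplified]
  fix v assume "v \<in> plus_set (vs M) (radical U) (radical W)"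
  then show "v \<in> rad"
    using plus_set_least[OF subspace_radical[OF subspace_carrier_M] radical_mono[OF D(4)] radical_mono[OF D(5)]] by blast
qed

text \<open>The kernel of the cover is the sum of the shifts of \<open>U\<close> and
  \<open>W\<close>, and the isomorphism turns this into a new decomposition of \<open>M\<close>. For
  the last inequality, the radical of the shift of \<open>W\<close> lies in the
  \<open>XY\<close>-multiples of the cover of \<open>W\<close>, a space of dimension dim W - dim rad
  W.\<close>

lemma heller_step:
  assumes f: "f \<in> module_hom R (heller_shift P M \<pi>) M" "bij_betw f (carrier (heller_shift P M \<pi>)) (carrier M)"
    and U: "submodule R U M" and W: "submodule R W M" and UW: "dir_sum K (vs M) (carrier M) U W"
  obtains U' W' where "submodule R U' M" "submodule R W' M" "dir_sum K (vs M) (carrier M) U' W'"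
    "vdim K (vs M) U' + 4 * vdim K (vs M) (radical U) = 3 * vdim K (vs M) U"
    "vdim K (vs M) W' + 4 * vdim K (vs M) (radical W) = 3 * vdim K (vs M) W"
    "vdim K (vs M) (radical W') + vdim K (vs M) (radical W) \<le> vdim K (vs M) W"
proof -
  note D = dir_sumD[OF UW, simplified] and fUW = dir_sum_vdim[OF UW fd]
  obtain AU where "dir_sum K (vs M) U (radical U) AU"
    using complement_exists[OF fUW(2) subspace_radical[OF D(1)] radical_subset[OF U]] .
  then have AU: "dir_sum K (vs M) U AU (radical U)" by (rule dir_sum_commute)
  obtain AW where "dir_sum K (vs M) W (radical W) AW"
    using complement_exists[OF fUW(3) subspace_radical[OF D(2)] radical_subset[OF W]] .
  then have AW: "dir_sum K (vs M) W AW (radical W)" by (rule dir_sum_commute)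
  \<comment> \<open>The complement of the radical is chosen along \<open>U\<close> and
    \<open>W\<close>, so that its lift splits in the same way.\<close>
  define A where "A = plus_set (vs M) AU AW"
  have A: "dir_sum K (vs M) (carrier M) A rad" and A_split: "dir_sum K (vs M) A AU AW"
    using dir_sum_interchange[OF UW AU AW] unfolding A_def rad_eq_plus_radical[OF UW] .
  obtain S where S: "lift A S" using lift_exists[OF A] .
  interpret char2_lift K M P \<pi> A S by unfold_locales (fact A S)+
  have i: "linear_on K (vs M) (vs P) A (inv_into S \<pi>)" "inj_on (inv_into S \<pi>) A" "inv_into S \<pi> ` A = S"
    using linear_on_inv[OF sub_S vectorspace_vs linear_\<pi>_S inj_\<pi>] \<pi>_S inj_\<pi>
    by (auto simp: inj_on_inv_into inv_into_image_cancel)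
  define SU SW where "SU = inv_into S \<pi> ` AU" and "SW = inv_into S \<pi> ` AW"
  have S_split: "dir_sum K (vs P) S SU SW"
    using dir_sum_image[OF A_split P.vectorspace_vs i(1,2)] i(3) by (simp add: SU_def SW_def)
  note DS = dir_sumD[OF S_split, simplified] and fS = dir_sum_vdim[OF S_split fin_S]
  note DA = dir_sumD[OF A_split, simplified]
  have \<pi>SU: "\<pi> ` SU = AU" "\<pi> ` SW = AW"
    unfolding SU_def SW_def using \<pi>_S DA(4,5) by (auto simp: image_image f_inv_into_f subset_iff cong: image_cong)
  have dimS: "vdim K (vs P) SU = vdim K (vs M) AU" "vdim K (vs P) SW = vdim K (vs M) AW"
    using vdim_image_inj[OF fS(2) vectorspace_vs linear_on_subset[OF linear_\<pi>_S DS(4)] inj_on_subset[OF inj_\<pi> DS(4)]]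
      vdim_image_inj[OF fS(3) vectorspace_vs linear_on_subset[OF linear_\<pi>_S DS(5)] inj_on_subset[OF inj_\<pi> DS(5)]]
    unfolding \<pi>SU by simp_all
  have gen: "gen SU = radical U" "gen SW = radical W"
    using gen_eq_radical[OF DS(4)] gen_eq_radical[OF DS(5)] AU AW D(4,5) \<pi>SU by auto
  have dimO: "vdim K (vs P) (Omega SU) + 4 * vdim K (vs M) (radical U) = 3 * vdim K (vs M) U"
    "vdim K (vs P) (Omega SW) + 4 * vdim K (vs M) (radical W) = 3 * vdim K (vs M) W"
    using vdim_Omega(2)[OF fS(2) DS(4)] vdim_Omega(2)[OF fS(3) DS(5)] gen dimS
      dir_sum_vdim(1)[OF AU fUW(2)] dir_sum_vdim(1)[OF AW fUW(3)] by simp_all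
  have O_split: "dir_sum K (vs P) (Omega S) (Omega SU) (Omega SW)"
    by (rule Omega_dir_sum[OF S_split UW]) (use gen radical_subset[OF U] radical_subset[OF W] in auto)
  note DO = dir_sumD[OF O_split, simplified] and fO = dir_sum_vdim[OF O_split vdim_Omega(1)[OF fin_S subset_refl]]
  have F: "linear_on K (vs P) (vs M) (Omega S) f"
    "\<And>v. v \<in> Omega S \<Longrightarrow> f (X \<odot>\<^bsub>P\<^esub> v) = X \<odot> f v" "\<And>v. v \<in> Omega S \<Longrightarrow> f (Y \<odot>\<^bsub>P\<^esub> v) = Y \<odot> f v"
    using f(1) unfolding heller_hom_iff by auto
  have bij: "inj_on f (Omega S)" "f ` Omega S = carrier M" using f(2) by (auto simp: heller bij_betw_def)
  have dim_f: "vdim K (vs M) (f ` T) = vdim K (vs P) T" if "fin_sub K (vs P) T" "T \<subseteq> Omega S" for T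
    by (rule vdim_image_inj[OF that(1) vectorspace_vs linear_on_subset[OF F(1) that(2)] inj_on_subset[OF bij(1) that(2)]])
  show thesis
  proof (rule that[of "f ` Omega SU" "f ` Omega SW"])
    show sub: "submodule R (f ` Omega SU) M" "submodule R (f ` Omega SW) M"
      using submodule_hom_image[OF f(1)] submodule_Omega DS DO(4,5) by auto
    show "dir_sum K (vs M) (carrier M) (f ` Omega SU) (f ` Omega SW)"
      using dir_sum_image[OF O_split vectorspace_vs F(1) bij(1)] bij(2) by simp
    show "vdim K (vs M) (f ` Omega SU) + 4 * vdim K (vs M) (radical U) = 3 * vdim K (vs M) U"
      "vdim K (vs M) (f ` Omega SW) + 4 * vdim K (vs M) (radical W) = 3 * vdim K (vs M) W"
      using dimO dim_f fO(2,3) DO(4,5) by simp_all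
    let ?XY = "(\<lambda>p. X \<odot>\<^bsub>P\<^esub> (Y \<odot>\<^bsub>P\<^esub> p)) ` SW"
    note xy = XY_image[OF fS(3) DS(5)]
    have in_SW: "p \<in> S" if "p \<in> SW" for p using that DS(5) by auto
    have XY_eq: "X \<odot>\<^bsub>P\<^esub> (Y \<odot>\<^bsub>P\<^esub> p) = comb \<zero>\<^bsub>P\<^esub> \<zero>\<^bsub>P\<^esub> p" if "p \<in> SW" for p
      using S_closed(1)[OF in_SW[OF that]] by (simp add: comb_def)
    have XYO: "?XY \<subseteq> Omega S"
      using XY_eq OmegaI[OF S_closed(2) S_closed(2)] in_SW by auto
    \<comment> \<open>\<open>X\<close> sends \<open>comb p1 p2 p3\<close> to XY p2, and
      \<open>Y\<close> sends it to XY p1.\<close>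
    have X: "X \<odot>\<^bsub>P\<^esub> v \<in> ?XY" "Y \<odot>\<^bsub>P\<^esub> v \<in> ?XY" if "v \<in> Omega SW" for v
      using that by (auto elim!: OmegaE simp: comb_XY in_SW simp flip: XY_eq)
    have "radical (f ` Omega SW) \<subseteq> f ` ?XY"
      unfolding radical_def
    proof (rule plus_set_least[OF subspace_image[OF fin_subD(1)[OF xy(1)] vectorspace_vs linear_on_subset[OF F(1) XYO]]])
      show "(\<lambda>v. X \<odot> v) ` f ` Omega SW \<subseteq> f ` ?XY" "(\<lambda>v. Y \<odot> v) ` f ` Omega SW \<subseteq> f ` ?XY"
        using X F(2,3) DO(5) by (auto simp: subset_iff simp flip: F(2,3))
    qed
    moreover have "fin_sub K (vs M) (f ` ?XY)"
      by (rule rank_nullity(1)[OF xy(1) vectorspace_vs linear_on_subset[OF F(1) XYO]])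
    ultimately have "vdim K (vs M) (radical (f ` Omega SW)) \<le> vdim K (vs M) (f ` ?XY)"
      using fin_sub_mono(2) subspace_radical submoduleD(1)[OF sub(2)] by blast
    also have "\<dots> = vdim K (vs M) AW" using dim_f[OF xy(1) XYO] xy(2) dimS(2) by simp
    finally show "vdim K (vs M) (radical (f ` Omega SW)) + vdim K (vs M) (radical W) \<le> vdim K (vs M) W"
      using dir_sum_vdim(1)[OF AW fUW(3)] by simp
  qed
qed

text \<open>A summand \<open>W\<close> with \<open>dim W > 2 dim (rad W)\<close> would produce, by iterating the isomorphism
  between the Heller shift and \<open>M\<close>, summands of unbounded dimension.\<close>
lemma vdim_le_radical:
  assumes f: "f \<in> module_hom R (heller_shift P M \<pi>) M" "bij_betw f (carrier (heller_shift P M \<pi>)) (carrier M)"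
    and "submodule R U M" "submodule R W M" "dir_sum K (vs M) (carrier M) U W"
  shows "vdim K (vs M) W \<le> 2 * vdim K (vs M) (radical W)"
  using assms(3-)
proof (induction "vdim K (vs M) (carrier M) - vdim K (vs M) W" arbitrary: U W rule: less_induct)
  case less
  show ?case
  proof (rule ccontr)
    assume neg: "\<not> vdim K (vs M) W \<le> 2 * vdim K (vs M) (radical W)"
    obtain U' W' where s: "submodule R U' M" "submodule R W' M" "dir_sum K (vs M) (carrier M) U' W'"
      and d: "vdim K (vs M) W' + 4 * vdim K (vs M) (radical W) = 3 * vdim K (vs M) W"
      "vdim K (vs M) (radical W') + vdim K (vs M) (radical W) \<le> vdim K (vs M) W"
      using heller_step[OF f less.prems] by metis
    have "vdim K (vs M) W' \<le> vdim K (vs M) (carrier M)" using dir_sum_vdim(1)[OF s(3) fd] by simp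
    \<comment> \<open>Put d = dim W - 2 dim rad W > 0. Then dim W' = dim W + 2d, so the induction
      hypothesis applies to \<open>W'\<close>; but the second inequality of \<open>d\<close> gives
      dim W' - 2 dim rad W' >= d.\<close>
    then have "vdim K (vs M) W' \<le> 2 * vdim K (vs M) (radical W')"
      using less.hyps[OF _ s] d(1) neg by linarith
    then show False using d neg by linarith
  qed
qed

lemma even_summands_if_isomorphic:
  assumes "isomorphic_modules R (heller_shift P M \<pi>) M" and U: "direct_summand R U M"
  shows "even (vdim K (vs M) U)"
proof -
  obtain f where f: "f \<in> module_hom R (heller_shift P M \<pi>) M" "bij_betw f (carrier (heller_shift P M \<pi>)) (carrier M)"
    using assms(1) unfolding isomorphic_modules_def by blast
  obtain W where UW: "submodule R U M" "submodule R W M" "dir_sum K (vs M) (carrier M) U W"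
    using U unfolding direct_summand_iff by blast
  note WU = UW(2,1) dir_sum_commute[OF UW(3)]
  obtain U' W' where "dir_sum K (vs M) (carrier M) U' W'"
    "vdim K (vs M) U' + 4 * vdim K (vs M) (radical U) = 3 * vdim K (vs M) U"
    "vdim K (vs M) W' + 4 * vdim K (vs M) (radical W) = 3 * vdim K (vs M) W"
    using heller_step[OF f UW] by metis
  moreover have "vdim K (vs M) U' + vdim K (vs M) W' = vdim K (vs M) U + vdim K (vs M) W"
    using dir_sum_vdim(1)[OF _ fd] calculation(1) UW(3) by metis
  moreover note vdim_le_radical[OF f UW] vdim_le_radical[OF f WU]
  \<comment> \<open>Adding the two equations gives dim U + dim W = 2 dim rad U + 2 dim rad W.
    Neither summand exceeds twice its radical in dimension, so both attain it.\<close>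
  ultimately have "vdim K (vs M) U = 2 * vdim K (vs M) (radical U)" by linarith
  then show ?thesis by simp
qed

lemma even_dimensional_iff_isomorphic:
  "even_dimensional K M \<longleftrightarrow> isomorphic_modules R (heller_shift P M \<pi>) M"
proof
  assume ev: "even_dimensional K M"
  obtain A where "dir_sum K (vs M) (carrier M) rad A"
    using complement_exists[OF fd subspace_radical[OF subspace_carrier_M]] rad_closed by blast
  then have A: "dir_sum K (vs M) (carrier M) A rad" by (rule dir_sum_commute)
  obtain S where S: "lift A S" using lift_exists[OF A] .
  interpret char2_lift K M P \<pi> A S by unfold_locales (fact A S)+
  show "isomorphic_modules R (heller_shift P M \<pi>) M"
    using isomorphic_if_no_odd_split odd_split_odd_summand ev even_dimensional_iff[OF fd] by blast
next
  assume "isomorphic_modules R (heller_shift P M \<pi>) M"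
  then show "even_dimensional K M"
    using even_summands_if_isomorphic even_dimensional_iff[OF fd] by blast
qed

end

text \<open>The Heller shift is determined up to isomorphism, so \<open>P\<close> and \<pi> range
  over all minimal projective covers. Being projective-free enters through
  \<open>projective_free_XY_zero\<close>.\<close>

theorem corollary3p2:
  fixes K :: "'k ring"
    and M :: "(int \<times> int \<Rightarrow> 'k, 'm) module"
    and P :: "(int \<times> int \<Rightarrow> 'k, 'p) module"
    and \<pi> :: "'p \<Rightarrow> 'm"
  assumes "field K" and "characteristic K = 2"
    and "module (kV4 K) M" and "kV4_fin_dim K M" and "projective_free (kV4 K) M"
    and "minimal_projective_cover (kV4 K) P M \<pi>"
  shows "even_dimensional K M \<longleftrightarrow> isomorphic_modules (kV4 K) (heller_shift P M \<pi>) M"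
proof -
  interpret char2_field K using assms(1,2) by (intro char2_field.intro char2_field_axioms.intro)
  interpret char2_module K M by (intro char2_module.intro char2_field_axioms assms(3))
  interpret char2_cover K M P \<pi>
    using assms(4-6) fin_sub_carrier projective_free_XY_zero
    by unfold_locales auto
  show ?thesis by (rule even_dimensional_iff_isomorphic)
qed

end
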